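(* Let $A$ be a self-adjoint definitizable linear relation on a Krein space $(\mathcal K,[.,.])$, and let $q$ be a (not identically zero) real definitizing rational function for $A$. Let $\mathcal V$ be a Hilbert space and $T:\mathcal V\to\mathcal K$ a bounded, linear and injective mapping with $TT^+=q(A)$. Let $E$ be the spectral measure of the self-adjoint linear relation $\Theta(A)=(T\times T)^{-1}(A)$ on $\mathcal V$. For $\phi\in\mathcal F(q,A)$ let $\phi=s_{q,A}+g\cdot q_{q,A}$ be a decomposition with $s\in\mathbb C_{\rho(A)}(z)$ and $g:\sigma(A)\to\mathbb C$ bounded and Borel measurable. Then $$\phi(A):=s(A)+T\int_{\sigma(\Theta(A))} g\,dE\;T^+$$ is a bounded operator in $A''$ which does not depend on the decomposition of $\phi$. The map $\phi\mapsto\phi(A)$, $\mathcal F(q,A)\to A''\subseteq B(\mathcal K)$, is a $*$-homomorphism (with the involution $\phi\mapsto\phi^\#$ on $\mathcal F(q,A)$ and the Krein space adjoint $C\mapsto C^+$ on $A''$), and it extends the rational functional calculus, i.e. $s_{q,A}(A)=s(A)$ for all $s\in\mathbb C_{\rho(A)}(z)$.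
   Context: Linear relations. A linear relation $A$ on a vector space $X$ is a linear subspace of $X\times X$; operators are identified with their graphs. For a linear map $T:\mathcal V\to\mathcal K$ and linear relations $B$ on $\mathcal V$, $A$ on $\mathcal K$ put $(T\times T)(B)=\{(Tu;Tv):(u;v)\in B\}$ and $(T\times T)^{-1}(A)=\{(u;v)\in\mathcal V\times\mathcal V:(Tu;Tv)\in A\}$. On a Banach space $\mathcal K$, $(A-\lambda)^{-1}=\{(y-\lambda x;x):(x;y)\in A\}$ for $\lambda\in\mathbb C$, $(A-\infty)^{-1}:=A$, $\rho(A)=\{\lambda\in\mathbb C\cup\{\infty\}:(A-\lambda)^{-1}\in B(\mathcal K)\}$, $\sigma(A)=(\mathbb C\cup\{\infty\})\setminus\rho(A)$. Here $B(\mathcal K)$ is the set of bounded everywhere defined linear operators. The spectrum of the relation on $\{0\}$ is $\emptyset$. Rational functional calculus. If $\rho(A)\ne\emptyset$, $\mathbb C_{\rho(A)}(z)$ is the algebra of rational functions all of whose poles in $\mathbb C\cup\{\infty\}$ lie in $\rho(A)$. For such $r(z)=p(z)+\sum_{k}\sum_j \frac{c_{kj}}{(z-\alpha_k)^j}$ (partial fractions, $p$ a polynomial) put $r(A)=p(A)+\sum_k\sum_j c_{kj}(A-\alpha_k)^{-j}\in B(\mathcal K)$. Put $r^\#(z)=\overline{r(\bar z)}$. Krein spaces. For a bounded linear $T$ between Krein spaces, $T^+$ is the adjoint w.r.t. the Krein space inner products. For a linear relation, $A^+=\{(x;y):[x,v]=[y,u]\text{ for all }(u;v)\in A\}$; $A$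 is self-adjoint if $A=A^+$. $A$ is definitizable if $\rho(A)\neq\emptyset$ and $[q(A)x,x]\ge0$ for all $x\in\mathcal K$ for some $q\in\mathbb C_{\rho(A)}(z)$; such $q$ is called a definitizing rational function for $A$. It is real if $q^\#=q$. $A'$ denotes the set of all $C\in B(\mathcal K)$ with $(C\times C)(A)\subseteq A$, and $A''$ is the commutant of $A'$ in $B(\mathcal K)$. Spectral measure. A self-adjoint linear relation $H$ on a Hilbert space has $\sigma(H)\subseteq\mathbb R\cup\{\infty\}$ and a unique spectral measure $E$ on the Borel sets of $\mathbb R\cup\{\infty\}$ with $(H-z)^{-1}=\int_{\sigma(H)}\frac1{t-z}\,dE(t)$, $z\in\rho(H)$. In the situation of the claim, $\Theta(A)$ is self-adjoint and $\sigma(\Theta(A))\subseteq\sigma(A)$. Function classes. For $w\in\sigma(A)$ let $\mathfrak d(w)\in\mathbb N_0$ be the order of $w$ as a zero of $q$ ($0$ if $q(w)\neq0$; at $\infty$, for $q=a/b$ with polynomials $a,b$, it is $\max(0,\deg b-\deg a)$). $q^{-1}\{0\}$ is the zero set of $q$ in $\mathbb C\cup\{\infty\}$. $\mathbb C^m$ carries componentwise addition and scalar multiplication, the product $x\cdot y=(\sum_{k=0}^j x_ky_{j-k})_{j=0}^{m-1}$ and componentwise conjugation. $\mathcal M(q,A)$ is the set of all functions $\phi$ on $\sigma(A)$ with $\phi(w)=(\phi(w)_0,\dots,\phi(w)_{\mathfrak d(w)})\in\mathbb C^{\mathfrak d(w)+1}$, with pointwise operations and $\phi^\#(\lambda)=\overline{\phi(\bar\lambda)}$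 (a $*$-algebra). For $f$ defined on a set containing $\sigma(A)$ and holomorphic near each point of $q^{-1}\{0\}\cap\sigma(A)$ (in particular for $f\in\mathbb C_{\rho(A)}(z)$), $f_{q,A}\in\mathcal M(q,A)$ is $f_{q,A}(\lambda)=\big(\frac{f^{(0)}(\lambda)}{0!},\dots,\frac{f^{(\mathfrak d(\lambda))}(\lambda)}{\mathfrak d(\lambda)!}\big)$, where $f^{(j)}(\infty)$ means $h^{(j)}(0)$ for $h(z)=f(1/z)$. All entries of $q_{q,A}(w)$ except the last vanish. For $g:\sigma(A)\to\mathbb C$, $g\cdot q_{q,A}$ is the pointwise scalar multiple. Finally $\mathcal F(q,A)=\{s_{q,A}+g\cdot q_{q,A}: s\in\mathbb C_{\rho(A)}(z),\ g:\sigma(A)\to\mathbb C \text{ bounded and Borel measurable}\}$, a $*$-subalgebra of $\mathcal M(q,A)$. *)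

theory Defs
  imports "HOL-Analysis.Analysis" "HOL-Computational_Algebra.Computational_Algebra"
    "HOL-Computational_Algebra.Field_as_Ring"
begin

section \<open>Complex vector spaces, Hilbert spaces, Krein spaces\<close>

class complex_vector = ab_group_add +
  fixes scaleC :: "complex \<Rightarrow> 'a \<Rightarrow> 'a" (infixr "*\<^sub>C" 75)
  assumes scaleC_add_right: "a *\<^sub>C (x + y) = a *\<^sub>C x + a *\<^sub>C y"
    and scaleC_add_left: "(a + b) *\<^sub>C x = a *\<^sub>C x + b *\<^sub>C x"
    and scaleC_scaleC: "a *\<^sub>C b *\<^sub>C x = (a * b) *\<^sub>C x"
    and scaleC_one: "1 *\<^sub>C x = x"

abbreviation csubspace :: "'a::complex_vector set \<Rightarrow> bool"
  where "csubspace \<equiv> module.subspace scaleC"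

instantiation prod :: (complex_vector, complex_vector) complex_vector
begin

definition scaleC_prod_def: "scaleC a p = (a *\<^sub>C fst p, a *\<^sub>C snd p)"

instance
  by standard
    (simp_all add: scaleC_prod_def scaleC_add_right scaleC_add_left scaleC_scaleC scaleC_one)

end

class complex_normed_vector = complex_vector + real_normed_vector +
  assumes scaleR_eq_scaleC: "r *\<^sub>R x = complex_of_real r *\<^sub>C x"
    and norm_scaleC: "norm (a *\<^sub>C x) = cmod a * norm x"

class complex_banach = complex_normed_vector + complete_space

text \<open>All inner products are linear in the first and conjugate linear in the second argument.\<close>

class complex_inner = complex_normed_vector +
  fixes cinner :: "'a \<Rightarrow> 'a \<Rightarrow> complex"
  assumes cinner_add_left: "cinner (x + y) z = cinner x z + cinner y z"
    and cinner_scaleC_left: "cinner (a *\<^sub>C x) y = a * cinner x y"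
    and cinner_commute: "cinner y x = cnj (cinner x y)"
    and cinner_nonneg: "cinner x x \<in> \<real>\<^sub>\<ge>\<^sub>0"
    and norm_eq_sqrt_cinner: "norm x = sqrt (Re (cinner x x))"

class complex_hilbert = complex_inner + complete_space

definition hermitian_form :: "('a::complex_vector \<Rightarrow> 'a \<Rightarrow> complex) \<Rightarrow> bool" where
  "hermitian_form ip \<longleftrightarrow>
     (\<forall>x y z. ip (x + y) z = ip x z + ip y z) \<and>
     (\<forall>a x y. ip (a *\<^sub>C x) y = a * ip x y) \<and>
     (\<forall>x y. ip y x = cnj (ip x y))"

definition hilbert_subspace :: "('a::complex_vector \<Rightarrow> 'a \<Rightarrow> complex) \<Rightarrow> 'a set \<Rightarrow> bool" where
  "hilbert_subspace ip S \<longleftrightarrow>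
     csubspace S \<and> (\<forall>x\<in>S. x \<noteq> 0 \<longrightarrow> 0 < Re (ip x x)) \<and>
     (\<forall>X. (\<forall>n::nat. X n \<in> S) \<and>
          (\<forall>e>0. \<exists>N. \<forall>m\<ge>N. \<forall>n\<ge>N. Re (ip (X m - X n) (X m - X n)) < e) \<longrightarrow>
          (\<exists>L\<in>S. (\<lambda>n. Re (ip (X n - L) (X n - L))) \<longlonglongrightarrow> 0))"

text \<open>
  A Krein space is the orthogonal direct sum of a Hilbert space and the negative of a Hilbert
  space. Its topology is that of the Hilbert space norm
  \<open>x = x\<^sub>+ + x\<^sub>- \<mapsto> sqrt ([x\<^sub>+, x\<^sub>+] - [x\<^sub>-, x\<^sub>-])\<close>, which up to
  equivalence does not depend on the decomposition; the last clause says that the norm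
  of the type induces this topology, so that \<^const>\<open>bounded_linear\<close> has the usual meaning.
\<close>

definition krein_space :: "('k::complex_banach \<Rightarrow> 'k \<Rightarrow> complex) \<Rightarrow> bool" where
  "krein_space ip \<longleftrightarrow> hermitian_form ip \<and>
     (\<exists>Kp Km. hilbert_subspace ip Kp \<and> hilbert_subspace (\<lambda>x y. - ip x y) Km \<and>
        (\<forall>x\<in>Kp. \<forall>y\<in>Km. ip x y = 0) \<and>
        (\<forall>z. \<exists>x\<in>Kp. \<exists>y\<in>Km. z = x + y) \<and>
        (\<exists>c>0. \<exists>C>0. \<forall>x\<in>Kp. \<forall>y\<in>Km.
           c * norm (x + y) \<le> sqrt (Re (ip x x) - Re (ip y y)) \<and>
           sqrt (Re (ip x x) - Re (ip y y)) \<le> C * norm (x + y)))"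

definition bounded_clinear :: "('a::complex_normed_vector \<Rightarrow> 'b::complex_normed_vector) \<Rightarrow> bool"
  where "bounded_clinear f \<longleftrightarrow> bounded_linear f \<and> (\<forall>a x. f (a *\<^sub>C x) = a *\<^sub>C f x)"

definition adj ::
    "('a \<Rightarrow> 'a \<Rightarrow> complex) \<Rightarrow> ('b \<Rightarrow> 'b \<Rightarrow> complex) \<Rightarrow> ('a \<Rightarrow> 'b) \<Rightarrow> 'b \<Rightarrow> 'a" where
  "adj ipa ipb T y = (THE x. \<forall>u. ipb (T u) y = ipa u x)"


section \<open>Linear relations\<close>

text \<open>The Riemann sphere is \<^typ>\<open>complex option\<close>, with \<^const>\<open>None\<close> in the role of infinity.\<close>

type_synonym sphere = "complex option"

abbreviation sphere_cnj :: "sphere \<Rightarrow> sphere" where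
  "sphere_cnj \<equiv> map_option cnj"

definition op_graph :: "('a \<Rightarrow> 'b) \<Rightarrow> ('a \<times> 'b) set" where
  "op_graph f = {(x, f x) |x. True}"

definition rel_preimage :: "('v \<Rightarrow> 'k) \<Rightarrow> ('k \<times> 'k) set \<Rightarrow> ('v \<times> 'v) set" where
  "rel_preimage T A = {(u, v). (T u, T v) \<in> A}"

definition rel_adj :: "('k \<Rightarrow> 'k \<Rightarrow> complex) \<Rightarrow> ('k \<times> 'k) set \<Rightarrow> ('k \<times> 'k) set" where
  "rel_adj ip A = {(x, y). \<forall>(u, v)\<in>A. ip x v = ip y u}"

fun resolvent_rel :: "('k::complex_vector \<times> 'k) set \<Rightarrow> sphere \<Rightarrow> ('k \<times> 'k) set" where
  "resolvent_rel A (Some \<alpha>) = {(y - \<alpha> *\<^sub>C x, x) |x y. (x, y) \<in> A}"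
| "resolvent_rel A None = A"

definition resolvent_set :: "('k::complex_normed_vector \<times> 'k) set \<Rightarrow> sphere set" where
  "resolvent_set A = {\<alpha>. \<exists>R. bounded_clinear R \<and> resolvent_rel A \<alpha> = op_graph R}"

definition spectrum :: "('k::complex_normed_vector \<times> 'k) set \<Rightarrow> sphere set" where
  "spectrum A = - resolvent_set A"

definition resolvent :: "('k::complex_normed_vector \<times> 'k) set \<Rightarrow> sphere \<Rightarrow> 'k \<Rightarrow> 'k" where
  "resolvent A \<alpha> = (THE R. resolvent_rel A \<alpha> = op_graph R)"

definition rel_commutant :: "('k::complex_normed_vector \<times> 'k) set \<Rightarrow> ('k \<Rightarrow> 'k) set" where
  "rel_commutant A = {C. bounded_clinear C \<and> (\<forall>(x, y)\<in>A. (C x, C y) \<in> A)}"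

definition rel_bicommutant :: "('k::complex_normed_vector \<times> 'k) set \<Rightarrow> ('k \<Rightarrow> 'k) set" where
  "rel_bicommutant A = {D. bounded_clinear D \<and> (\<forall>C\<in>rel_commutant A. D \<circ> C = C \<circ> D)}"


section \<open>Rational functions and the rational functional calculus\<close>

text \<open>Numerator and denominator in lowest terms; the denominator is nonzero (and monic).\<close>

definition rnum :: "complex poly fract \<Rightarrow> complex poly" where
  "rnum r = fst (quot_of_fract r)"

definition rden :: "complex poly fract \<Rightarrow> complex poly" where
  "rden r = snd (quot_of_fract r)"

definition rat_poles :: "complex poly fract \<Rightarrow> sphere set" where
  "rat_poles r = {Some z |z. poly (rden r) z = 0} \<union> {w. w = None \<and> degree (rden r) < degree (rnum r)}"

text \<open>
  The value at infinity is the limit of \<open>r z\<close>, if this is finite. Values at poles are irrelevant.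
\<close>

fun rat_eval :: "complex poly fract \<Rightarrow> sphere \<Rightarrow> complex" where
  "rat_eval r (Some z) = poly (rnum r) z / poly (rden r) z"
| "rat_eval r None = coeff (rnum r) (degree (rden r)) / lead_coeff (rden r)"

fun rat_zero_order :: "complex poly fract \<Rightarrow> sphere \<Rightarrow> nat" where
  "rat_zero_order r (Some z) = order z (rnum r)"
| "rat_zero_order r None = degree (rden r) - degree (rnum r)"

definition rat_sharp :: "complex poly fract \<Rightarrow> complex poly fract" where
  "rat_sharp r = Fract (map_poly cnj (rnum r)) (map_poly cnj (rden r))"

definition rat_algebra :: "('k::complex_normed_vector \<times> 'k) set \<Rightarrow> complex poly fract set" where
  "rat_algebra A = {r. rat_poles r \<subseteq> resolvent_set A}"

text \<open>
  Coefficients that are zero are allowed in the partial fraction decomposition, so that it is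
  unique only up to such terms; this does not affect the resulting operator. If infinity is not a
  pole of \<open>r\<close>, then \<open>p\<close> is constant and the first sum is a multiple of the identity.
\<close>

definition rat_calc ::
    "('k::complex_normed_vector \<times> 'k) set \<Rightarrow> complex poly fract \<Rightarrow> 'k \<Rightarrow> 'k" where
  "rat_calc A r = (THE R. \<exists>(p::complex poly) (P::complex set) (n::nat) (c::complex \<Rightarrow> nat \<Rightarrow> complex).
     finite P \<and>
     r = Fract p 1 + (\<Sum>\<alpha>\<in>P. \<Sum>j=1..n. Fract [:c \<alpha> j:] ([:-\<alpha>, 1:] ^ j)) \<and>
     R = (\<lambda>x. (\<Sum>i\<le>degree p. coeff p i *\<^sub>C (resolvent A None ^^ i) x) +
              (\<Sum>\<alpha>\<in>P. \<Sum>j=1..n. c \<alpha> j *\<^sub>C (resolvent A (Some \<alpha>) ^^ j) x)))"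

definition definitizing ::
    "('k::complex_normed_vector \<Rightarrow> 'k \<Rightarrow> complex) \<Rightarrow> ('k \<times> 'k) set \<Rightarrow> complex poly fract \<Rightarrow> bool" where
  "definitizing ip A q \<longleftrightarrow> q \<in> rat_algebra A \<and> (\<forall>x. ip (rat_calc A q x) x \<in> \<real>\<^sub>\<ge>\<^sub>0)"

definition definitizable ::
    "('k::complex_normed_vector \<Rightarrow> 'k \<Rightarrow> complex) \<Rightarrow> ('k \<times> 'k) set \<Rightarrow> bool" where
  "definitizable ip A \<longleftrightarrow> resolvent_set A \<noteq> {} \<and> (\<exists>q. definitizing ip A q)"


section \<open>Spectral measures\<close>

definition sphere_borel :: "sphere measure" where
  "sphere_borel = sigma UNIV {U. openin (Alexandroff_compactification euclidean) U}"

definition ext_real :: "sphere set" where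
  "ext_real = insert None (Some ` \<real>)"

abbreviation ext_real_borel :: "sphere measure" where
  "ext_real_borel \<equiv> restrict_space sphere_borel ext_real"

definition orth_projection :: "('v::complex_inner \<Rightarrow> 'v) \<Rightarrow> bool" where
  "orth_projection P \<longleftrightarrow> bounded_clinear P \<and> P \<circ> P = P \<and>
     (\<forall>x y. cinner (P x) y = cinner x (P y))"

definition spectral_measure :: "(sphere set \<Rightarrow> 'v::complex_inner \<Rightarrow> 'v) \<Rightarrow> bool" where
  "spectral_measure E \<longleftrightarrow>
     (\<forall>B\<in>sets ext_real_borel. orth_projection (E B)) \<and>
     E ext_real = id \<and>
     (\<forall>B\<in>sets ext_real_borel. \<forall>C\<in>sets ext_real_borel. E (B \<inter> C) = E B \<circ> E C) \<and>
     (\<forall>B x. range B \<subseteq> sets ext_real_borel \<and> disjoint_family (B :: nat \<Rightarrow> sphere set) \<longrightarrow>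
        (\<lambda>n. E (B n) x) sums E (\<Union>n. B n) x)"

definition scalar_measure :: "(sphere set \<Rightarrow> 'v::complex_inner \<Rightarrow> 'v) \<Rightarrow> 'v \<Rightarrow> sphere measure" where
  "scalar_measure E x = measure_of ext_real (sets ext_real_borel) (\<lambda>B. ennreal (Re (cinner (E B x) x)))"

text \<open>
  The integral of a bounded measurable \<open>f\<close> over \<open>S\<close> is understood in the weak sense. By
  polarization it suffices to prescribe the quadratic form of the operator.
\<close>

definition spectral_integral ::
    "(sphere set \<Rightarrow> 'v::complex_inner \<Rightarrow> 'v) \<Rightarrow> sphere set \<Rightarrow> (sphere \<Rightarrow> complex) \<Rightarrow> 'v \<Rightarrow> 'v" where
  "spectral_integral E S f = (THE R. bounded_clinear R \<and>
     (\<forall>x. cinner (R x) x = set_lebesgue_integral (scalar_measure E x) S f))"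

text \<open>
  The resolvent formula is for finite \<open>z\<close>, and its integrand vanishes at infinity. That \<open>E\<close>
  lives on the spectrum of \<open>H\<close> has to be required separately: the resolvent formula does not
  determine where the mass belonging to the multivalued part of \<open>H\<close> is located.
\<close>

definition spectral_measure_of ::
    "('v::complex_inner \<times> 'v) set \<Rightarrow> (sphere set \<Rightarrow> 'v \<Rightarrow> 'v) \<Rightarrow> bool" where
  "spectral_measure_of H E \<longleftrightarrow> spectral_measure E \<and> E (spectrum H) = id \<and>
     (\<forall>z. Some z \<in> resolvent_set H \<longrightarrow>
        resolvent H (Some z) =
          spectral_integral E (spectrum H) (\<lambda>t. case t of None \<Rightarrow> 0 | Some t \<Rightarrow> 1 / (t - z)))"


section \<open>The function classes\<close>

text \<open>
  An element \<open>\<phi>\<close> of \<open>\<M>(q, A)\<close> is represented by the function \<open>\<lambda>w j. \<phi>(w)\<^sub>j\<close>, extended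
  by zero to all points \<open>w\<close> outside the spectrum and all indices beyond the order of \<open>w\<close>
  as a zero of \<open>q\<close>; equality in \<open>\<M>(q, A)\<close> is then equality of functions.
\<close>

type_synonym jet_function = "sphere \<Rightarrow> nat \<Rightarrow> complex"

definition jet_domain ::
    "complex poly fract \<Rightarrow> ('k::complex_normed_vector \<times> 'k) set \<Rightarrow> (sphere \<times> nat) set" where
  "jet_domain q A = {(w, j). w \<in> spectrum A \<and> j \<le> rat_zero_order q w}"

definition jet_add :: "jet_function \<Rightarrow> jet_function \<Rightarrow> jet_function" where
  "jet_add \<phi> \<psi> = (\<lambda>w j. \<phi> w j + \<psi> w j)"

definition jet_scale :: "complex \<Rightarrow> jet_function \<Rightarrow> jet_function" where
  "jet_scale a \<phi> = (\<lambda>w j. a * \<phi> w j)"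

definition jet_mult ::
    "complex poly fract \<Rightarrow> jet_function \<Rightarrow> jet_function \<Rightarrow> jet_function" where
  "jet_mult q \<phi> \<psi> = (\<lambda>w j. if j \<le> rat_zero_order q w then \<Sum>k\<le>j. \<phi> w k * \<psi> w (j - k) else 0)"

definition jet_sharp :: "jet_function \<Rightarrow> jet_function" where
  "jet_sharp \<phi> = (\<lambda>w j. cnj (\<phi> (sphere_cnj w) j))"

fun taylor_coeff :: "(sphere \<Rightarrow> complex) \<Rightarrow> sphere \<Rightarrow> nat \<Rightarrow> complex" where
  "taylor_coeff f (Some w) j = (deriv ^^ j) (\<lambda>z. f (Some z)) w / fact j"
| "taylor_coeff f None j = (deriv ^^ j) (\<lambda>z. f (if z = 0 then None else Some (1 / z))) 0 / fact j"

definition jet_embed ::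
    "complex poly fract \<Rightarrow> ('k::complex_normed_vector \<times> 'k) set \<Rightarrow> (sphere \<Rightarrow> complex) \<Rightarrow> jet_function" where
  "jet_embed q A f = (\<lambda>w j. if (w, j) \<in> jet_domain q A then taylor_coeff f w j else 0)"

definition bounded_borel_on :: "sphere set \<Rightarrow> (sphere \<Rightarrow> complex) set" where
  "bounded_borel_on S = {g. g \<in> borel_measurable (restrict_space sphere_borel S) \<and> bounded (g ` S)}"

definition compose_jet ::
    "complex poly fract \<Rightarrow> ('k::complex_normed_vector \<times> 'k) set \<Rightarrow>
     complex poly fract \<Rightarrow> (sphere \<Rightarrow> complex) \<Rightarrow> jet_function" where
  "compose_jet q A s g =
     jet_add (jet_embed q A (rat_eval s)) (\<lambda>w j. g w * jet_embed q A (rat_eval q) w j)"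

definition F_algebra ::
    "complex poly fract \<Rightarrow> ('k::complex_normed_vector \<times> 'k) set \<Rightarrow> jet_function set" where
  "F_algebra q A = {compose_jet q A s g |s g. s \<in> rat_algebra A \<and> g \<in> bounded_borel_on (spectrum A)}"


section \<open>The functional calculus\<close>

definition calc_op ::
    "('k::complex_normed_vector \<Rightarrow> 'k \<Rightarrow> complex) \<Rightarrow> ('k \<times> 'k) set \<Rightarrow> ('v::complex_inner \<Rightarrow> 'k) \<Rightarrow>
     (sphere set \<Rightarrow> 'v \<Rightarrow> 'v) \<Rightarrow> complex poly fract \<Rightarrow> (sphere \<Rightarrow> complex) \<Rightarrow> 'k \<Rightarrow> 'k" where
  "calc_op ip A T E s g =
     (\<lambda>x. rat_calc A s x +
          T (spectral_integral E (spectrum (rel_preimage T A)) g (adj cinner ip T x)))"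

definition fun_calc ::
    "('k::complex_normed_vector \<Rightarrow> 'k \<Rightarrow> complex) \<Rightarrow> ('k \<times> 'k) set \<Rightarrow> complex poly fract \<Rightarrow>
     ('v::complex_inner \<Rightarrow> 'k) \<Rightarrow> (sphere set \<Rightarrow> 'v \<Rightarrow> 'v) \<Rightarrow> jet_function \<Rightarrow> 'k \<Rightarrow> 'k" where
  "fun_calc ip A q T E \<phi> =
     (THE X. \<exists>s\<in>rat_algebra A. \<exists>g\<in>bounded_borel_on (spectrum A).
        \<phi> = compose_jet q A s g \<and> X = calc_op ip A T E s g)"

end

theory Submission
  imports Defs
begin

text \<open>
  Write \<open>H = \<Theta>(A)\<close>, \<open>T\<^sup>+\<close> for the adjoint of \<open>T\<close> and \<open>J g\<close> for the integral of \<open>g\<close> with respect to \<open>E\<close>.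
  Every resolvent \<open>R\<close> of \<open>A\<close> commutes with \<open>q(A) = T T\<^sup>+\<close>, and so does its adjoint. Iterating the
  Cauchy-Schwarz inequality shows \<open>\<parallel>T\<^sup>+ R x\<parallel> \<le> c \<parallel>T\<^sup>+ x\<parallel>\<close>, hence \<open>R\<close> lifts to a bounded operator on \<open>\<V>\<close>,
  which is the resolvent of \<open>H\<close> at the same point. It follows that \<open>H\<close> is self-adjoint, that its spectrum is
  contained in that of \<open>A\<close>, and that \<open>T (J s) = s(A) T\<close> and \<open>T\<^sup>+ s(A) = (J s) T\<^sup>+\<close> for all rational \<open>s\<close>.
  In particular \<open>T\<^sup>+ T = J q\<close>, which gives multiplicativity.

  If two decompositions define the same jets, then \<open>s - s' = k q\<close> with \<open>k\<close> in the rational algebra and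
  \<open>k = g' - g\<close> on the spectrum of \<open>A\<close>, so that \<open>s(A) - s'(A) = k(A) T T\<^sup>+ = T (J (g' - g)) T\<^sup>+\<close>.

  For \<open>C\<close> in the commutant of \<open>A\<close>, the functions \<open>g\<close> for which \<open>T (J g) T\<^sup>+\<close> commutes with \<open>C\<close> include the rational
  ones, and hence, by the Stone-Weierstrass theorem and weak limits, all bounded Borel functions.
\<close>

section \<open>Krein spaces and the Riesz representation theorem\<close>

text \<open>The form on a Krein space is indefinite and offers no Cauchy-Schwarz inequality. Its
  place is taken by the seminorm \<open>norm (Tp x)\<close>, whose square is [q(A) x, x]; every
  estimate that moves an operator from the Krein space to the Hilbert space is made in it.
  \<open>A\<close> may be multivalued, and infinity may lie in its spectrum. Fixing a finite
  resolvent point \<open>m\<close> and passing to w = 1 / (z - m) replaces \<open>A\<close> by the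
  bounded operator B = (A - m)^-1 and rational functions of \<open>A\<close> by quotients of
  polynomials in \<open>B\<close> with invertible denominator. The point \<open>m\<close> is taken
  nonreal where w has to stay bounded on the extended real line. The notions \<open>adj\<close>,
  \<open>rat_calc\<close>, \<open>spectral_integral\<close> and \<open>fun_calc\<close> are definite
  descriptions. The first three are therefore handled through characterizations
  (\<open>riesz_form\<close>, \<open>calc_rel\<close>, \<open>represents\<close>) for which
  existence and uniqueness can be proved, and the last one rests on independence of the
  decomposition.\<close>

interpretation cv: module "scaleC :: complex \<Rightarrow> 'a::complex_vector \<Rightarrow> 'a"
  by standard (auto simp: scaleC_add_right scaleC_add_left scaleC_scaleC scaleC_one)

section \<open>Bounded complex linear operators\<close>

lemma bounded_clinear_bounded_linear: "bounded_clinear f \<Longrightarrow> bounded_linear f"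
  by (simp add: bounded_clinear_def)

lemma bounded_clinear_add_apply: "bounded_clinear f \<Longrightarrow> f (x + y) = f x + f y"
  by (simp add: bounded_clinear_def bounded_linear.axioms linear_add bounded_linear.linear)

lemma bounded_clinear_diff_apply: "bounded_clinear f \<Longrightarrow> f (x - y) = f x - f y"
  by (simp add: bounded_clinear_def linear_diff bounded_linear.linear)

lemma bounded_clinear_zero_apply: "bounded_clinear f \<Longrightarrow> f 0 = 0"
  by (simp add: bounded_clinear_def linear_0 bounded_linear.linear)

lemma bounded_clinear_scale_apply: "bounded_clinear f \<Longrightarrow> f (a *\<^sub>C x) = a *\<^sub>C f x"
  by (simp add: bounded_clinear_def)

lemma bounded_clinearI:
  fixes f :: "'a::complex_normed_vector \<Rightarrow> 'b::complex_normed_vector"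
  assumes "\<And>x y. f (x + y) = f x + f y" "\<And>a x. f (a *\<^sub>C x) = a *\<^sub>C f x"
    and "\<And>x. norm (f x) \<le> norm x * K"
  shows "bounded_clinear f"
  unfolding bounded_clinear_def
  by (auto intro!: bounded_linear_intro[where K=K] simp: assms scaleR_eq_scaleC)

lemma bounded_clinear_bound:
  assumes "bounded_clinear f"
  obtains K where "0 < K" "\<And>x. norm (f x) \<le> norm x * K"
  using bounded_linear.pos_bounded[OF bounded_clinear_bounded_linear[OF assms]] by blast

lemma bounded_clinear_id: "bounded_clinear id"
  by (rule bounded_clinearI[where K=1]) auto

lemma bounded_clinear_zero: "bounded_clinear (\<lambda>x. 0)"
  by (rule bounded_clinearI[where K=0]) auto

lemma bounded_clinear_comp:
  "bounded_clinear f \<Longrightarrow> bounded_clinear g \<Longrightarrow> bounded_clinear (f \<circ> g)"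
  unfolding bounded_clinear_def by (auto intro: bounded_linear_compose simp: comp_def)

lemma bounded_clinear_add:
  "bounded_clinear f \<Longrightarrow> bounded_clinear g \<Longrightarrow> bounded_clinear (\<lambda>x. f x + g x)"
  unfolding bounded_clinear_def by (auto intro: bounded_linear_add simp: scaleC_add_right)

lemma bounded_clinear_scale:
  assumes "bounded_clinear f"
  shows "bounded_clinear (\<lambda>x. a *\<^sub>C f x)"
proof -
  obtain K where K: "\<And>x. norm (f x) \<le> norm x * K" using bounded_clinear_bound[OF assms] by metis
  show ?thesis
  proof (rule bounded_clinearI[where K="cmod a * K"])
    show "norm (a *\<^sub>C f x) \<le> norm x * (cmod a * K)" for x
      using mult_left_mono[OF K, of "cmod a" x] by (simp add: norm_scaleC mult_ac)
  qed (use assms in \<open>auto simp: bounded_clinear_add_apply bounded_clinear_scale_apply scaleC_add_right mult.commute\<close>)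
qed

lemma bounded_clinear_funpow:
  fixes f :: "'a::complex_normed_vector \<Rightarrow> 'a"
  shows "bounded_clinear f \<Longrightarrow> bounded_clinear (f ^^ n)"
proof (induction n)
  case 0
  show ?case using bounded_clinear_id by (simp only: funpow.simps)
next
  case (Suc n)
  then show ?case using bounded_clinear_comp[of f "f ^^ n"] by (simp only: funpow.simps)
qed

lemma bounded_clinear_sum:
  "finite I \<Longrightarrow> (\<And>i. i \<in> I \<Longrightarrow> bounded_clinear (f i)) \<Longrightarrow> bounded_clinear (\<lambda>x. \<Sum>i\<in>I. f i x)"
  by (induction I rule: finite_induct) (auto intro: bounded_clinear_zero bounded_clinear_add)

lemmas bounded_clinear_intros = bounded_clinear_id bounded_clinear_zero bounded_clinear_comp
  bounded_clinear_add bounded_clinear_scale bounded_clinear_funpow bounded_clinear_sum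

section \<open>Hermitian forms and the Cauchy-Schwarz inequality\<close>

lemma hermitian_form_add_left: "hermitian_form ip \<Longrightarrow> ip (x + y) z = ip x z + ip y z"
  unfolding hermitian_form_def by blast

lemma hermitian_form_scale_left: "hermitian_form ip \<Longrightarrow> ip (a *\<^sub>C x) z = a * ip x z"
  unfolding hermitian_form_def by blast

lemma hermitian_form_cnj: "hermitian_form ip \<Longrightarrow> cnj (ip x y) = ip y x"
proof -
  assume "hermitian_form ip"
  then have "ip y x = cnj (ip x y)" unfolding hermitian_form_def by blast
  then show ?thesis by simp
qed

lemma hermitian_form_add_right: "hermitian_form ip \<Longrightarrow> ip z (x + y) = ip z x + ip z y"
  using hermitian_form_cnj[of ip "x + y" z] hermitian_form_cnj[of ip x z] hermitian_form_cnj[of ip y z]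
  by (simp add: hermitian_form_add_left)

lemma hermitian_form_scale_right: "hermitian_form ip \<Longrightarrow> ip z (a *\<^sub>C x) = cnj a * ip z x"
  using hermitian_form_cnj[of ip "a *\<^sub>C x" z] hermitian_form_cnj[of ip x z]
  by (simp add: hermitian_form_scale_left)

lemma hermitian_form_minus_left: "hermitian_form ip \<Longrightarrow> ip (- x) z = - ip x z"
  using hermitian_form_scale_left[of ip "-1" x z] by (simp add: scaleC_one)

lemma hermitian_form_minus_right: "hermitian_form ip \<Longrightarrow> ip z (- x) = - ip z x"
  using hermitian_form_scale_right[of ip z "-1" x] by (simp add: scaleC_one)

lemma hermitian_form_diff_left: "hermitian_form ip \<Longrightarrow> ip (x - y) z = ip x z - ip y z"
  using hermitian_form_add_left[of ip x "-y" z] by (simp add: hermitian_form_minus_left)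

lemma hermitian_form_diff_right: "hermitian_form ip \<Longrightarrow> ip z (x - y) = ip z x - ip z y"
  using hermitian_form_add_right[of ip z x "-y"] by (simp add: hermitian_form_minus_right)

lemma hermitian_form_zero_left: "hermitian_form ip \<Longrightarrow> ip 0 z = 0"
  using hermitian_form_diff_left[of ip z z z] by simp

lemma hermitian_form_zero_right: "hermitian_form ip \<Longrightarrow> ip z 0 = 0"
  using hermitian_form_diff_right[of ip z z z] by simp

lemmas hermitian_form_simps = hermitian_form_add_left hermitian_form_add_right
  hermitian_form_scale_left hermitian_form_scale_right hermitian_form_minus_left
  hermitian_form_minus_right hermitian_form_diff_left hermitian_form_diff_right
  hermitian_form_zero_left hermitian_form_zero_right

lemma hermitian_form_self_real: "hermitian_form ip \<Longrightarrow> ip x x = of_real (Re (ip x x))"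
  by (metis Reals_cnj_iff complex_is_Real_iff hermitian_form_cnj of_real_Re)

lemma hermitian_form_cinner: "hermitian_form (cinner :: 'v::complex_inner \<Rightarrow> _)"
  unfolding hermitian_form_def by (auto simp: cinner_add_left cinner_scaleC_left intro: cinner_commute)

lemmas cinner_simps = hermitian_form_simps[OF hermitian_form_cinner]
lemmas cinner_cnj = hermitian_form_cnj[OF hermitian_form_cinner]
lemmas cinner_self_real = hermitian_form_self_real[OF hermitian_form_cinner]

lemma hermitian_form_quadratic:
  assumes "hermitian_form ip"
  shows "Re (ip (x + s *\<^sub>C y) (x + s *\<^sub>C y))
       = Re (ip x x) + 2 * Re (s * ip y x) + (cmod s)\<^sup>2 * Re (ip y y)"
proof -
  have 1: "ip (x + s *\<^sub>C y) (x + s *\<^sub>C y)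
      = ip x x + (s * ip y x + cnj (s * ip y x)) + (s * cnj s) * ip y y"
    using assms by (simp add: hermitian_form_simps hermitian_form_cnj algebra_simps)
  show ?thesis unfolding 1 complex_add_cnj complex_norm_square[symmetric]
    by (subst hermitian_form_self_real[OF assms, of y]) (simp flip: of_real_power)
qed

lemma Re_scaled_cnj_mult: "Re (- of_real t * cnj d * d) = - t * (cmod d)\<^sup>2"
  unfolding cmod_power2 by (simp add: power2_eq_square algebra_simps)

lemma cmod_scaled_cnj: "(cmod (- of_real t * cnj d))\<^sup>2 = t\<^sup>2 * (cmod d)\<^sup>2"
  by (simp add: norm_mult power_mult_distrib)

text \<open>Evaluating the form at \<open>x - t * cnj d * y\<close> with d = [y, x] aligns the
  phases and leaves a real quadratic in \<open>t\<close>. Semidefiniteness allows null vectors, so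
  the case [y, y] = 0, where the quadratic has no vertex, is treated on its own.\<close>

lemma semidefinite_Cauchy_Schwarz:
  assumes h: "hermitian_form ip" and S: "csubspace S" and pos: "\<And>x. x \<in> S \<Longrightarrow> 0 \<le> Re (ip x x)"
    and xS: "x \<in> S" and yS: "y \<in> S"
  shows "(cmod (ip x y))\<^sup>2 \<le> Re (ip x x) * Re (ip y y)"
proof -
  define d where "d = ip y x"
  have cd: "cmod (ip x y) = cmod d" unfolding d_def by (metis complex_mod_cnj h hermitian_form_cnj)
  have q: "0 \<le> Re (ip x x) - 2 * t * (cmod d)\<^sup>2 + t\<^sup>2 * (cmod d)\<^sup>2 * Re (ip y y)" for t
  proof -
    have "x + (- of_real t * cnj d) *\<^sub>C y \<in> S"
      using S xS yS by (intro cv.subspace_add cv.subspace_scale)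
    from pos[OF this] show ?thesis
      unfolding hermitian_form_quadratic[OF h] d_def[symmetric] Re_scaled_cnj_mult cmod_scaled_cnj
      by simp
  qed
  show ?thesis
  proof (cases "Re (ip y y) = 0")
    case True
    have "cmod d = 0"
    proof (rule ccontr)
      assume "cmod d \<noteq> 0"
      \<comment> \<open>The quadratic term vanishes, so the expression is affine in
        \<open>t\<close>; this \<open>t\<close> makes it equal to -1.\<close>
      then show False using q[of "(Re (ip x x) + 1) / (2 * (cmod d)\<^sup>2)"] True by simp
    qed
    then show ?thesis using cd True by simp
  next
    case False
    then have p: "0 < Re (ip y y)" using pos[OF yS] by simp
    have "0 \<le> Re (ip x x) - (cmod d)\<^sup>2 / Re (ip y y)"
      using q[of "1 / Re (ip y y)"] p by (simp add: field_simps power2_eq_square)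
    then show ?thesis using p cd by (simp add: field_simps)
  qed
qed

section \<open>Riesz representation in Hilbert subspaces\<close>

lemma hilbert_subspace_nonneg:
  assumes "hermitian_form ip" "hilbert_subspace ip S" "x \<in> S"
  shows "0 \<le> Re (ip x x)"
  using assms unfolding hilbert_subspace_def
  by (metis hermitian_form_zero_left less_eq_real_def zero_complex.simps(1))

lemma hilbert_subspace_Cauchy_Schwarz:
  assumes "hermitian_form ip" "hilbert_subspace ip S" "x \<in> S" "y \<in> S"
  shows "cmod (ip x y) \<le> sqrt (Re (ip x x)) * sqrt (Re (ip y y))"
proof -
  have "(cmod (ip x y))\<^sup>2 \<le> Re (ip x x) * Re (ip y y)"
    using assms hilbert_subspace_nonneg[OF assms(1,2)]
    by (intro semidefinite_Cauchy_Schwarz[of ip S]) (auto simp: hilbert_subspace_def)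
  then show ?thesis by (simp add: real_le_rsqrt real_sqrt_mult[symmetric])
qed

text \<open>The representing vector is the limit of a minimising sequence of
  \<open>Re (ip x x) - 2 * Re (f x)\<close> on \<open>M\<close>; the subspace \<open>M\<close> need not be closed.\<close>

lemma riesz_on_subspace:
  fixes f :: "'a::complex_vector \<Rightarrow> complex"
  assumes h: "hermitian_form ip" and S: "hilbert_subspace ip S"
    and M: "csubspace M" "M \<subseteq> S"
    and fadd: "\<And>x y. x \<in> M \<Longrightarrow> y \<in> M \<Longrightarrow> f (x + y) = f x + f y"
    and fscale: "\<And>a x. x \<in> M \<Longrightarrow> f (a *\<^sub>C x) = a * f x"
    and c: "0 \<le> c" and fb: "\<And>x. x \<in> M \<Longrightarrow> cmod (f x) \<le> c * sqrt (Re (ip x x))"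
  obtains v where "v \<in> S" "\<And>x. x \<in> M \<Longrightarrow> f x = ip x v" "sqrt (Re (ip v v)) \<le> c"
proof -
  define N where "N x = Re (ip x x)" for x
  define Q where "Q x = N x - 2 * Re (f x)" for x
  have cS: "csubspace S" using S by (simp add: hilbert_subspace_def)
  have N0: "x \<in> S \<Longrightarrow> 0 \<le> N x" for x unfolding N_def by (rule hilbert_subspace_nonneg[OF h S])
  have CS: "x \<in> S \<Longrightarrow> y \<in> S \<Longrightarrow> cmod (ip x y) \<le> sqrt (N x) * sqrt (N y)" for x y
    unfolding N_def by (rule hilbert_subspace_Cauchy_Schwarz[OF h S])
  \<comment> \<open>Completing the square: \<open>Q x\<close> is at least (sqrt (N x) - c)^2 -
    c^2.\<close>
  have Qb: "- (c\<^sup>2) \<le> Q x" if "x \<in> M" for x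
  proof -
    have "Re (f x) \<le> c * sqrt (N x)" using fb[OF that] complex_Re_le_cmod[of "f x"] unfolding N_def by linarith
    moreover have "0 \<le> (sqrt (N x) - c)\<^sup>2" by simp
    moreover have "(sqrt (N x))\<^sup>2 = N x" using N0 that M by auto
    ultimately show ?thesis unfolding Q_def by (simp add: power2_diff mult.commute)
  qed
  define I where "I = Inf (Q ` M)"
  have M0: "0 \<in> M" using M(1) by (simp add: cv.subspace_0)
  have bdd: "bdd_below (Q ` M)" using Qb by (auto intro!: bdd_belowI2)
  have IQ: "I \<le> Q x" if "x \<in> M" for x unfolding I_def using bdd that by (auto intro: cInf_lower)
  have "\<exists>x\<in>M. Q x < I + 1 / (real n + 1)" for n
  proof -
    have "Inf (Q ` M) < I + 1 / (real n + 1)" unfolding I_def by simp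
    then show ?thesis using cInf_less_iff[OF _ bdd] M0 by blast
  qed
  then obtain X where XM: "\<And>n. X n \<in> M" and XQ: "\<And>n. Q (X n) < I + 1 / (real n + 1)" by metis
  have XS: "X n \<in> S" for n using XM M by auto
  \<comment> \<open>Parallelogram law; the linear part of \<open>Q\<close> cancels because the third
    point is the midpoint. It turns near-minimality of two points into closeness.\<close>
  have par: "N (x - y) = 2 * (Q x + Q y - 2 * Q ((1/2) *\<^sub>C (x + y)))" if "x \<in> M" "y \<in> M" for x y
  proof -
    have "x + y \<in> M" using that M by (simp add: cv.subspace_add)
    then have "f ((1/2) *\<^sub>C (x + y)) = of_real (1/2) * (f x + f y)" using that by (simp add: fscale fadd)
    then have a: "2 * Re (f ((1/2) *\<^sub>C (x + y))) = Re (f x) + Re (f y)"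
      by (simp only: Re_complex_of_real times_complex.sel Im_complex_of_real plus_complex.sel) simp
    have b: "4 * N ((1/2) *\<^sub>C (x + y)) = Re (ip (x + y) (x + y))"
      unfolding N_def using h by (simp add: hermitian_form_simps add_divide_distrib)
    show ?thesis unfolding Q_def using a b h by (simp add: N_def hermitian_form_simps)
  qed
  have cau: "N (X m - X n) \<le> 2 * (1 / (real m + 1) + 1 / (real n + 1))" for m n
  proof -
    have "(1/2) *\<^sub>C (X m + X n) \<in> M" using XM M(1) by (simp add: cv.subspace_add cv.subspace_scale)
    from IQ[OF this] show ?thesis using par[OF XM XM] XQ[of m] XQ[of n] by simp
  qed
  have "\<exists>L\<in>S. (\<lambda>n. Re (ip (X n - L) (X n - L))) \<longlonglongrightarrow> 0"
  proof -
    have "\<exists>N0. \<forall>m\<ge>N0. \<forall>n\<ge>N0. Re (ip (X m - X n) (X m - X n)) < e" if "0 < e" for e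
    proof -
      obtain k where k: "4 / e < real k" using reals_Archimedean2 by blast
      have "N (X m - X n) < e" if mn: "m \<ge> k" "n \<ge> k" for m n
      proof -
        have k0: "0 < real k" using k \<open>0 < e\<close> by (meson divide_pos_pos less_trans zero_less_numeral)
        have "1 / (real m + 1) < 1 / real k" "1 / (real n + 1) < 1 / real k"
          using mn k0 by (auto intro!: divide_strict_left_mono)
        then have "2 * (1 / (real m + 1) + 1 / (real n + 1)) < 2 * (1 / real k + 1 / real k)"
          by (intro mult_strict_left_mono add_strict_mono) auto
        with cau have "N (X m - X n) < 2 * (1 / real k + 1 / real k)" by (rule order.strict_trans1)
        also have "\<dots> = 4 / real k" by simp
        also have "4 / real k < e" using k \<open>0 < e\<close> k0 by (simp add: field_simps)
        finally show ?thesis .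
      qed
      then show ?thesis unfolding N_def by blast
    qed
    then show ?thesis using S XS unfolding hilbert_subspace_def by blast
  qed
  then obtain L where LS: "L \<in> S" and lim: "(\<lambda>n. N (X n - L)) \<longlonglongrightarrow> 0" unfolding N_def by blast
  have lim2: "(\<lambda>n. sqrt (N (X n - L))) \<longlonglongrightarrow> 0" using tendsto_real_sqrt[OF lim] by simp
  have ipl: "(\<lambda>n. ip y (X n)) \<longlonglongrightarrow> ip y L" if "y \<in> S" for y
  proof -
    have "(\<lambda>n. ip y (X n) - ip y L) \<longlonglongrightarrow> 0"
    proof (rule Lim_null_comparison)
      show "\<forall>\<^sub>F n in sequentially. norm (ip y (X n) - ip y L) \<le> sqrt (N y) * sqrt (N (X n - L))"
        using CS[OF that cv.subspace_diff[OF cS XS LS]] h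
        by (simp add: hermitian_form_diff_right)
      show "(\<lambda>n. sqrt (N y) * sqrt (N (X n - L))) \<longlonglongrightarrow> 0"
        using tendsto_mult_left[OF lim2, of "sqrt (N y)"] by simp
    qed
    then show ?thesis by (simp add: LIM_zero_iff)
  qed
  have rep: "f y = ip y L" if yM: "y \<in> M" for y
  proof -
    define d where "d = ip y L - f y"
    \<comment> \<open>First-order condition at the minimum. The near-minimizers \<open>X n\<close>
      are compared with \<open>X n + s y\<close> before the limit is taken, since \<open>L\<close>
      need not lie in \<open>M\<close>, where alone \<open>f\<close> is known to be linear.\<close>
    have ineq: "0 \<le> 2 * Re (s * d) + (cmod s)\<^sup>2 * N y" for s
    proof (rule LIMSEQ_le_const)
      show "(\<lambda>n. 2 * Re (s * (ip y (X n) - f y)) + (cmod s)\<^sup>2 * N y + 1 / (real n + 1))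
          \<longlonglongrightarrow> 2 * Re (s * d) + (cmod s)\<^sup>2 * N y"
      proof -
        have "(\<lambda>n. 1 / (real n + 1)) \<longlonglongrightarrow> 0"
          using LIMSEQ_inverse_real_of_nat by (simp add: inverse_eq_divide add.commute)
        then have "(\<lambda>n. 2 * Re (s * (ip y (X n) - f y)) + (cmod s)\<^sup>2 * N y + 1 / (real n + 1))
          \<longlonglongrightarrow> 2 * Re (s * d) + (cmod s)\<^sup>2 * N y + 0"
          unfolding d_def using yM M by (intro tendsto_intros ipl) auto
        then show ?thesis by simp
      qed
      have "0 \<le> 2 * Re (s * (ip y (X n) - f y)) + (cmod s)\<^sup>2 * N y + 1 / (real n + 1)" for n
      proof -
        have "X n + s *\<^sub>C y \<in> M" using XM yM M(1) by (simp add: cv.subspace_add cv.subspace_scale)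
        from IQ[OF this] have "Q (X n) - 1 / (real n + 1) < Q (X n + s *\<^sub>C y)" using XQ[of n] by linarith
        moreover have "f (X n + s *\<^sub>C y) = f (X n) + s * f y"
          using XM yM M(1) by (simp add: fadd fscale cv.subspace_scale)
        ultimately show ?thesis unfolding Q_def N_def hermitian_form_quadratic[OF h]
          by (simp add: algebra_simps)
      qed
      then show "\<exists>N0. \<forall>n\<ge>N0. 0 \<le> 2 * Re (s * (ip y (X n) - f y)) + (cmod s)\<^sup>2 * N y + 1 / (real n + 1)"
        by blast
    qed
    have Ny: "0 \<le> N y" using N0 yM M by auto
    \<comment> \<open>The shift by 1 admits \<open>N y = 0\<close> and still gives
      \<open>t * N y \<le> 1\<close>, so that the quadratic term is at most half of the linear
      one.\<close>
    define t where "t = 1 / (N y + 1)"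
    have t: "0 < t" "t * N y \<le> 1" unfolding t_def using Ny by (auto simp: field_simps)
    have sq: "t * t * (cmod d)\<^sup>2 * N y \<le> t * (cmod d)\<^sup>2"
      using mult_left_mono[OF t(2), of "t * (cmod d)\<^sup>2"] t(1) by (simp add: mult_ac)
    have "0 \<le> - 2 * (t * (cmod d)\<^sup>2) + t * t * (cmod d)\<^sup>2 * N y"
      using ineq[of "- of_real t * cnj d"] unfolding Re_scaled_cnj_mult cmod_scaled_cnj
      by (simp add: power2_eq_square)
    then have "t * (cmod d)\<^sup>2 \<le> 0" using sq by linarith
    then have "d = 0" using t(1) by (simp add: mult_le_0_iff)
    then show ?thesis unfolding d_def by simp
  qed
  \<comment> \<open>The representation of \<open>f\<close> is available on \<open>M\<close> only and
    cannot be applied to \<open>L\<close>. Instead \<open>N L\<close> is the limit of [L, X n],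
    whose modulus is that of \<open>f (X n)\<close>.\<close>
  have "sqrt (N L) \<le> c"
  proof -
    have "(\<lambda>n. ip L (X n)) \<longlonglongrightarrow> ip L L" by (rule ipl[OF LS])
    then have l1: "(\<lambda>n. cmod (ip L (X n))) \<longlonglongrightarrow> cmod (ip L L)" by (rule tendsto_norm)
    have NL: "cmod (ip L L) = N L"
      using hermitian_form_self_real[OF h, of L] N0[OF LS] unfolding N_def
      by (metis abs_of_nonneg norm_of_real)
    have cx: "cmod (ip L (X n)) = cmod (f (X n))" for n
      using rep[OF XM[of n]] by (metis complex_mod_cnj h hermitian_form_cnj)
    have "sqrt (N (X n)) \<le> sqrt (N L) + sqrt (N (X n - L))" for n
    proof -
      have "N (X n) = N L + 2 * Re (ip (X n - L) L) + N (X n - L)"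
        using hermitian_form_quadratic[OF h, of L 1 "X n - L"] by (simp add: N_def scaleC_one)
      also have "\<dots> \<le> N L + 2 * (sqrt (N (X n - L)) * sqrt (N L)) + N (X n - L)"
        using CS[OF cv.subspace_diff[OF cS XS LS] LS, of n] complex_Re_le_cmod[of "ip (X n - L) L"]
        by (smt (verit))
      also have "\<dots> = (sqrt (N L) + sqrt (N (X n - L)))\<^sup>2"
        using N0[OF LS] N0[OF cv.subspace_diff[OF cS XS LS]] by (simp add: power2_sum)
      finally show ?thesis
        using N0[OF LS] N0[OF cv.subspace_diff[OF cS XS LS], of n] by (intro real_le_lsqrt) auto
    qed
    then have "cmod (ip L (X n)) \<le> c * (sqrt (N L) + sqrt (N (X n - L)))" for n
      unfolding cx using fb[OF XM, of n] c unfolding N_def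
      by (meson mult_left_mono order_trans)
    moreover have "(\<lambda>n. c * (sqrt (N L) + sqrt (N (X n - L)))) \<longlonglongrightarrow> c * (sqrt (N L) + 0)"
      by (intro tendsto_intros lim2)
    ultimately have "N L \<le> c * sqrt (N L)"
      using LIMSEQ_le[OF l1] NL by auto
    then show ?thesis using N0[OF LS] c
      by (cases "N L = 0") (auto simp: real_le_lsqrt, metis less_eq_real_def mult_le_cancel_right real_sqrt_gt_0_iff real_sqrt_mult_self abs_of_nonneg not_less)
  qed
  then show ?thesis using that[of L] LS rep unfolding N_def by blast
qed


section \<open>Riesz representation and adjoints in Hilbert and Krein spaces\<close>

lemma norm_square_cinner: "(norm x)\<^sup>2 = Re (cinner x x)"
  using cinner_nonneg[of x] by (simp add: norm_eq_sqrt_cinner complex_nonneg_Reals_iff)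

lemma cinner_self: "cinner x x = of_real ((norm x)\<^sup>2)"
  by (subst cinner_self_real) (simp add: norm_square_cinner)

lemma hilbert_subspace_cinner: "hilbert_subspace cinner (UNIV :: 'v::complex_hilbert set)"
  unfolding hilbert_subspace_def
proof (intro conjI allI impI ballI)
  show "csubspace (UNIV :: 'v set)" by (simp add: cv.subspace_UNIV)
  fix x :: 'v
  assume "x \<noteq> 0"
  then show "0 < Re (cinner x x)" by (simp flip: norm_square_cinner)
next
  fix X :: "nat \<Rightarrow> 'v"
  assume "(\<forall>n. X n \<in> UNIV) \<and> (\<forall>e>0. \<exists>N. \<forall>m\<ge>N. \<forall>n\<ge>N. Re (cinner (X m - X n) (X m - X n)) < e)"
  then have *: "\<exists>N. \<forall>m\<ge>N. \<forall>n\<ge>N. (norm (X m - X n))\<^sup>2 < e" if "0 < e" for e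
    using that by (auto simp: norm_square_cinner)
  have "Cauchy X"
  proof (rule CauchyI)
    fix e :: real
    assume "0 < e"
    with *[of "e\<^sup>2"] show "\<exists>M. \<forall>m\<ge>M. \<forall>n\<ge>M. norm (X m - X n) < e"
      by (simp add: power_strict_mono) (meson less_eq_real_def power_less_imp_less_base)
  qed
  then obtain L where "X \<longlonglongrightarrow> L" using Cauchy_convergent_iff convergent_def by blast
  then have "(\<lambda>n. norm (X n - L)) \<longlonglongrightarrow> 0" by (simp add: LIM_zero tendsto_norm_zero)
  then have "(\<lambda>n. (norm (X n - L))\<^sup>2) \<longlonglongrightarrow> 0\<^sup>2" by (rule tendsto_power)
  then show "\<exists>L\<in>UNIV. (\<lambda>n. Re (cinner (X n - L) (X n - L))) \<longlonglongrightarrow> 0"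
    by (auto simp: norm_square_cinner)
qed

lemma cinner_Cauchy_Schwarz:
  fixes x y :: "'v::complex_hilbert"
  shows "cmod (cinner x y) \<le> norm x * norm y"
  using hilbert_subspace_Cauchy_Schwarz[OF hermitian_form_cinner hilbert_subspace_cinner, of x y]
  by (simp add: norm_eq_sqrt_cinner)

text \<open>Collects what Hilbert and Krein inner products share and what adjoints require, with
  nondegeneracy in the place of definiteness. The constant in the representation clause is uniform
  in the functional, which makes adjoints bounded; for a Krein space it reflects the equivalence of
  norms.\<close>

definition riesz_form :: "('a::complex_normed_vector \<Rightarrow> 'a \<Rightarrow> complex) \<Rightarrow> bool" where
  "riesz_form ip \<longleftrightarrow> hermitian_form ip \<and>
     (\<exists>M. \<forall>x y. cmod (ip x y) \<le> M * norm x * norm y) \<and>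
     (\<forall>x. (\<forall>u. ip u x = 0) \<longrightarrow> x = 0) \<and>
     (\<exists>M. \<forall>f c. (\<forall>x y. f (x + y) = f x + f y) \<longrightarrow> (\<forall>a x. f (a *\<^sub>C x) = a * f x) \<longrightarrow>
        (\<forall>x. cmod (f x) \<le> c * norm x) \<longrightarrow> 0 \<le> c \<longrightarrow> (\<exists>v. (\<forall>x. f x = ip x v) \<and> norm v \<le> M * c))"

lemma riesz_form_cinner: "riesz_form (cinner :: 'v::complex_hilbert \<Rightarrow> _)"
  unfolding riesz_form_def
proof (intro conjI)
  show "\<exists>M. \<forall>x y :: 'v. cmod (cinner x y) \<le> M * norm x * norm y"
    using cinner_Cauchy_Schwarz by (metis mult_1)
  show "\<forall>x :: 'v. (\<forall>u. cinner u x = 0) \<longrightarrow> x = 0"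
    by (metis cinner_self norm_eq_zero of_real_eq_0_iff power_eq_0_iff)
  show "\<exists>M. \<forall>f c. (\<forall>x y :: 'v. f (x + y) = f x + f y) \<longrightarrow> (\<forall>a x. f (a *\<^sub>C x) = a * f x) \<longrightarrow>
        (\<forall>x. cmod (f x) \<le> c * norm x) \<longrightarrow> 0 \<le> c \<longrightarrow> (\<exists>v. (\<forall>x. f x = cinner x v) \<and> norm v \<le> M * c)"
  proof (rule exI[of _ 1], intro allI impI)
    fix f :: "'v \<Rightarrow> complex" and c
    assume f: "\<forall>x y. f (x + y) = f x + f y" "\<forall>a x. f (a *\<^sub>C x) = a * f x"
      "\<forall>x. cmod (f x) \<le> c * norm x" "0 \<le> c"
    obtain v where "\<And>x. f x = cinner x v" "sqrt (Re (cinner v v)) \<le> c"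
      by (rule riesz_on_subspace[OF hermitian_form_cinner hilbert_subspace_cinner, of UNIV f c])
        (use f in \<open>auto simp: norm_eq_sqrt_cinner cv.subspace_UNIV\<close>)
    then show "\<exists>v. (\<forall>x. f x = cinner x v) \<and> norm v \<le> 1 * c" by (auto simp: norm_eq_sqrt_cinner)
  qed
qed (rule hermitian_form_cinner)

lemma hermitian_form_uminus:
  assumes "hermitian_form ip"
  shows "hermitian_form (\<lambda>x y. - ip x y)"
  using assms unfolding hermitian_form_def by (metis complex_cnj_minus minus_add_distrib mult_minus_right)

text \<open>A fundamental decomposition reduces everything to two Hilbert spaces: a functional is
  represented on \<open>Kp\<close> by the form and on \<open>Km\<close> by its negative, and the two
  vectors are combined with opposite signs. One factor 1 / c enters when the bound of the functional
  is expressed in the Hilbert norm, another when the resulting vector is measured in the given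
  norm.\<close>

lemma riesz_form_krein:
  assumes K: "krein_space ip"
  shows "riesz_form ip"
proof -
  have h: "hermitian_form ip" using K by (simp add: krein_space_def)
  have h': "hermitian_form (\<lambda>x y. - ip x y)" by (rule hermitian_form_uminus[OF h])
  obtain Kp Km c C where Kp: "hilbert_subspace ip Kp" and Km: "hilbert_subspace (\<lambda>x y. - ip x y) Km"
    and orth0: "\<forall>x\<in>Kp. \<forall>y\<in>Km. ip x y = 0" and dec: "\<forall>z. \<exists>x\<in>Kp. \<exists>y\<in>Km. z = x + y"
    and c: "0 < c" and C: "0 < C" and "\<forall>x\<in>Kp. \<forall>y\<in>Km.
           c * norm (x + y) \<le> sqrt (Re (ip x x) - Re (ip y y)) \<and>
           sqrt (Re (ip x x) - Re (ip y y)) \<le> C * norm (x + y)"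
    using K unfolding krein_space_def by (elim conjE exE) (rule that)
  then have cn: "\<And>x y. x \<in> Kp \<Longrightarrow> y \<in> Km \<Longrightarrow> c * norm (x + y) \<le> sqrt (Re (ip x x) - Re (ip y y))"
    and Cn: "\<And>x y. x \<in> Kp \<Longrightarrow> y \<in> Km \<Longrightarrow> sqrt (Re (ip x x) - Re (ip y y)) \<le> C * norm (x + y)"
    by simp_all
  have orth: "\<And>x y. x \<in> Kp \<Longrightarrow> y \<in> Km \<Longrightarrow> ip x y = 0" using orth0 by blast
  have orth': "ip y x = 0" if "x \<in> Kp" "y \<in> Km" for x y
    using orth[OF that] hermitian_form_cnj[OF h, of x y] by simp
  have subp: "csubspace Kp" and subm: "csubspace Km"
    using Kp Km by (auto simp: hilbert_subspace_def)
  have p0: "0 \<in> Kp" and m0: "0 \<in> Km" using subp subm by (auto simp: cv.subspace_0)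
  have posp: "0 \<le> Re (ip x x)" if "x \<in> Kp" for x using hilbert_subspace_nonneg[OF h Kp that] .
  have posm: "Re (ip x x) \<le> 0" if "x \<in> Km" for x using hilbert_subspace_nonneg[OF h' Km that] by simp
  have split: "ip (x + y) (x' + y') = ip x x' + ip y y'" if "x \<in> Kp" "y \<in> Km" "x' \<in> Kp" "y' \<in> Km" for x y x' y'
    using that orth orth' h by (simp add: hermitian_form_simps)
  have nd: "x = 0" if "\<forall>u. ip u x = 0" for x
  proof -
    obtain a b where ab: "a \<in> Kp" "b \<in> Km" "x = a + b" using dec by blast
    have "ip a a = 0" using that[rule_format, of a] ab orth h by (simp add: hermitian_form_simps)
    moreover have "ip b b = 0" using that[rule_format, of b] ab orth' h by (simp add: hermitian_form_simps)
    ultimately show ?thesis using cn[OF ab(1,2)] c ab(3) by (simp add: mult_le_0_iff)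
  qed
  \<comment> \<open>Each component is dominated by the full Hilbert norm, as \<open>p\<close> and
    \<open>- r\<close> are both nonnegative.\<close>
  have sq: "sqrt p \<le> t \<and> sqrt (- r) \<le> t" if "sqrt (p - r) \<le> t" "0 \<le> p" "r \<le> 0" for p r t :: real
    using that by (auto intro: order_trans[OF real_sqrt_le_mono that(1)])
  have cont: "cmod (ip z w) \<le> (2 * C\<^sup>2) * norm z * norm w" for z w
  proof -
    obtain a b where ab: "a \<in> Kp" "b \<in> Km" "z = a + b" using dec by blast
    obtain a' b' where ab': "a' \<in> Kp" "b' \<in> Km" "w = a' + b'" using dec by blast
    have s1: "sqrt (Re (ip a a)) \<le> C * norm z" "sqrt (- Re (ip b b)) \<le> C * norm z"
      using sq[OF Cn[OF ab(1,2)] posp[OF ab(1)] posm[OF ab(2)]] ab(3) by simp_all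
    have s2: "sqrt (Re (ip a' a')) \<le> C * norm w" "sqrt (- Re (ip b' b')) \<le> C * norm w"
      using sq[OF Cn[OF ab'(1,2)] posp[OF ab'(1)] posm[OF ab'(2)]] ab'(3) by simp_all
    have Cz: "0 \<le> C * norm z" using C by simp
    have "cmod (ip a a') \<le> sqrt (Re (ip a a)) * sqrt (Re (ip a' a'))"
      by (rule hilbert_subspace_Cauchy_Schwarz[OF h Kp ab(1) ab'(1)])
    also have "\<dots> \<le> (C * norm z) * (C * norm w)"
      using s1 s2 Cz posp[OF ab'(1)] by (intro mult_mono) auto
    finally have 1: "cmod (ip a a') \<le> (C * norm z) * (C * norm w)" .
    have "cmod (ip b b') \<le> sqrt (- Re (ip b b)) * sqrt (- Re (ip b' b'))"
      using hilbert_subspace_Cauchy_Schwarz[OF h' Km ab(2) ab'(2)] by simp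
    also have "\<dots> \<le> (C * norm z) * (C * norm w)"
      using s1 s2 Cz posm[OF ab'(2)] by (intro mult_mono) auto
    finally have 2: "cmod (ip b b') \<le> (C * norm z) * (C * norm w)" .
    have "cmod (ip z w) \<le> cmod (ip a a') + cmod (ip b b')"
      unfolding ab(3) ab'(3) split[OF ab(1,2) ab'(1,2)] by (rule norm_triangle_ineq)
    then show ?thesis using 1 2 by (simp add: power2_eq_square mult_ac)
  qed
  have rep: "\<exists>v. (\<forall>x. f x = ip x v) \<and> norm v \<le> (2 / c\<^sup>2) * d"
    if add: "\<forall>x y. f (x + y) = f x + f y" and scale: "\<forall>a x. f (a *\<^sub>C x) = a * f x"
      and bd: "\<forall>x. cmod (f x) \<le> d * norm x" and d: "0 \<le> d" for f d
  proof -
    have dc: "0 \<le> d / c" using c d by simp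
    have bp: "cmod (f x) \<le> (d / c) * sqrt (Re (ip x x))" if "x \<in> Kp" for x
    proof -
      have "norm x \<le> sqrt (Re (ip x x)) / c"
        using cn[OF that m0] c h by (simp add: hermitian_form_simps field_simps)
      then have "d * norm x \<le> d * (sqrt (Re (ip x x)) / c)" using d by (rule mult_left_mono)
      then show ?thesis using bd[rule_format, of x] by simp
    qed
    have bm: "cmod (f x) \<le> (d / c) * sqrt (Re (- ip x x))" if "x \<in> Km" for x
    proof -
      have "norm x \<le> sqrt (- Re (ip x x)) / c"
        using cn[OF p0 that] c h by (simp add: hermitian_form_simps field_simps)
      then have "d * norm x \<le> d * (sqrt (- Re (ip x x)) / c)" using d by (rule mult_left_mono)
      then show ?thesis using bd[rule_format, of x] by simp
    qed
    obtain vp where vp: "vp \<in> Kp" "\<And>x. x \<in> Kp \<Longrightarrow> f x = ip x vp" "sqrt (Re (ip vp vp)) \<le> d / c"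
      by (rule riesz_on_subspace[OF h Kp subp order_refl, of f "d / c"]) (use add scale bp dc in auto)
    obtain vm where vm: "vm \<in> Km" "\<And>x. x \<in> Km \<Longrightarrow> f x = - ip x vm" "sqrt (Re (- ip vm vm)) \<le> d / c"
      by (rule riesz_on_subspace[OF h' Km subm order_refl, of f "d / c"]) (use add scale bm dc in auto)
    have vm': "- vm \<in> Km" using vm(1) subm by (rule cv.subspace_neg[rotated])
    have "f z = ip z (vp + - vm)" for z
    proof -
      obtain a b where ab: "a \<in> Kp" "b \<in> Km" "z = a + b" using dec by blast
      have "f z = f a + f b" using add ab(3) by blast
      then show ?thesis unfolding ab(3) split[OF ab(1,2) vp(1) vm'] using vp(2)[OF ab(1)] vm(2)[OF ab(2)] h
        by (simp add: hermitian_form_simps)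
    qed
    moreover have "norm (vp + - vm) \<le> (2 / c\<^sup>2) * d"
    proof -
      have "c * norm (vp + - vm) \<le> sqrt (Re (ip vp vp) + - Re (ip vm vm))"
        using cn[OF vp(1) vm'] h by (simp add: hermitian_form_simps)
      also have "\<dots> \<le> sqrt (Re (ip vp vp)) + sqrt (- Re (ip vm vm))"
        using posp[OF vp(1)] posm[OF vm(1)] by (intro sqrt_add_le_add_sqrt) auto
      also have "\<dots> \<le> 2 * (d / c)" using vp(3) vm(3) by simp
      finally show ?thesis using c by (simp add: field_simps power2_eq_square)
    qed
    ultimately show ?thesis by blast
  qed
  show ?thesis unfolding riesz_form_def using h cont nd rep by blast
qed

lemma riesz_form_hermitian: "riesz_form ip \<Longrightarrow> hermitian_form ip"
  by (simp add: riesz_form_def)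

lemma riesz_form_nondegenerate:
  assumes "riesz_form ip" "\<forall>u. ip u x = 0"
  shows "x = 0"
proof -
  have "\<forall>x. (\<forall>u. ip u x = 0) \<longrightarrow> x = 0"
    using assms(1) unfolding riesz_form_def by (elim conjE)
  from mp[OF spec[OF this] assms(2)] show ?thesis .
qed

lemma riesz_form_eqI:
  assumes "riesz_form ip" "\<And>u. ip u x = ip u y"
  shows "x = y"
proof -
  have "\<forall>u. ip u (x - y) = 0"
    using assms by (simp add: hermitian_form_diff_right riesz_form_hermitian)
  then show ?thesis using riesz_form_nondegenerate[OF assms(1)] by force
qed

lemma riesz_form_bounded:
  assumes "riesz_form ip"
  obtains M where "\<And>x y. cmod (ip x y) \<le> M * norm x * norm y"
proof -
  have "\<exists>M. \<forall>x y. cmod (ip x y) \<le> M * norm x * norm y"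
    using assms unfolding riesz_form_def by (elim conjE)
  then show ?thesis using that by blast
qed

lemma adj_eqI:
  assumes "riesz_form ipa" "\<And>u. ipb (T u) y = ipa u z"
  shows "adj ipa ipb T y = z"
  unfolding adj_def
proof (rule the_equality)
  fix x
  assume "\<forall>u. ipb (T u) y = ipa u x"
  then show "x = z" using assms(2) by (intro riesz_form_eqI[OF assms(1)]) simp
qed (use assms(2) in simp)

text \<open>For fixed \<open>y\<close> the functional u \<mapsto> [T u, y] has a bound proportional
  to \<open>norm y\<close>; the uniform Riesz constant carries this bound over to the representing
  vector.\<close>

lemma riesz_form_adjoint:
  assumes a: "riesz_form ipa" and b: "riesz_form ipb" and T: "bounded_clinear T"
  shows "bounded_clinear (adj ipa ipb T) \<and> (\<forall>u y. ipb (T u) y = ipa u (adj ipa ipb T y))"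
proof -
  have hb: "hermitian_form ipb" and ha: "hermitian_form ipa" using a b by (simp_all add: riesz_form_hermitian)
  obtain K where K: "0 < K" "\<And>x. norm (T x) \<le> norm x * K" using bounded_clinear_bound[OF T] by metis
  obtain M' where M': "\<And>x y. cmod (ipb x y) \<le> M' * norm x * norm y"
    using riesz_form_bounded[OF b] by metis
  \<comment> \<open>The constant supplied by boundedness of the form could be negative, as on the
    zero space; the monotonicity arguments need a nonnegative one.\<close>
  define M where "M = max M' 0"
  have M: "cmod (ipb x y) \<le> M * norm x * norm y" "0 \<le> M" for x y
  proof -
    have "M' * norm x * norm y \<le> M * norm x * norm y" unfolding M_def by (intro mult_right_mono) auto
    with M'[of x y] show "cmod (ipb x y) \<le> M * norm x * norm y" by linarith
  qed (simp add: M_def)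
  obtain N where N: "\<And>f c. (\<forall>x y. f (x + y) = f x + f y) \<Longrightarrow> (\<forall>a x. f (a *\<^sub>C x) = a * f x) \<Longrightarrow>
        (\<forall>x. cmod (f x) \<le> c * norm x) \<Longrightarrow> 0 \<le> c \<Longrightarrow> (\<exists>v. (\<forall>x. f x = ipa x v) \<and> norm v \<le> N * c)"
  proof -
    have "\<exists>M. \<forall>f c. (\<forall>x y. f (x + y) = f x + f y) \<longrightarrow> (\<forall>a x. f (a *\<^sub>C x) = a * f x) \<longrightarrow>
        (\<forall>x. cmod (f x) \<le> c * norm x) \<longrightarrow> 0 \<le> c \<longrightarrow> (\<exists>v. (\<forall>x. f x = ipa x v) \<and> norm v \<le> M * c)"
      using a unfolding riesz_form_def by (elim conjE)
    then show ?thesis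
      by (elim exE) (rule that, drule spec, drule spec, (drule mp, assumption)+, assumption)
  qed
  have "\<exists>v. (\<forall>u. ipb (T u) y = ipa u v) \<and> norm v \<le> N * (M * K * norm y)" for y
  proof (rule N)
    show "\<forall>x. cmod (ipb (T x) y) \<le> M * K * norm y * norm x"
    proof
      fix x
      have "M * norm (T x) * norm y \<le> M * (norm x * K) * norm y"
        using K M by (intro mult_right_mono mult_left_mono) auto
      then show "cmod (ipb (T x) y) \<le> M * K * norm y * norm x" using M(1)[of "T x" y] by (simp add: mult_ac)
    qed
  qed (use K M T hb in \<open>auto simp: bounded_clinear_add_apply bounded_clinear_scale_apply hermitian_form_simps\<close>)
  then obtain T' where T': "\<And>u y. ipb (T u) y = ipa u (T' y)" "\<And>y. norm (T' y) \<le> N * (M * K * norm y)"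
    by metis
  have "adj ipa ipb T = T'" using T'(1) by (auto intro!: adj_eqI[OF a])
  moreover have "bounded_clinear T'"
  proof (rule bounded_clinearI[where K="N * M * K"])
    show "T' (x + y) = T' x + T' y" for x y
      by (rule riesz_form_eqI[OF a]) (simp add: hermitian_form_simps ha hb flip: T'(1))
    show "T' (s *\<^sub>C x) = s *\<^sub>C T' x" for s x
      by (rule riesz_form_eqI[OF a]) (simp add: hermitian_form_simps ha hb flip: T'(1))
    show "norm (T' x) \<le> norm x * (N * M * K)" for x using T'(2)[of x] by (simp add: mult_ac)
  qed
  ultimately show ?thesis using T' by simp
qed

section \<open>Invertible bounded operators\<close>

definition invertible_op :: "('a::complex_normed_vector \<Rightarrow> 'a) \<Rightarrow> bool" where
  "invertible_op P \<longleftrightarrow> bounded_clinear P \<and> (\<exists>Q. bounded_clinear Q \<and> P \<circ> Q = id \<and> Q \<circ> P = id)"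

text \<open>Inverting means solving x = y + M x, a fixed point problem for a contraction. Linearity
  of the solution map follows from uniqueness of the fixed point, and its bound 1 / (1 - k) from the
  equation itself.\<close>

lemma invertible_op_perturb:
  fixes M :: "'a::{complex_normed_vector, complete_space} \<Rightarrow> 'a"
  assumes M: "bounded_clinear M" and k: "0 \<le> k" "k < 1" and b: "\<And>x. norm (M x) \<le> k * norm x"
  shows "invertible_op (\<lambda>x. x - M x)"
proof -
  have bP: "bounded_clinear (\<lambda>x. x - M x)"
    using bounded_clinear_add[OF bounded_clinear_id bounded_clinear_scale[OF M, of "-1"]]
    by (simp add: scaleC_one cv.scale_minus_left)
  have ex: "\<exists>!x. y + M x = x" for y
    using banach_fix_type[OF k, of "\<lambda>x. y + M x"] b
      by (simp add: dist_norm flip: bounded_clinear_diff_apply[OF M])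
  define Q where "Q y = (THE x. y + M x = x)" for y
  have Q: "y + M (Q y) = Q y" for y unfolding Q_def by (rule theI'[OF ex])
  have Qu: "Q y = x" if "y + M x = x" for x y using ex[of y] Q[of y] that by blast
  have "bounded_clinear Q"
  proof (rule bounded_clinearI[where K="1 / (1 - k)"])
    show "Q (x + y) = Q x + Q y" for x y
      by (rule Qu) (metis (no_types, lifting) Q M add.assoc add.left_commute bounded_clinear_add_apply)
    show "Q (a *\<^sub>C x) = a *\<^sub>C Q x" for a x
      by (rule Qu) (metis Q M bounded_clinear_scale_apply scaleC_add_right)
    show "norm (Q x) \<le> norm x * (1 / (1 - k))" for x
    proof -
      have "norm (Q x) \<le> norm x + k * norm (Q x)" using Q[of x] b[of "Q x"] norm_triangle_ineq[of x "M (Q x)"] by simp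
      then show ?thesis using k by (simp add: field_simps)
    qed
  qed
  moreover have "(\<lambda>x. x - M x) \<circ> Q = id" using Q by (auto simp: fun_eq_iff algebra_simps)
  moreover have "Q \<circ> (\<lambda>x. x - M x) = id" using Qu by (auto simp: fun_eq_iff)
  ultimately show ?thesis unfolding invertible_op_def using bP by blast
qed

section \<open>Rational functions of a linear relation\<close>

definition poly_op :: "('a::complex_vector \<Rightarrow> 'a) \<Rightarrow> complex poly \<Rightarrow> 'a \<Rightarrow> 'a" where
  "poly_op B p x = (\<Sum>i\<le>degree p. coeff p i *\<^sub>C (B ^^ i) x)"

lemma poly_op_extend:
  assumes "degree p \<le> n"
  shows "poly_op B p x = (\<Sum>i\<le>n. coeff p i *\<^sub>C (B ^^ i) x)"
  unfolding poly_op_def using assms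
  by (intro sum.mono_neutral_left) (auto simp: coeff_eq_0)

lemma bounded_clinear_sum_apply:
  "bounded_clinear f \<Longrightarrow> f (\<Sum>i\<in>I. g i) = (\<Sum>i\<in>I. f (g i))"
  by (simp add: bounded_clinear_def linear_sum bounded_linear.linear)

lemma poly_op_pCons:
  assumes "bounded_clinear B"
  shows "poly_op B (pCons a p) x = a *\<^sub>C x + B (poly_op B p x)"
proof -
  have "poly_op B (pCons a p) x = (\<Sum>i\<le>Suc (degree p). coeff (pCons a p) i *\<^sub>C (B ^^ i) x)"
    by (rule poly_op_extend) (rule degree_pCons_le)
  also have "\<dots> = a *\<^sub>C x + (\<Sum>i\<le>degree p. coeff p i *\<^sub>C B ((B ^^ i) x))"
    by (subst sum.atMost_Suc_shift) simp
  finally show ?thesis using assms unfolding poly_op_def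
    by (simp add: bounded_clinear_sum_apply bounded_clinear_scale_apply)
qed

lemma poly_op_0 [simp]: "poly_op B 0 x = 0"
  by (simp add: poly_op_def)

lemma poly_op_const [simp]: "poly_op B [:c:] x = c *\<^sub>C x"
  by (simp add: poly_op_def)

lemma poly_op_1 [simp]: "poly_op B 1 x = x"
  by (simp add: poly_op_def scaleC_one)

lemma poly_op_add: "poly_op B (p + q) x = poly_op B p x + poly_op B q x"
proof -
  define n where "n = max (degree p) (degree q)"
  have "degree p \<le> n" "degree q \<le> n" "degree (p + q) \<le> n" unfolding n_def by (auto intro: degree_add_le)
  then show ?thesis by (simp add: poly_op_extend[of _ n] scaleC_add_left sum.distrib)
qed

lemma poly_op_smult: "poly_op B (smult a p) x = a *\<^sub>C poly_op B p x"
proof -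
  have "degree (smult a p) \<le> degree p" by simp
  then show ?thesis
    by (simp add: poly_op_extend[of "smult a p" "degree p"] poly_op_def cv.scale_sum_right scaleC_scaleC)
qed

lemma bounded_clinear_poly_op: "bounded_clinear B \<Longrightarrow> bounded_clinear (poly_op B p)"
  unfolding poly_op_def[abs_def] by (intro bounded_clinear_intros) auto

lemma poly_op_mult:
  assumes "bounded_clinear B"
  shows "poly_op B (p * q) x = poly_op B p (poly_op B q x)"
  by (induction p) (simp_all add: poly_op_pCons[OF assms] poly_op_add poly_op_smult)

lemma poly_op_commute:
  assumes "bounded_clinear B" "bounded_clinear B'" "bounded_clinear C" "\<And>x. C (B x) = B' (C x)"
  shows "C (poly_op B p x) = poly_op B' p (C x)"
  by (induction p)
    (simp_all add: poly_op_pCons assms bounded_clinear_add_apply bounded_clinear_scale_apply bounded_clinear_zero_apply)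

lemma invertible_op_comp:
  assumes "invertible_op P" "invertible_op Q"
  shows "invertible_op (P \<circ> Q)"
proof -
  obtain P' Q' where "bounded_clinear P'" "P \<circ> P' = id" "P' \<circ> P = id"
    "bounded_clinear Q'" "Q \<circ> Q' = id" "Q' \<circ> Q = id"
    using assms unfolding invertible_op_def by metis
  then show ?thesis using assms unfolding invertible_op_def
    by (intro conjI bounded_clinear_comp exI[of _ "Q' \<circ> P'"]) (auto simp: fun_eq_iff)
qed

text \<open>With R' the inverse of the product R, the operator Q R' is a right inverse of P. It is
  also a left inverse, because Q R = Q P Q = R Q lets Q commute with R'.\<close>

lemma invertible_op_factor:
  assumes "invertible_op R" "bounded_clinear P" "bounded_clinear Q"
    and PQ: "\<And>x. P (Q x) = R x" and QP: "\<And>x. Q (P x) = R x"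
  shows "invertible_op P"
proof -
  obtain R' where R': "bounded_clinear R'" "R \<circ> R' = id" "R' \<circ> R = id"
    using assms(1) unfolding invertible_op_def by metis
  have r1: "R (R' x) = x" and r2: "R' (R x) = x" for x
    using R' by (metis comp_apply id_apply)+
  have comm: "Q (R' x) = R' (Q x)" for x
    by (metis PQ QP r1 r2)
  have "P (Q (R' x)) = x" for x by (simp add: PQ r1)
  moreover have "Q (R' (P x)) = x" for x unfolding comm by (simp add: QP r2)
  ultimately show ?thesis unfolding invertible_op_def using assms(2,3) R'(1)
    by (intro conjI exI[of _ "Q \<circ> R'"] bounded_clinear_comp) (auto simp: fun_eq_iff)
qed

lemma invertible_op_inj: "invertible_op P \<Longrightarrow> P x = P y \<Longrightarrow> x = y"
  unfolding invertible_op_def by (metis comp_apply id_apply)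

lemma invertible_op_scale:
  assumes "invertible_op P" "a \<noteq> 0"
  shows "invertible_op (\<lambda>x. a *\<^sub>C P x)"
proof -
  obtain P' where P': "bounded_clinear P'" "P \<circ> P' = id" "P' \<circ> P = id" and P: "bounded_clinear P"
    using assms(1) unfolding invertible_op_def by metis
  show ?thesis unfolding invertible_op_def
    using P P' assms(2)
    by (intro conjI exI[of _ "\<lambda>x. (1 / a) *\<^sub>C P' x"] bounded_clinear_scale)
      (auto simp: fun_eq_iff scaleC_scaleC bounded_clinear_scale_apply scaleC_one)
qed

lemma invertible_op_id: "invertible_op (\<lambda>x. x)"
  unfolding invertible_op_def using bounded_clinear_id by (auto simp: id_def intro!: exI[of _ id])

text \<open>\<open>moebius_poly m n N\<close> is the polynomial \<open>w ^ n * N (m + 1 / w)\<close>; it requires \<open>degree N \<le> n\<close>.\<close>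

definition moebius_poly :: "complex \<Rightarrow> nat \<Rightarrow> complex poly \<Rightarrow> complex poly" where
  "moebius_poly m n N = monom 1 (n - degree N) * reflect_poly (pcompose N [:m, 1:])"

lemma poly_moebius_poly:
  assumes "degree N \<le> n" "w \<noteq> 0"
  shows "poly (moebius_poly m n N) w = w ^ n * poly N (m + 1 / w)"
proof -
  have "degree (pcompose N [:m, 1:]) = degree N" by (simp add: degree_pcompose)
  moreover have "w ^ n = w ^ (n - degree N) * w ^ degree N" using assms by (simp flip: power_add)
  ultimately show ?thesis using assms unfolding moebius_poly_def
    by (simp add: poly_monom poly_reflect_poly_nz poly_pcompose inverse_eq_divide)
qed

lemma lead_coeff_pcompose_shift: "lead_coeff (pcompose N [:m, 1:]) = lead_coeff (N :: complex poly)"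
  by (cases "degree N = 0") (auto elim!: degree_eq_zeroE simp: lead_coeff_comp)

text \<open>The point w = 0 is the image of infinity; there w^n N(m + 1 / w) reduces to the
  coefficient of z^n, which is 0 as soon as the degree is smaller than n.\<close>

lemma poly_moebius_poly_0:
  assumes "degree N \<le> n"
  shows "poly (moebius_poly m n N) 0 = coeff N n"
proof (cases "degree N = n")
  case True
  then show ?thesis unfolding moebius_poly_def
    using lead_coeff_pcompose_shift[of N m] by (simp add: poly_0_coeff_0)
next
  case False
  then show ?thesis unfolding moebius_poly_def using assms
    by (simp add: poly_monom coeff_eq_0)
qed

text \<open>Serves to check identities between transformed polynomials where 1 / w makes sense; a
  nonzero difference would have finitely many roots.\<close>

lemma poly_eqI_nonzero:
  fixes p q :: "complex poly"
  assumes "\<And>w. w \<noteq> 0 \<Longrightarrow> poly p w = poly q w"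
  shows "p = q"
proof (rule ccontr)
  assume "p \<noteq> q"
  then have "finite {w. poly (p - q) w = 0}" by (intro poly_roots_finite) simp
  moreover have "- {0} \<subseteq> {w. poly (p - q) w = 0}" using assms by auto
  ultimately have "finite (- {0 :: complex})" by (rule rev_finite_subset)
  then show False by (simp add: finite_compl infinite_UNIV_char_0)
qed

lemma moebius_poly_mult:
  assumes "degree N \<le> n" "degree M \<le> k"
  shows "moebius_poly m (n + k) (N * M) = moebius_poly m n N * moebius_poly m k M"
proof (rule poly_eqI_nonzero)
  have d: "degree (N * M) \<le> n + k" using degree_mult_le[of N M] assms by linarith
  show "poly (moebius_poly m (n + k) (N * M)) w = poly (moebius_poly m n N * moebius_poly m k M) w"
    if "w \<noteq> 0" for w
    using that by (simp add: poly_moebius_poly[OF d] poly_moebius_poly[OF assms(1)]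
        poly_moebius_poly[OF assms(2)] power_add)
qed

lemma moebius_poly_add:
  assumes "degree N \<le> n" "degree M \<le> n"
  shows "moebius_poly m n (N + M) = moebius_poly m n N + moebius_poly m n M"
proof (rule poly_eqI_nonzero)
  have d: "degree (N + M) \<le> n" using assms by (rule degree_add_le)
  show "poly (moebius_poly m n (N + M)) w = poly (moebius_poly m n N + moebius_poly m n M) w"
    if "w \<noteq> 0" for w
    using that by (simp add: poly_moebius_poly[OF d] poly_moebius_poly[OF assms(1)]
        poly_moebius_poly[OF assms(2)] distrib_left)
qed

lemma moebius_poly_const: "moebius_poly m n [:c:] = monom c n"
  by (rule poly_eqI_nonzero) (simp add: poly_moebius_poly poly_monom)

lemma moebius_poly_linear: "moebius_poly m 1 [:a, 1:] = [:1, m + a:]"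
proof (rule poly_eqI_nonzero)
  fix w :: complex
  assume "w \<noteq> 0"
  then show "poly (moebius_poly m 1 [:a, 1:]) w = poly [:1, m + a:] w"
    by (subst poly_moebius_poly) (auto simp: distrib_left)
qed

text \<open>At t = m total division gives 0, which collides with the value at infinity. For this
  reason \<open>moebius_factor_dvd\<close> and \<open>rat_eval_moebius\<close> exclude
  \<open>Some m\<close>, a point that is never in the spectrum when \<open>m\<close> is a resolvent
  point.\<close>

definition moebius_point :: "complex \<Rightarrow> sphere \<Rightarrow> complex" where
  "moebius_point m t = (case t of None \<Rightarrow> 0 | Some t \<Rightarrow> 1 / (t - m))"

lemma moebius_point_simps [simp]:
  "moebius_point m None = 0" "moebius_point m (Some t) = 1 / (t - m)"
  by (simp_all add: moebius_point_def)

text \<open>The numerator of z - \<alpha> in the coordinate w = 1 / (z - m), since z - \<alpha> = (1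
  + (m - \<alpha>) w) / w; for infinity it is w. For \<alpha> = m it is the constant 1, in
  accordance with \<open>m\<close> being a resolvent point.\<close>

definition moebius_factor :: "complex \<Rightarrow> sphere \<Rightarrow> complex poly" where
  "moebius_factor m t = (case t of None \<Rightarrow> [:0, 1:] | Some \<alpha> \<Rightarrow> [:1, m - \<alpha>:])"

lemma moebius_factor_dvd:
  assumes "t \<noteq> Some m" "poly p (moebius_point m t) = 0"
  shows "moebius_factor m t dvd p"
proof -
  have "[:- moebius_point m t, 1:] dvd p" using assms(2) by (simp add: poly_eq_0_iff_dvd)
  moreover have "\<exists>c\<noteq>0. moebius_factor m t = smult c [:- moebius_point m t, 1:]"
  proof (cases t)
    case None
    then show ?thesis by (intro exI[of _ 1]) (simp add: moebius_factor_def)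
  next
    case (Some \<alpha>)
    then show ?thesis using assms(1) by (intro exI[of _ "m - \<alpha>"]) (auto simp: moebius_factor_def field_simps)
  qed
  ultimately show ?thesis by (metis smult_dvd_iff)
qed

section \<open>Resolvents under the Moebius transform\<close>

lemma op_graph_inj: "op_graph f = op_graph g \<Longrightarrow> f = g"
  unfolding op_graph_def by (auto simp: fun_eq_iff set_eq_iff)

lemma resolvent_eqI: "resolvent_rel A \<alpha> = op_graph R \<Longrightarrow> resolvent A \<alpha> = R"
  unfolding resolvent_def by (auto intro!: the_equality dest: op_graph_inj)

lemma resolvent_setD:
  assumes "\<alpha> \<in> resolvent_set A"
  shows "bounded_clinear (resolvent A \<alpha>)" "resolvent_rel A \<alpha> = op_graph (resolvent A \<alpha>)"
  using assms resolvent_eqI unfolding resolvent_set_def by blast+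

text \<open>A single resolvent determines the relation: membership in \<open>A\<close> becomes an
  operator equation, which is the form in which \<open>A\<close> is used below.\<close>

lemma mem_iff_resolvent:
  assumes "Some m \<in> resolvent_set A"
  shows "(x, y) \<in> A \<longleftrightarrow> resolvent A (Some m) (y - m *\<^sub>C x) = x"
proof -
  have "(x, y) \<in> A \<longleftrightarrow> (y - m *\<^sub>C x, x) \<in> resolvent_rel A (Some m)"
    by auto
  also have "\<dots> \<longleftrightarrow> resolvent A (Some m) (y - m *\<^sub>C x) = x"
    unfolding resolvent_setD(2)[OF assms] by (auto simp: op_graph_def)
  finally show ?thesis .
qed

lemma mem_iff_resolvent_None:
  assumes "None \<in> resolvent_set A"
  shows "(x, y) \<in> A \<longleftrightarrow> resolvent A None x = y"
proof -
  have A: "A = op_graph (resolvent A None)" using resolvent_setD(2)[OF assms] by simp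
  show ?thesis by (subst A) (auto simp: op_graph_def)
qed

lemma resolvent_setI:
  fixes A :: "('k::complex_normed_vector \<times> 'k) set"
  assumes "bounded_clinear R" "\<And>x y. (x, y) \<in> A \<longleftrightarrow> R (y - m *\<^sub>C x) = x"
  shows "Some m \<in> resolvent_set A" "resolvent A (Some m) = R"
proof -
  have "resolvent_rel A (Some m) = op_graph R"
  proof (intro set_eqI iffI)
    fix p
    assume "p \<in> op_graph R"
    then obtain h where "p = (h, R h)" by (auto simp: op_graph_def)
    moreover have "(R h, h + m *\<^sub>C R h) \<in> A" using assms(2) by simp
    ultimately show "p \<in> resolvent_rel A (Some m)" by force
  qed (use assms(2) in \<open>auto simp: op_graph_def\<close>)
  then show "Some m \<in> resolvent_set A" "resolvent A (Some m) = R"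
    using assms(1) by (auto simp: resolvent_set_def intro: resolvent_eqI)
qed

lemma resolvent_set_NoneI:
  assumes "bounded_clinear R" "\<And>x y. (x, y) \<in> A \<longleftrightarrow> R x = y"
  shows "None \<in> resolvent_set A" "resolvent A None = R"
proof -
  have "resolvent_rel A None = op_graph R" using assms(2) by (auto simp: op_graph_def)
  then show "None \<in> resolvent_set A" "resolvent A None = R"
    using assms(1) by (auto simp: resolvent_set_def intro: resolvent_eqI)
qed

lemma poly_op_linear: "bounded_clinear B \<Longrightarrow> poly_op B [:a, b:] x = a *\<^sub>C x + b *\<^sub>C B x"
  by (simp add: poly_op_pCons bounded_clinear_scale_apply)

text \<open>The resolvent identity R - B = (\<alpha> - m) B R = (\<alpha> - m) R B in product form,
  where B and R are the resolvents at m and \<alpha>.\<close>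

lemma resolvent_poly_op_eq:
  assumes m: "Some m \<in> resolvent_set A" and \<alpha>: "Some \<alpha> \<in> resolvent_set A"
  shows "poly_op (resolvent A (Some m)) [:1, m - \<alpha>:] (resolvent A (Some \<alpha>) h) = resolvent A (Some m) h"
    and "resolvent A (Some \<alpha>) (poly_op (resolvent A (Some m)) [:1, m - \<alpha>:] h) = resolvent A (Some m) h"
proof -
  define B where "B = resolvent A (Some m)"
  define R where "R = resolvent A (Some \<alpha>)"
  have bB: "bounded_clinear B" unfolding B_def by (rule resolvent_setD(1)[OF m])
  have bR: "bounded_clinear R" unfolding R_def by (rule resolvent_setD(1)[OF \<alpha>])
  have Bm: "(x, y) \<in> A \<longleftrightarrow> B (y - m *\<^sub>C x) = x" for x y unfolding B_def by (rule mem_iff_resolvent[OF m])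
  have R\<alpha>: "(x, y) \<in> A \<longleftrightarrow> R (y - \<alpha> *\<^sub>C x) = x" for x y unfolding R_def by (rule mem_iff_resolvent[OF \<alpha>])
  have "(R h, h + \<alpha> *\<^sub>C R h) \<in> A" unfolding R\<alpha> by simp
  then have "B (h + \<alpha> *\<^sub>C R h - m *\<^sub>C R h) = R h" unfolding Bm .
  then show "poly_op B [:1, m - \<alpha>:] (R h) = B h"
    by (simp add: poly_op_linear[OF bB] bB bounded_clinear_add_apply bounded_clinear_diff_apply
        bounded_clinear_scale_apply scaleC_one cv.scale_left_diff_distrib algebra_simps)
  have "(B h, h + m *\<^sub>C B h) \<in> A" unfolding Bm by simp
  then have "R (h + m *\<^sub>C B h - \<alpha> *\<^sub>C B h) = B h" unfolding R\<alpha> .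
  then show "R (poly_op B [:1, m - \<alpha>:] h) = B h"
    by (simp add: poly_op_linear[OF bB] scaleC_one cv.scale_left_diff_distrib add_diff_eq)
qed

text \<open>Formally A - \<alpha> = (1 + (m - \<alpha>) B) B^-1. Hence (A - \<alpha>)^-1 is B times
  the inverse of the bracket, and conversely the bracket has the inverse 1 + (\<alpha> - m) (A -
  \<alpha>)^-1. At infinity the factor is B itself, with inverse A - m.\<close>

lemma resolvent_set_iff_invertible:
  assumes m: "Some m \<in> resolvent_set A"
  shows "t \<in> resolvent_set A \<longleftrightarrow> invertible_op (poly_op (resolvent A (Some m)) (moebius_factor m t))"
proof -
  define B where "B = resolvent A (Some m)"
  have bB: "bounded_clinear B" unfolding B_def by (rule resolvent_setD(1)[OF m])
  have Bm: "(x, y) \<in> A \<longleftrightarrow> B (y - m *\<^sub>C x) = x" for x y unfolding B_def by (rule mem_iff_resolvent[OF m])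
  show ?thesis unfolding B_def[symmetric]
  proof (cases t)
    case None
    have pB: "poly_op B (moebius_factor m t) = B"
      using None bB by (auto simp: fun_eq_iff moebius_factor_def poly_op_linear scaleC_one)
    show "(t \<in> resolvent_set A) = invertible_op (poly_op B (moebius_factor m t))" unfolding pB
    proof
      assume t: "t \<in> resolvent_set A"
      define R where "R = resolvent A None"
      have bR: "bounded_clinear R" using resolvent_setD(1) t None unfolding R_def by blast
      have Rn: "(x, y) \<in> A \<longleftrightarrow> R x = y" for x y using mem_iff_resolvent_None t None unfolding R_def by blast
      define Q where "Q = (\<lambda>x. R x + (- m) *\<^sub>C id x)"
      have bQ: "bounded_clinear Q" unfolding Q_def by (intro bounded_clinear_intros bR)
      have "B (Q x) = x" for x using Rn[of x "R x"] unfolding Bm Q_def by simp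
      moreover have "Q (B h) = h" for h
        using Rn[of "B h" "h + m *\<^sub>C B h"] Bm[of "B h" "h + m *\<^sub>C B h"] unfolding Q_def by simp
      ultimately show "invertible_op B" unfolding invertible_op_def using bB bQ by (auto simp: fun_eq_iff)
    next
      assume "invertible_op B"
      then obtain Q where Q: "bounded_clinear Q" "B \<circ> Q = id" "Q \<circ> B = id" unfolding invertible_op_def by blast
      have "(x, y) \<in> A \<longleftrightarrow> Q x + m *\<^sub>C id x = y" for x y
      proof -
        have "B (Q x) = x" "Q (B (y - m *\<^sub>C x)) = y - m *\<^sub>C x" using Q(2,3) by (metis comp_apply id_apply)+
        then show ?thesis unfolding Bm by (metis add_diff_cancel_right' diff_add_cancel id_apply)
      qed
      moreover have "bounded_clinear (\<lambda>x. Q x + m *\<^sub>C id x)" by (intro bounded_clinear_intros Q)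
      ultimately show "t \<in> resolvent_set A" unfolding None by (intro resolvent_set_NoneI)
    qed
  next
    case (Some \<alpha>)
    define P where "P = poly_op B [:1, m - \<alpha>:]"
    have pB: "poly_op B (moebius_factor m t) = P" using Some by (simp add: moebius_factor_def P_def)
    have bP: "bounded_clinear P" unfolding P_def by (rule bounded_clinear_poly_op[OF bB])
    have P: "P x = x + (m - \<alpha>) *\<^sub>C B x" for x unfolding P_def by (simp add: poly_op_linear[OF bB] scaleC_one)
    have BP: "B (P x) = P (B x)" for x
      unfolding P by (simp add: bB bounded_clinear_add_apply bounded_clinear_scale_apply)
    show "(t \<in> resolvent_set A) = invertible_op (poly_op B (moebius_factor m t))" unfolding pB
    proof
      assume t: "t \<in> resolvent_set A"
      define R where "R = resolvent A (Some \<alpha>)"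
      have bR: "bounded_clinear R" using resolvent_setD(1) t Some unfolding R_def by blast
      have PR: "P (R h) = B h" and RP: "R (P h) = B h" for h
        using resolvent_poly_op_eq[OF m, of \<alpha> h] t Some unfolding P_def B_def R_def by auto
      define Q where "Q = (\<lambda>x. id x + (\<alpha> - m) *\<^sub>C R x)"
      have bQ: "bounded_clinear Q" unfolding Q_def by (intro bounded_clinear_intros bR)
      have "P (Q x) = P x + (\<alpha> - m) *\<^sub>C B x" for x
        unfolding Q_def by (simp add: bP bounded_clinear_add_apply bounded_clinear_scale_apply PR)
      then have "P (Q x) = x" for x unfolding P by (simp add: cv.scale_left_diff_distrib)
      moreover have "Q (P x) = x" for x
        unfolding Q_def by (simp add: RP) (simp add: P cv.scale_left_diff_distrib)
      ultimately show "invertible_op P" unfolding invertible_op_def using bP bQ by (auto simp: fun_eq_iff)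
    next
      assume "invertible_op P"
      then obtain Q where Q: "bounded_clinear Q" "P \<circ> Q = id" "Q \<circ> P = id" unfolding invertible_op_def by blast
      have PQ: "P (Q x) = x" "Q (P x) = x" for x using Q by (metis comp_apply id_apply)+
      have "(x, y) \<in> A \<longleftrightarrow> (B \<circ> Q) (y - \<alpha> *\<^sub>C x) = x" for x y
      proof
        assume "(x, y) \<in> A"
        then have x: "B (y - m *\<^sub>C x) = x" unfolding Bm .
        have "P (y - m *\<^sub>C x) = y - \<alpha> *\<^sub>C x" unfolding P x by (simp add: cv.scale_left_diff_distrib)
        then show "(B \<circ> Q) (y - \<alpha> *\<^sub>C x) = x" using PQ(2) x by (metis comp_apply)
      next
        assume "(B \<circ> Q) (y - \<alpha> *\<^sub>C x) = x"
        moreover define k where "k = Q (y - \<alpha> *\<^sub>C x)"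
        ultimately have k: "B k = x" "P k = y - \<alpha> *\<^sub>C x" by (auto simp: PQ)
        then have "k = y - m *\<^sub>C x" unfolding P by (simp add: cv.scale_left_diff_distrib algebra_simps)
        then show "(x, y) \<in> A" unfolding Bm using k(1) by simp
      qed
      then show "t \<in> resolvent_set A" unfolding Some
        by (intro resolvent_setI(1)[of "B \<circ> Q"] bounded_clinear_comp bB Q(1))
    qed
  qed
qed

text \<open>\<open>calc_rel B m r R\<close> says that \<open>R\<close> is \<open>r\<close> applied to the relation \<open>A\<close> with
  \<open>(A - m)\<inverse> = B\<close>: after multiplication by \<open>w ^ n\<close> with \<open>w = 1 / (z - m)\<close>, numerator and
  denominator become polynomials in \<open>w\<close>, which can be evaluated at the bounded operator \<open>B\<close>.\<close>

definition calc_rel ::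
    "('k::complex_normed_vector \<Rightarrow> 'k) \<Rightarrow> complex \<Rightarrow> complex poly fract \<Rightarrow> ('k \<Rightarrow> 'k) \<Rightarrow> bool" where
  "calc_rel B m r R \<longleftrightarrow> bounded_clinear R \<and>
     (\<exists>N D n. D \<noteq> 0 \<and> r = Fract N D \<and> degree N \<le> n \<and> degree D \<le> n \<and>
        invertible_op (poly_op B (moebius_poly m n D)) \<and>
        (\<forall>x. poly_op B (moebius_poly m n D) (R x) = poly_op B (moebius_poly m n N) x))"

lemma calc_relI:
  assumes "bounded_clinear R" "D \<noteq> 0" "r = Fract N D" "degree N \<le> n" "degree D \<le> n"
    and "invertible_op (poly_op B (moebius_poly m n D))"
    and "\<And>x. poly_op B (moebius_poly m n D) (R x) = poly_op B (moebius_poly m n N) x"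
  shows "calc_rel B m r R"
  using assms unfolding calc_rel_def by blast

lemma calc_relE:
  assumes "calc_rel B m r R"
  obtains N D n where "D \<noteq> 0" "r = Fract N D" "degree N \<le> n" "degree D \<le> n"
    and "invertible_op (poly_op B (moebius_poly m n D))"
    and "\<And>x. poly_op B (moebius_poly m n D) (R x) = poly_op B (moebius_poly m n N) x"
    and "bounded_clinear R"
  using assms unfolding calc_rel_def by blast

lemma poly_op_comp_invertible:
  assumes "bounded_clinear B" "invertible_op (poly_op B p)" "invertible_op (poly_op B q)"
  shows "invertible_op (poly_op B (p * q))"
proof -
  have "poly_op B (p * q) = poly_op B p \<circ> poly_op B q"
    by (auto simp: fun_eq_iff poly_op_mult[OF assms(1)])
  then show ?thesis using invertible_op_comp[OF assms(2,3)] by simp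
qed

context
  fixes B :: "'k::complex_normed_vector \<Rightarrow> 'k"
  assumes B: "bounded_clinear B"
begin

text \<open>\<open>R\<close> is accessible through the equation D(B) R = N(B). Moving C past both
  polynomials and cancelling the injective D(B) gives the claim.\<close>

lemma calc_rel_commute:
  assumes "calc_rel B m r R" "bounded_clinear C" "\<And>x. C (B x) = B (C x)"
  shows "C (R x) = R (C x)"
proof -
  from assms(1) obtain N D n where inv: "invertible_op (poly_op B (moebius_poly m n D))"
    and eq: "\<And>x. poly_op B (moebius_poly m n D) (R x) = poly_op B (moebius_poly m n N) x"
    by (rule calc_relE) blast
  have "poly_op B (moebius_poly m n D) (C (R x)) = C (poly_op B (moebius_poly m n N) x)"
    by (simp add: poly_op_commute[OF B B assms(2,3), symmetric] eq)
  also have "\<dots> = poly_op B (moebius_poly m n D) (R (C x))"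
    by (simp add: poly_op_commute[OF B B assms(2,3)] eq)
  finally show ?thesis by (rule invertible_op_inj[OF inv])
qed

lemma calc_rel_poly_op:
  assumes "calc_rel B m r R"
  shows "R (poly_op B p x) = poly_op B p (R x)"
  using calc_rel_commute[OF assms bounded_clinear_poly_op[OF B], of p x] poly_op_commute[OF B B B refl]
  by metis

text \<open>Two representations of the same fraction are related by N D' = N' D. Both equations are
  multiplied up to the common denominator, which is invertible and can be cancelled.\<close>

lemma calc_rel_unique:
  assumes "calc_rel B m r R" "calc_rel B m r R'"
  shows "R = R'"
proof
  fix x
  from assms(1) obtain N D n where D: "D \<noteq> 0" and r: "r = Fract N D" and n: "degree N \<le> n" "degree D \<le> n"
    and inv: "invertible_op (poly_op B (moebius_poly m n D))"
    and eq: "\<And>x. poly_op B (moebius_poly m n D) (R x) = poly_op B (moebius_poly m n N) x"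
    by (rule calc_relE) blast
  from assms(2) obtain N' D' n' where D': "D' \<noteq> 0" and r': "r = Fract N' D'"
    and n': "degree N' \<le> n'" "degree D' \<le> n'"
    and inv': "invertible_op (poly_op B (moebius_poly m n' D'))"
    and eq': "\<And>x. poly_op B (moebius_poly m n' D') (R' x) = poly_op B (moebius_poly m n' N') x"
    by (rule calc_relE) blast
  have "N * D' = N' * D" using r r' D D' by (simp add: eq_fract)
  then have *: "moebius_poly m n N * moebius_poly m n' D' = moebius_poly m n' N' * moebius_poly m n D"
    using n n' by (metis add.commute moebius_poly_mult)
  have "poly_op B (moebius_poly m n D * moebius_poly m n' D') (R x)
      = poly_op B (moebius_poly m n' D' * moebius_poly m n N) x"
    by (subst mult.commute) (simp add: poly_op_mult[OF B] eq)
  also have "\<dots> = poly_op B (moebius_poly m n D * moebius_poly m n' D') (R' x)"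
    by (simp add: mult.commute[of "moebius_poly m n' D'"] *)
      (simp add: mult.commute[of "moebius_poly m n' N'"] poly_op_mult[OF B] eq')
  finally show "R x = R' x" by (rule invertible_op_inj[OF poly_op_comp_invertible[OF B inv inv']])
qed

text \<open>As \<open>calc_rel\<close> admits every representation with invertible denominator, the
  product of the two denominators can serve as a common one.\<close>

lemma calc_rel_add:
  assumes "calc_rel B m r R" "calc_rel B m r' R'"
  shows "calc_rel B m (r + r') (\<lambda>x. R x + R' x)"
proof -
  from assms(1) obtain N D n where D: "D \<noteq> 0" and r: "r = Fract N D" and n: "degree N \<le> n" "degree D \<le> n"
    and inv: "invertible_op (poly_op B (moebius_poly m n D))" and R: "bounded_clinear R"
    and eq: "\<And>x. poly_op B (moebius_poly m n D) (R x) = poly_op B (moebius_poly m n N) x"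
    by (rule calc_relE) blast
  from assms(2) obtain N' D' n' where D': "D' \<noteq> 0" and r': "r' = Fract N' D'"
    and n': "degree N' \<le> n'" "degree D' \<le> n'"
    and inv': "invertible_op (poly_op B (moebius_poly m n' D'))" and R': "bounded_clinear R'"
    and eq': "\<And>x. poly_op B (moebius_poly m n' D') (R' x) = poly_op B (moebius_poly m n' N') x"
    by (rule calc_relE) blast
  have d: "degree (N * D') \<le> n + n'" "degree (N' * D) \<le> n + n'" "degree (D * D') \<le> n + n'"
    using n n' degree_mult_le[of N D'] degree_mult_le[of N' D] degree_mult_le[of D D'] by linarith+
  have N: "moebius_poly m (n + n') (N * D' + N' * D)
      = moebius_poly m n N * moebius_poly m n' D' + moebius_poly m n' N' * moebius_poly m n D"
    using d n n' by (simp add: moebius_poly_add moebius_poly_mult add.commute[of n n'] del: add.commute)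
      (metis add.commute moebius_poly_mult)
  show ?thesis
  proof (rule calc_relI[of _ "D * D'" _ "N * D' + N' * D" "n + n'"])
    show "bounded_clinear (\<lambda>x. R x + R' x)" by (intro bounded_clinear_intros R R')
    show "degree (N * D' + N' * D) \<le> n + n'" using d by (intro degree_add_le)
    show "r + r' = Fract (N * D' + N' * D) (D * D')" using D D' r r' by simp
    have DD: "moebius_poly m (n + n') (D * D') = moebius_poly m n D * moebius_poly m n' D'"
      using n n' by (simp add: moebius_poly_mult)
    show "invertible_op (poly_op B (moebius_poly m (n + n') (D * D')))"
      unfolding DD by (rule poly_op_comp_invertible[OF B inv inv'])
    fix x
    have "poly_op B (moebius_poly m n D * moebius_poly m n' D') (R x)
        = poly_op B (moebius_poly m n N * moebius_poly m n' D') x"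
      by (simp only: mult.commute[of _ "moebius_poly m n' D'"] poly_op_mult[OF B] eq)
    moreover have "poly_op B (moebius_poly m n D * moebius_poly m n' D') (R' x)
        = poly_op B (moebius_poly m n' N' * moebius_poly m n D) x"
      by (simp only: mult.commute[of "moebius_poly m n' N'"] poly_op_mult[OF B] eq')
    ultimately show "poly_op B (moebius_poly m (n + n') (D * D')) (R x + R' x) =
        poly_op B (moebius_poly m (n + n') (N * D' + N' * D)) x"
      unfolding DD N by (simp add: bounded_clinear_add_apply[OF bounded_clinear_poly_op[OF B]] poly_op_add)
  qed (use d D D' in auto)
qed

lemma calc_rel_mult:
  assumes "calc_rel B m r R" "calc_rel B m r' R'"
  shows "calc_rel B m (r * r') (R \<circ> R')"
proof -
  from assms(1) obtain N D n where D: "D \<noteq> 0" and r: "r = Fract N D" and n: "degree N \<le> n" "degree D \<le> n"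
    and inv: "invertible_op (poly_op B (moebius_poly m n D))" and R: "bounded_clinear R"
    and eq: "\<And>x. poly_op B (moebius_poly m n D) (R x) = poly_op B (moebius_poly m n N) x"
    by (rule calc_relE) blast
  from assms(2) obtain N' D' n' where D': "D' \<noteq> 0" and r': "r' = Fract N' D'"
    and n': "degree N' \<le> n'" "degree D' \<le> n'"
    and inv': "invertible_op (poly_op B (moebius_poly m n' D'))" and R': "bounded_clinear R'"
    and eq': "\<And>x. poly_op B (moebius_poly m n' D') (R' x) = poly_op B (moebius_poly m n' N') x"
    by (rule calc_relE) blast
  have d: "degree (N * N') \<le> n + n'" "degree (D * D') \<le> n + n'"
    using n n' degree_mult_le[of N N'] degree_mult_le[of D D'] by linarith+
  have DD: "moebius_poly m (n + n') (D * D') = moebius_poly m n D * moebius_poly m n' D'"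
    and NN: "moebius_poly m (n + n') (N * N') = moebius_poly m n N * moebius_poly m n' N'"
    using n n' by (simp_all add: moebius_poly_mult)
  show ?thesis
  proof (rule calc_relI[of _ "D * D'" _ "N * N'" "n + n'"])
    show "bounded_clinear (R \<circ> R')" by (intro bounded_clinear_intros R R')
    show "r * r' = Fract (N * N') (D * D')" using r r' by simp
    show "invertible_op (poly_op B (moebius_poly m (n + n') (D * D')))"
      unfolding DD by (rule poly_op_comp_invertible[OF B inv inv'])
    fix x
    have "poly_op B (moebius_poly m n D * moebius_poly m n' D') (R (R' x))
        = poly_op B (moebius_poly m n' D') (poly_op B (moebius_poly m n N) (R' x))"
      by (simp only: mult.commute[of _ "moebius_poly m n' D'"] poly_op_mult[OF B] eq)
    also have "\<dots> = poly_op B (moebius_poly m n N * moebius_poly m n' N') x"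
      by (simp only: poly_op_mult[OF B, symmetric] mult.commute[of "moebius_poly m n' D'"])
        (simp only: poly_op_mult[OF B] eq')
    finally show "poly_op B (moebius_poly m (n + n') (D * D')) ((R \<circ> R') x) =
        poly_op B (moebius_poly m (n + n') (N * N')) x"
      unfolding DD NN by simp
  qed (use d D D' in auto)
qed

lemma calc_rel_const: "calc_rel B m (Fract [:c:] 1) (\<lambda>x. c *\<^sub>C x)"
proof (rule calc_relI[of _ 1 _ "[:c:]" 0])
  have "bounded_clinear (\<lambda>x. c *\<^sub>C id x)" by (intro bounded_clinear_intros)
  then show "bounded_clinear ((*\<^sub>C) c :: 'k \<Rightarrow> 'k)" by simp
  have 1: "moebius_poly m 0 1 = 1" using moebius_poly_const[of m 0 1] by (simp add: one_pCons)
  then show "invertible_op (poly_op B (moebius_poly m 0 1))"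
    using invertible_op_id by (simp add: poly_op_1[abs_def])
  show "poly_op B (moebius_poly m 0 1) (c *\<^sub>C x) = poly_op B (moebius_poly m 0 [:c:]) x" for x
    unfolding 1 moebius_poly_const by (simp add: monom_0)
qed auto

lemma calc_rel_scale:
  assumes "calc_rel B m r R"
  shows "calc_rel B m (Fract [:c:] 1 * r) (\<lambda>x. c *\<^sub>C R x)"
  using calc_rel_mult[OF calc_rel_const assms] by (simp add: comp_def)

lemma calc_rel_0: "calc_rel B m 0 (\<lambda>x. 0)"
  using calc_rel_const[of m 0] by (simp add: Zero_fract_def)

lemma calc_rel_1: "calc_rel B m 1 (\<lambda>x. x)"
  using calc_rel_const[of m 1] by (simp add: One_fract_def one_pCons scaleC_one)

lemma calc_rel_funpow:
  assumes "calc_rel B m r R"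
  shows "calc_rel B m (r ^ n) (R ^^ n)"
proof (induction n)
  case 0
  then show ?case using calc_rel_1 by (simp add: id_def)
next
  case (Suc n)
  then show ?case using calc_rel_mult[OF assms] by (simp only: power_Suc funpow.simps)
qed

lemma calc_rel_sum:
  assumes "finite I" "\<And>i. i \<in> I \<Longrightarrow> calc_rel B m (r i) (R i)"
  shows "calc_rel B m (\<Sum>i\<in>I. r i) (\<lambda>x. \<Sum>i\<in>I. R i x)"
  using assms by (induction I rule: finite_induct) (auto intro: calc_rel_0 calc_rel_add)

end

lemma calc_rel_resolvent:
  assumes m: "Some m \<in> resolvent_set A" and \<alpha>: "Some \<alpha> \<in> resolvent_set A"
  shows "calc_rel (resolvent A (Some m)) m (Fract 1 [:- \<alpha>, 1:]) (resolvent A (Some \<alpha>))"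
proof (rule calc_relI[of _ "[:- \<alpha>, 1:]" _ 1 1])
  have 1: "moebius_poly m 1 [:- \<alpha>, 1:] = [:1, m - \<alpha>:]" using moebius_poly_linear[of m "- \<alpha>"] by simp
  have 2: "moebius_poly m 1 1 = [:0, 1:]" using moebius_poly_const[of m 1 1] by (simp add: one_pCons monom_Suc monom_0)
  show "invertible_op (poly_op (resolvent A (Some m)) (moebius_poly m 1 [:- \<alpha>, 1:]))"
    using resolvent_set_iff_invertible[OF m, of "Some \<alpha>"] \<alpha> unfolding 1 by (simp add: moebius_factor_def)
  show "poly_op (resolvent A (Some m)) (moebius_poly m 1 [:- \<alpha>, 1:]) (resolvent A (Some \<alpha>) x)
      = poly_op (resolvent A (Some m)) (moebius_poly m 1 1) x" for x
    unfolding 1 2 resolvent_poly_op_eq(1)[OF m \<alpha>]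
    by (simp add: poly_op_linear resolvent_setD(1)[OF m] scaleC_one)
qed (use resolvent_setD(1)[OF \<alpha>] in auto)

lemma calc_rel_resolvent_None:
  assumes m: "Some m \<in> resolvent_set A" and A: "None \<in> resolvent_set A"
  shows "calc_rel (resolvent A (Some m)) m (Fract [:0, 1:] 1) (resolvent A None)"
proof (rule calc_relI[of _ 1 _ "[:0, 1:]" 1])
  have 1: "moebius_poly m 1 [:0, 1:] = [:1, m:]" using moebius_poly_linear[of m 0] by simp
  have 2: "moebius_poly m 1 1 = [:0, 1:]" using moebius_poly_const[of m 1 1] by (simp add: one_pCons monom_Suc monom_0)
  note b = resolvent_setD(1)[OF m]
  show "invertible_op (poly_op (resolvent A (Some m)) (moebius_poly m 1 1))"
    using resolvent_set_iff_invertible[OF m, of None] A unfolding 2 by (simp add: moebius_factor_def)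
  show "poly_op (resolvent A (Some m)) (moebius_poly m 1 1) (resolvent A None x)
      = poly_op (resolvent A (Some m)) (moebius_poly m 1 [:0, 1:]) x" for x
  proof -
    have "(x, resolvent A None x) \<in> A" using mem_iff_resolvent_None[OF A] by simp
    then have "resolvent A (Some m) (resolvent A None x - m *\<^sub>C x) = x" using mem_iff_resolvent[OF m] by simp
    then show ?thesis unfolding 1 2
      by (simp add: poly_op_linear b scaleC_one bounded_clinear_diff_apply bounded_clinear_scale_apply algebra_simps)
  qed
qed (use resolvent_setD(1)[OF A] in auto)

section \<open>Poles of rational functions\<close>

lemma Fract_rnum_rden: "Fract (rnum r) (rden r) = r"
  and rden_nonzero [simp]: "rden r \<noteq> 0"
  and coprime_rnum_rden: "coprime (rnum r) (rden r)"
  by (auto simp: rnum_def rden_def coprime_quot_of_fract)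

lemma rnum_rden_cross:
  assumes "r = Fract N D" "D \<noteq> 0"
  shows "N * rden r = rnum r * D"
  using assms Fract_rnum_rden[of r] eq_fract(1)[of D "rden r" N "rnum r"] by simp

lemma rden_dvd:
  assumes "r = Fract N D" "D \<noteq> 0"
  shows "rden r dvd D"
proof -
  have "rden r dvd rnum r * D" by (metis rnum_rden_cross[OF assms] dvd_triv_right)
  then show ?thesis using coprime_rnum_rden[of r] by (simp add: coprime_commute coprime_dvd_mult_right_iff)
qed

text \<open>The reduced denominator divides every other one. Poles can thus be read off from any
  representation, on which closure under sums and products relies.\<close>

lemma not_pole_Some_iff: "Some z \<notin> rat_poles r \<longleftrightarrow> (\<exists>N D. r = Fract N D \<and> poly D z \<noteq> 0)"
proof
  assume "Some z \<notin> rat_poles r"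
  then show "\<exists>N D. r = Fract N D \<and> poly D z \<noteq> 0"
    by (intro exI[of _ "rnum r"] exI[of _ "rden r"]) (auto simp: rat_poles_def Fract_rnum_rden)
next
  assume "\<exists>N D. r = Fract N D \<and> poly D z \<noteq> 0"
  then obtain N D where ND: "r = Fract N D" "poly D z \<noteq> 0" by blast
  then have "rden r dvd D" by (intro rden_dvd) auto
  then show "Some z \<notin> rat_poles r" using ND(2) by (auto simp: rat_poles_def)
qed

text \<open>Cross multiplication shows that the degree difference of numerator and denominator is
  the same for all representations; the zero function is set apart because the degree of 0 is
  0.\<close>

lemma not_pole_None_iff: "None \<notin> rat_poles r \<longleftrightarrow> (\<exists>N D. D \<noteq> 0 \<and> r = Fract N D \<and> degree N \<le> degree D)"
proof
  assume "None \<notin> rat_poles r"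
  then show "\<exists>N D. D \<noteq> 0 \<and> r = Fract N D \<and> degree N \<le> degree D"
    by (intro exI[of _ "rnum r"] exI[of _ "rden r"]) (auto simp: rat_poles_def Fract_rnum_rden)
next
  assume "\<exists>N D. D \<noteq> 0 \<and> r = Fract N D \<and> degree N \<le> degree D"
  then obtain N D where ND: "D \<noteq> 0" "r = Fract N D" "degree N \<le> degree D" by blast
  have "degree (rnum r) \<le> degree (rden r)"
  proof (cases "N = 0")
    case True
    then have "rnum r * D = 0" using rnum_rden_cross[OF ND(2,1)] by simp
    then show ?thesis using ND(1) by simp
  next
    case False
    then have "rnum r \<noteq> 0" using rnum_rden_cross[OF ND(2,1)] by auto
    have "degree N + degree (rden r) = degree (rnum r) + degree D"
      using rnum_rden_cross[OF ND(2,1)] False \<open>rnum r \<noteq> 0\<close> ND(1) by (metis degree_mult_eq rden_nonzero)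
    then show ?thesis using ND(3) by simp
  qed
  then show "None \<notin> rat_poles r" by (auto simp: rat_poles_def)
qed

lemma not_pole_closed:
  assumes "w \<notin> rat_poles r" "w \<notin> rat_poles r'"
  shows not_pole_add: "w \<notin> rat_poles (r + r')" and not_pole_mult: "w \<notin> rat_poles (r * r')"
proof -
  have "w \<notin> rat_poles (r + r') \<and> w \<notin> rat_poles (r * r')"
  proof (cases w)
    case (Some z)
    obtain N D N' D' where *: "r = Fract N D" "poly D z \<noteq> 0" "r' = Fract N' D'" "poly D' z \<noteq> 0"
      using assms unfolding Some not_pole_Some_iff by blast
    then have "D \<noteq> 0" "D' \<noteq> 0" by auto
    then have "r + r' = Fract (N * D' + N' * D) (D * D')" "r * r' = Fract (N * N') (D * D')"
      using * by simp_all
    moreover have "poly (D * D') z \<noteq> 0" using * by simp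
    ultimately show ?thesis unfolding Some not_pole_Some_iff by blast
  next
    case None
    obtain N D N' D' where *: "D \<noteq> 0" "r = Fract N D" "degree N \<le> degree D"
        "D' \<noteq> 0" "r' = Fract N' D'" "degree N' \<le> degree D'"
      using assms unfolding None not_pole_None_iff by blast
    have 1: "r + r' = Fract (N * D' + N' * D) (D * D')" "r * r' = Fract (N * N') (D * D')" "D * D' \<noteq> 0"
      using * by simp_all
    have d: "degree (D * D') = degree D + degree D'" using * by (simp add: degree_mult_eq)
    have "degree (N * D') \<le> degree (D * D')" "degree (N' * D) \<le> degree (D * D')"
        "degree (N * N') \<le> degree (D * D')"
      using * degree_mult_le[of N D'] degree_mult_le[of N' D] degree_mult_le[of N N'] unfolding d by linarith+
    then show ?thesis unfolding None not_pole_None_iff using 1 degree_add_le by blast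
  qed
  then show "w \<notin> rat_poles (r + r')" "w \<notin> rat_poles (r * r')" by auto
qed

lemma not_pole_const: "w \<notin> rat_poles (Fract [:c:] 1)"
proof (cases w)
  case None
  then show ?thesis unfolding None not_pole_None_iff by (intro exI[of _ "[:c:]"] exI[of _ 1]) auto
next
  case (Some z)
  then show ?thesis unfolding Some not_pole_Some_iff by (intro exI[of _ "[:c:]"] exI[of _ 1]) auto
qed

lemma not_pole_sum:
  assumes "\<And>i. i \<in> I \<Longrightarrow> w \<notin> rat_poles (r i)"
  shows "w \<notin> rat_poles (\<Sum>i\<in>I. r i)"
  using assms
proof (induction I rule: infinite_finite_induct)
  case (insert i I)
  then show ?case by (simp add: not_pole_add)
qed (use not_pole_const[of w 0] in \<open>auto simp: Zero_fract_def\<close>)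

lemma uminus_fract_mult: "- r = Fract [:- 1:] 1 * (r :: complex poly fract)"
proof -
  have "Fract [:- 1:] 1 = - (1 :: complex poly fract)" by (simp add: One_fract_def one_pCons)
  then show ?thesis by simp
qed

lemma not_pole_diff:
  assumes "w \<notin> rat_poles r" "w \<notin> rat_poles r'"
  shows "w \<notin> rat_poles (r - r')"
proof -
  have "w \<notin> rat_poles (r + Fract [:- 1:] 1 * r')"
    using assms by (intro not_pole_add not_pole_mult not_pole_const)
  then show ?thesis by (simp flip: uminus_fract_mult)
qed

section \<open>Partial fractions\<close>

lemma Fract_mult_1: "Fract (a * b) 1 = Fract a 1 * (Fract b 1 :: complex poly fract)"
  by simp

lemma Fract_add_1: "Fract (a + b) 1 = Fract a 1 + (Fract b 1 :: complex poly fract)"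
  by simp

lemma Fract_sum_1: "finite I \<Longrightarrow> Fract (\<Sum>i\<in>I. f i) 1 = (\<Sum>i\<in>I. Fract (f i) 1 :: complex poly fract)"
  by (induction I rule: finite_induct) (auto simp: Zero_fract_def Fract_add_1 simp del: add_fract)

lemma Fract_power_1: "Fract (a ^ n) 1 = (Fract a 1 :: complex poly fract) ^ n"
proof (induction n)
  case (Suc n)
  then show ?case by (simp only: power_Suc Fract_mult_1)
qed (simp add: One_fract_def)

lemma Fract_power_inverse:
  "Fract [:c:] (a ^ n) = Fract [:c:] 1 * (Fract 1 a :: complex poly fract) ^ n"
proof (induction n)
  case (Suc n)
  have "Fract [:c:] (a ^ Suc n) = Fract 1 a * Fract [:c:] (a ^ n)" by simp
  then show ?case by (simp only: Suc power_Suc mult.left_commute)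
qed (simp add: One_fract_def)

lemma linear_neq_0 [simp]: "[:- \<alpha>, 1 :: complex:] \<noteq> 0" "[:- \<alpha>, 1 :: complex:] ^ n \<noteq> 0"
  by auto

lemma principal_part_numerator:
  "\<exists>s. Fract ([:- \<alpha>, 1:] ^ n) 1 * (\<Sum>j=1..n. Fract [:c j:] ([:- \<alpha>, 1:] ^ j)) = (Fract s 1 :: complex poly fract)"
proof (induction n)
  case 0
  show ?case by (rule exI[of _ 0]) (simp add: Zero_fract_def)
next
  case (Suc n)
  let ?X = "[:- \<alpha>, 1:]"
  obtain s where s: "Fract (?X ^ n) 1 * (\<Sum>j=1..n. Fract [:c j:] (?X ^ j)) = Fract s 1" using Suc by blast
  have "Fract (?X ^ Suc n) 1 * (\<Sum>j=1..Suc n. Fract [:c j:] (?X ^ j))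
      = Fract (?X ^ Suc n) 1 * (\<Sum>j=1..n. Fract [:c j:] (?X ^ j)) + Fract (?X ^ Suc n) 1 * Fract [:c (Suc n):] (?X ^ Suc n)"
    by (simp add: distrib_left del: mult_fract power_Suc)
  also have "Fract (?X ^ Suc n) 1 * (\<Sum>j=1..n. Fract [:c j:] (?X ^ j)) = Fract ?X 1 * Fract s 1"
    by (simp only: power_Suc Fract_mult_1 mult.assoc s)
  also have "Fract (?X ^ Suc n) 1 * Fract [:c (Suc n):] (?X ^ Suc n) = Fract [:c (Suc n):] 1"
    using linear_neq_0(2)[of \<alpha> "Suc n"] by (simp add: eq_fract(1) del: power_Suc) 
  finally show ?case by (metis Fract_add_1 Fract_mult_1)
qed

text \<open>After multiplication by the highest power of z - \<alpha> only the top coefficient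
  survives at z = \<alpha>, whereas regularity makes the product vanish there. So the top
  coefficient is 0, and induction strips the others.\<close>

lemma principal_part_regular:
  assumes "Some \<alpha> \<notin> rat_poles (\<Sum>j=1..n. Fract [:c j:] ([:- \<alpha>, 1:] ^ j))" "j \<in> {1..n}"
  shows "c j = 0"
  using assms
proof (induction n)
  case (Suc n)
  let ?X = "[:- \<alpha>, 1:]"
  obtain N D where ND: "(\<Sum>j=1..Suc n. Fract [:c j:] (?X ^ j)) = Fract N D" "poly D \<alpha> \<noteq> 0"
    using Suc.prems(1) unfolding not_pole_Some_iff by blast
  have D: "D \<noteq> 0" using ND(2) by auto
  obtain s where s: "Fract (?X ^ n) 1 * (\<Sum>j=1..n. Fract [:c j:] (?X ^ j)) = Fract s 1"
    using principal_part_numerator by blast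
  have "Fract (?X ^ Suc n) 1 * (\<Sum>j=1..Suc n. Fract [:c j:] (?X ^ j))
      = Fract (?X ^ Suc n) 1 * (\<Sum>j=1..n. Fract [:c j:] (?X ^ j)) + Fract (?X ^ Suc n) 1 * Fract [:c (Suc n):] (?X ^ Suc n)"
    by (simp add: distrib_left del: mult_fract power_Suc)
  also have "Fract (?X ^ Suc n) 1 * (\<Sum>j=1..n. Fract [:c j:] (?X ^ j)) = Fract ?X 1 * Fract s 1"
    by (simp only: power_Suc Fract_mult_1 mult.assoc s)
  also have "Fract (?X ^ Suc n) 1 * Fract [:c (Suc n):] (?X ^ Suc n) = Fract [:c (Suc n):] 1"
    using linear_neq_0(2)[of \<alpha> "Suc n"] by (simp add: eq_fract(1) del: power_Suc)
  finally have "Fract (?X ^ Suc n * N) D = Fract (?X * s + [:c (Suc n):]) 1"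
    unfolding ND by (simp del: power_Suc)
  then have "?X ^ Suc n * N = (?X * s + [:c (Suc n):]) * D"
    using D by (simp add: eq_fract(1) del: power_Suc)
  then have "poly (?X ^ Suc n * N) \<alpha> = poly ((?X * s + [:c (Suc n):]) * D) \<alpha>" by (rule arg_cong)
  then have c: "c (Suc n) = 0" using ND(2) by simp
  then have "Fract [:c (Suc n):] (?X ^ Suc n) = 0" by (simp add: fract_collapse)
  then have "Some \<alpha> \<notin> rat_poles (\<Sum>j=1..n. Fract [:c j:] (?X ^ j))" using Suc.prems(1) by simp
  then show ?case using Suc.IH Suc.prems(2) c by (cases "j = Suc n") auto
qed simp

lemma not_pole_partial_fraction_term:
  assumes "w \<noteq> Some \<alpha>"
  shows "w \<notin> rat_poles (Fract [:c:] ([:- \<alpha>, 1:] ^ j))"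
proof (cases w)
  case None
  have "[:- \<alpha>, 1:] ^ j \<noteq> 0 \<and> Fract [:c:] ([:- \<alpha>, 1:] ^ j) = Fract [:c:] ([:- \<alpha>, 1:] ^ j) \<and>
      degree [:c:] \<le> degree ([:- \<alpha>, 1:] ^ j)" by simp
  then show ?thesis unfolding None not_pole_None_iff by blast
next
  case (Some z)
  have "Fract [:c:] ([:- \<alpha>, 1:] ^ j) = Fract [:c:] ([:- \<alpha>, 1:] ^ j) \<and> poly ([:- \<alpha>, 1:] ^ j) z \<noteq> 0"
    using assms Some by simp
  then show ?thesis unfolding Some not_pole_Some_iff by blast
qed

lemma not_pole_polynomial: "Some z \<notin> rat_poles (Fract p 1)"
  unfolding not_pole_Some_iff by (intro exI[of _ p] exI[of _ 1]) auto

lemma not_pole_polynomial_None: "None \<notin> rat_poles (Fract p 1) \<Longrightarrow> degree p = 0"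
proof -
  assume "None \<notin> rat_poles (Fract p 1)"
  then obtain N D where "D \<noteq> 0" "Fract p 1 = Fract N D" "degree N \<le> degree D"
    unfolding not_pole_None_iff by blast
  then have "p * D = N" "D \<noteq> 0" "degree N \<le> degree D" by (auto simp: eq_fract(1))
  then show "degree p = 0" by (cases "p = 0") (auto simp: degree_mult_eq)
qed

text \<open>\<open>rat_calc\<close> ranges over all decompositions, including those that list points
  outside the resolvent set, where \<open>resolvent\<close> is unspecified. Such terms do no harm
  because their coefficients are forced to vanish.\<close>

lemma calc_rel_partial_fractions:
  assumes m: "Some m \<in> resolvent_set A" and r: "r \<in> rat_algebra A" and P: "finite P"
    and dec: "r = Fract p 1 + (\<Sum>\<alpha>\<in>P. \<Sum>j=1..n. Fract [:c \<alpha> j:] ([:- \<alpha>, 1:] ^ j))"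
  shows "calc_rel (resolvent A (Some m)) m r
    (\<lambda>x. (\<Sum>i\<le>degree p. coeff p i *\<^sub>C (resolvent A None ^^ i) x) +
         (\<Sum>\<alpha>\<in>P. \<Sum>j=1..n. c \<alpha> j *\<^sub>C (resolvent A (Some \<alpha>) ^^ j) x))"
proof -
  define B where "B = resolvent A (Some m)"
  have bB: "bounded_clinear B" unfolding B_def by (rule resolvent_setD(1)[OF m])
  have poles: "w \<notin> rat_poles r" if "w \<notin> resolvent_set A" for w
    using r that by (auto simp: rat_algebra_def)
  have "calc_rel B m (Fract [:c \<alpha> j:] ([:- \<alpha>, 1:] ^ j)) (\<lambda>x. c \<alpha> j *\<^sub>C (resolvent A (Some \<alpha>) ^^ j) x)"
    if \<alpha>: "\<alpha> \<in> P" and j: "j \<in> {1..n}" for \<alpha> j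
  proof (cases "Some \<alpha> \<in> resolvent_set A")
    case True
    show ?thesis unfolding Fract_power_inverse B_def
      by (intro calc_rel_scale calc_rel_funpow calc_rel_resolvent m True resolvent_setD(1)[OF m])
  next
    case False
    \<comment> \<open>The principal part at \<alpha> is isolated as a difference of functions
      regular at \<alpha>; being regular there itself, it has zero coefficients.\<close>
    have "(\<Sum>j=1..n. Fract [:c \<alpha> j:] ([:- \<alpha>, 1:] ^ j))
      = r - Fract p 1 - (\<Sum>\<beta>\<in>P - {\<alpha>}. \<Sum>j=1..n. Fract [:c \<beta> j:] ([:- \<beta>, 1:] ^ j))"
      unfolding dec using P \<alpha> by (simp add: sum.remove[of P \<alpha>])
    also have "Some \<alpha> \<notin> rat_poles \<dots>"
      by (intro not_pole_diff not_pole_sum not_pole_partial_fraction_term not_pole_polynomial poles[OF False]) auto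
    finally have "c \<alpha> j = 0" using principal_part_regular j by blast
    then show ?thesis using calc_rel_0[OF bB, of m] by (simp add: fract_collapse)
  qed
  then have 1: "calc_rel B m (\<Sum>\<alpha>\<in>P. \<Sum>j=1..n. Fract [:c \<alpha> j:] ([:- \<alpha>, 1:] ^ j))
     (\<lambda>x. \<Sum>\<alpha>\<in>P. \<Sum>j=1..n. c \<alpha> j *\<^sub>C (resolvent A (Some \<alpha>) ^^ j) x)"
    using P by (intro calc_rel_sum bB) auto
  have "Fract p 1 = Fract (\<Sum>i\<le>degree p. monom (coeff p i) i) 1" by (simp add: poly_as_sum_of_monoms)
  also have "\<dots> = (\<Sum>i\<le>degree p. Fract (monom (coeff p i) i) 1)"
    by (rule Fract_sum_1) simp
  also have "\<dots> = (\<Sum>i\<le>degree p. Fract [:coeff p i:] 1 * Fract [:0, 1:] 1 ^ i)"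
    by (intro sum.cong refl) (simp add: monom_altdef flip: Fract_power_1)
  finally have Fp: "Fract p 1 = (\<Sum>i\<le>degree p. Fract [:coeff p i:] 1 * Fract [:0, 1:] 1 ^ i)" .
  have "calc_rel B m (Fract [:coeff p i:] 1 * Fract [:0, 1:] 1 ^ i) (\<lambda>x. coeff p i *\<^sub>C (resolvent A None ^^ i) x)"
    if "i \<le> degree p" for i
  proof (cases "None \<in> resolvent_set A")
    case True
    show ?thesis unfolding B_def
      by (intro calc_rel_scale calc_rel_funpow calc_rel_resolvent_None m True resolvent_setD(1)[OF m])
  next
    case False
    \<comment> \<open>Without a pole at infinity \<open>p\<close> is constant, so just the zeroth
      power occurs, which is the identity whatever \<open>resolvent A None\<close> is.\<close>
    have "Fract p 1 = r - (\<Sum>\<beta>\<in>P. \<Sum>j=1..n. Fract [:c \<beta> j:] ([:- \<beta>, 1:] ^ j))" unfolding dec by simp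
    also have "None \<notin> rat_poles \<dots>"
      by (intro not_pole_diff not_pole_sum not_pole_partial_fraction_term poles[OF False]) auto
    finally have "i = 0" using not_pole_polynomial_None that by auto
    then show ?thesis using calc_rel_const[OF bB] by simp
  qed
  then have "calc_rel B m (Fract p 1) (\<lambda>x. \<Sum>i\<le>degree p. coeff p i *\<^sub>C (resolvent A None ^^ i) x)"
    unfolding Fp by (intro calc_rel_sum bB) auto
  from calc_rel_add[OF bB this 1] show ?thesis unfolding dec B_def .
qed

definition has_partial_fractions :: "complex poly fract \<Rightarrow> bool" where
  "has_partial_fractions r \<longleftrightarrow> (\<exists>p P n c. finite P \<and>
     r = Fract p 1 + (\<Sum>\<alpha>\<in>P. \<Sum>j=1..n. Fract [:c \<alpha> j:] ([:- \<alpha>, 1:] ^ j)))"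

text \<open>Padding with zero coefficients brings two decompositions to a common set of poles and a
  common order before they are added.\<close>

lemma partial_fractions_extend:
  assumes "finite P'" "P \<subseteq> P'" "n \<le> n'"
  shows "(\<Sum>\<alpha>\<in>P. \<Sum>j=1..n. Fract [:c \<alpha> j:] ([:- \<alpha>, 1:] ^ j))
    = (\<Sum>\<alpha>\<in>P'. \<Sum>j=1..n'. Fract [:if \<alpha> \<in> P \<and> j \<le> n then c \<alpha> j else 0:] ([:- \<alpha>, 1:] ^ j) :: complex poly fract)"
proof -
  have "(\<Sum>j=1..n. Fract [:c \<alpha> j:] ([:- \<alpha>, 1:] ^ j))
      = (\<Sum>j=1..n'. Fract [:if \<alpha> \<in> P \<and> j \<le> n then c \<alpha> j else 0:] ([:- \<alpha>, 1:] ^ j) :: complex poly fract)"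
    if "\<alpha> \<in> P" for \<alpha>
    using that assms by (intro sum.mono_neutral_cong_left) (auto simp: fract_collapse)
  then show ?thesis using assms
    by (intro sum.mono_neutral_cong_left) (auto simp: fract_collapse intro!: sum.neutral)
qed

lemma has_partial_fractions_add:
  assumes "has_partial_fractions r" "has_partial_fractions r'"
  shows "has_partial_fractions (r + r')"
proof -
  obtain p P n c where 1: "finite P" "r = Fract p 1 + (\<Sum>\<alpha>\<in>P. \<Sum>j=1..n. Fract [:c \<alpha> j:] ([:- \<alpha>, 1:] ^ j))"
    using assms(1) unfolding has_partial_fractions_def by blast
  obtain p' P' n' c' where 2: "finite P'" "r' = Fract p' 1 + (\<Sum>\<alpha>\<in>P'. \<Sum>j=1..n'. Fract [:c' \<alpha> j:] ([:- \<alpha>, 1:] ^ j))"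
    using assms(2) unfolding has_partial_fractions_def by blast
  define Q k where "Q = P \<union> P'" and "k = max n n'"
  have Q: "finite Q" "P \<subseteq> Q" "P' \<subseteq> Q" "n \<le> k" "n' \<le> k" using 1 2 by (auto simp: Q_def k_def)
  have "Fract [:a + b:] d = Fract [:a:] d + Fract [:b:] d" if "d \<noteq> 0" for a b and d :: "complex poly"
    using that by (simp add: eq_fract(1)) (simp add: algebra_simps smult_add_left)
  then have "(\<Sum>\<alpha>\<in>Q. \<Sum>j=1..k. Fract [:(if \<alpha> \<in> P \<and> j \<le> n then c \<alpha> j else 0) + (if \<alpha> \<in> P' \<and> j \<le> n' then c' \<alpha> j else 0):] ([:- \<alpha>, 1:] ^ j))
    = (\<Sum>\<alpha>\<in>P. \<Sum>j=1..n. Fract [:c \<alpha> j:] ([:- \<alpha>, 1:] ^ j)) + (\<Sum>\<alpha>\<in>P'. \<Sum>j=1..n'. Fract [:c' \<alpha> j:] ([:- \<alpha>, 1:] ^ j))"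
    unfolding partial_fractions_extend[OF Q(1,2,4)] partial_fractions_extend[OF Q(1,3,5)]
    by (simp only: linear_neq_0 sum.distrib[symmetric] not_False_eq_True)
  then have "r + r' = Fract (p + p') 1 + (\<Sum>\<alpha>\<in>Q. \<Sum>j=1..k. Fract [:(if \<alpha> \<in> P \<and> j \<le> n then c \<alpha> j else 0) + (if \<alpha> \<in> P' \<and> j \<le> n' then c' \<alpha> j else 0):] ([:- \<alpha>, 1:] ^ j))"
    using 1 2 by (simp only: Fract_add_1 add_ac)
  then show ?thesis unfolding has_partial_fractions_def using Q(1) by (intro exI conjI) 
qed

lemma has_partial_fractions_polynomial: "has_partial_fractions (Fract p 1)"
  unfolding has_partial_fractions_def by (intro exI[of _ p] exI[of _ "{}"]) auto

text \<open>Division with remainder by z - \<alpha> splits off the term of highest order; the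
  quotient is left with one power less in the denominator.\<close>

lemma has_partial_fractions_power: "has_partial_fractions (Fract N ([:- \<alpha>, 1:] ^ k))"
proof (induction k arbitrary: N)
  case 0
  then show ?case using has_partial_fractions_polynomial by simp
next
  case (Suc k)
  let ?X = "[:- \<alpha>, 1:]"
  have "poly (N - [:poly N \<alpha>:]) \<alpha> = 0" by simp
  then obtain M where "N - [:poly N \<alpha>:] = ?X * M" by (meson dvdE poly_eq_0_iff_dvd)
  then have N: "N = ?X * M + [:poly N \<alpha>:]" by (metis diff_add_cancel)
  have "Fract (?X * M + [:a:]) (?X ^ Suc k) = Fract M (?X ^ k) + Fract [:a:] (?X ^ Suc k)" for a
    using linear_neq_0[of \<alpha>] by (simp add: eq_fract(1) algebra_simps del: mult_pCons_left mult_pCons_right)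
  then have eq: "Fract N (?X ^ Suc k) = Fract M (?X ^ k) + Fract [:poly N \<alpha>:] (?X ^ Suc k)" using N by metis
  have "(\<Sum>j=1..Suc k. Fract [:if j = Suc k then poly N \<alpha> else 0:] (?X ^ j)) = Fract [:poly N \<alpha>:] (?X ^ Suc k)"
    by (simp add: fract_collapse)
  then have "has_partial_fractions (Fract [:poly N \<alpha>:] (?X ^ Suc k))"
    unfolding has_partial_fractions_def
    by (intro exI[of _ 0] exI[of _ "{\<alpha>}"] exI[of _ "Suc k"] exI[of _ "\<lambda>\<beta> j. if j = Suc k then poly N \<alpha> else 0"])
      (simp add: fract_collapse)
  then show ?case unfolding eq by (intro has_partial_fractions_add Suc.IH)
qed

text \<open>The full power of one root is split off from the denominator and the two coprime factors
  are separated by a Bezout identity; the remaining factor has smaller degree.\<close>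

lemma partial_fractions_exist:
  assumes "D \<noteq> 0"
  shows "has_partial_fractions (Fract N D)"
  using assms
proof (induction "degree D" arbitrary: N D rule: less_induct)
  case less
  show ?case
  proof (cases "degree D = 0")
    case True
    then obtain d where d: "D = [:d:]" by (rule degree_eq_zeroE)
    then have "Fract N D = Fract (smult (1 / d) N) 1" using less.prems by (simp add: eq_fract(1))
    then show ?thesis using has_partial_fractions_polynomial by simp
  next
    case False
    then obtain \<alpha> where \<alpha>: "poly D \<alpha> = 0"
      using fundamental_theorem_of_algebra[of D] by (auto simp: constant_degree)
    let ?X = "[:- \<alpha>, 1:]"
    obtain D' where D': "D = ?X ^ order \<alpha> D * D'" "\<not> ?X dvd D'"
      using order_decomp[OF less.prems] by blast
    have D'0: "D' \<noteq> 0" using D'(2) by auto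
    have "coprime (?X ^ order \<alpha> D) D'"
      using D'(2) by (intro coprime_power_left_iff[THEN iffD2] disjI1 prime_elem_imp_coprime prime_elem_linear_field_poly) simp
    then obtain a b where ab: "a * ?X ^ order \<alpha> D + b * D' = 1"
      by (metis bezout_coefficients_fst_snd coprime_iff_gcd_eq_1)
    have "order \<alpha> D \<noteq> 0" using \<alpha> less.prems by (simp add: order_root)
    then have deg: "degree D' < degree D"
      using D'0 by (subst D'(1)) (simp add: degree_mult_eq degree_power_eq)
    have e: "Fract N (u * v) = Fract (N * a) v + Fract (N * b) u"
      if "a * u + b * v = 1" "u \<noteq> 0" "v \<noteq> 0" for u v
    proof -
      have "N * (u * v) = (N * a * u + N * b * v) * (u * v)" using that(1) by (simp add: mult.assoc flip: distrib_left)
      then show ?thesis using that by (simp add: eq_fract(1) mult_ac)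
    qed
    have "Fract N D = Fract (N * a) D' + Fract (N * b) (?X ^ order \<alpha> D)"
      by (subst D'(1)) (rule e[OF ab linear_neq_0(2) D'0])
    then show ?thesis
      using less.hyps[OF deg D'0] has_partial_fractions_power has_partial_fractions_add by simp
  qed
qed

text \<open>Justifies the definite description: a decomposition exists, and all decompositions yield
  the operator singled out by \<open>calc_rel\<close>. From here on \<open>rat_calc\<close> is
  handled through \<open>calc_rel\<close>.\<close>

lemma calc_rel_rat_calc:
  assumes m: "Some m \<in> resolvent_set A" and r: "r \<in> rat_algebra A"
  shows "calc_rel (resolvent A (Some m)) m r (rat_calc A r)"
proof -
  have "has_partial_fractions r"
    using partial_fractions_exist[of "rden r" "rnum r"] by (simp add: Fract_rnum_rden)
  then obtain p P n c where d: "finite P"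
    "r = Fract p 1 + (\<Sum>\<alpha>\<in>P. \<Sum>j=1..n. Fract [:c \<alpha> j:] ([:- \<alpha>, 1:] ^ j))"
    unfolding has_partial_fractions_def by blast
  let ?R = "\<lambda>x. (\<Sum>i\<le>degree p. coeff p i *\<^sub>C (resolvent A None ^^ i) x) +
         (\<Sum>\<alpha>\<in>P. \<Sum>j=1..n. c \<alpha> j *\<^sub>C (resolvent A (Some \<alpha>) ^^ j) x)"
  have R: "calc_rel (resolvent A (Some m)) m r ?R" by (rule calc_rel_partial_fractions[OF m r d])
  have "rat_calc A r = ?R"
    unfolding rat_calc_def
  proof (rule the_equality)
    show "\<exists>p' P' n' c'. finite P' \<and>
     r = Fract p' 1 + (\<Sum>\<alpha>\<in>P'. \<Sum>j=1..n'. Fract [:c' \<alpha> j:] ([:-\<alpha>, 1:] ^ j)) \<and>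
     ?R = (\<lambda>x. (\<Sum>i\<le>degree p'. coeff p' i *\<^sub>C (resolvent A None ^^ i) x) +
              (\<Sum>\<alpha>\<in>P'. \<Sum>j=1..n'. c' \<alpha> j *\<^sub>C (resolvent A (Some \<alpha>) ^^ j) x))"
      by (intro exI conjI, rule d(1), rule d(2), rule refl)
  next
    fix R'
    assume "\<exists>p' P' n' c'. finite P' \<and>
     r = Fract p' 1 + (\<Sum>\<alpha>\<in>P'. \<Sum>j=1..n'. Fract [:c' \<alpha> j:] ([:-\<alpha>, 1:] ^ j)) \<and>
     R' = (\<lambda>x. (\<Sum>i\<le>degree p'. coeff p' i *\<^sub>C (resolvent A None ^^ i) x) +
              (\<Sum>\<alpha>\<in>P'. \<Sum>j=1..n'. c' \<alpha> j *\<^sub>C (resolvent A (Some \<alpha>) ^^ j) x))"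
    then have "calc_rel (resolvent A (Some m)) m r R'"
      using calc_rel_partial_fractions[OF m r] by (elim exE conjE) (simp only:)
    then show "R' = ?R" by (rule calc_rel_unique[OF resolvent_setD(1)[OF m] _ R])
  qed
  then show ?thesis using R by (simp only:)
qed

section \<open>Values of rational functions on the spectrum\<close>

lemma not_pole_iff_rat_algebra: "r \<in> rat_algebra A \<longleftrightarrow> (\<forall>w\<in>spectrum A. w \<notin> rat_poles r)"
  by (auto simp: rat_algebra_def spectrum_def)

lemma rat_algebra_closed:
  assumes "r \<in> rat_algebra A" "r' \<in> rat_algebra A"
  shows rat_algebra_add: "r + r' \<in> rat_algebra A" and rat_algebra_mult: "r * r' \<in> rat_algebra A"
    and rat_algebra_diff: "r - r' \<in> rat_algebra A"
  using assms by (auto simp: not_pole_iff_rat_algebra not_pole_add not_pole_mult not_pole_diff)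

lemma rat_algebra_const: "Fract [:c:] 1 \<in> rat_algebra A"
  by (auto simp: not_pole_iff_rat_algebra not_pole_const)

text \<open>One inclusion of the spectral mapping theorem: a root at the image of t would split off
  the linear factor of t, and a factor of an invertible polynomial of B is invertible, which places
  t in the resolvent set.\<close>

lemma spectrum_poly_nonzero:
  assumes m: "Some m \<in> resolvent_set A" and t: "t \<in> spectrum A"
    and inv: "invertible_op (poly_op (resolvent A (Some m)) p)"
  shows "poly p (moebius_point m t) \<noteq> 0"
proof
  assume 0: "poly p (moebius_point m t) = 0"
  define B where "B = resolvent A (Some m)"
  have bB: "bounded_clinear B" unfolding B_def by (rule resolvent_setD(1)[OF m])
  have "t \<noteq> Some m" using m t by (auto simp: spectrum_def)
  then obtain q where q: "p = moebius_factor m t * q" using moebius_factor_dvd 0 by blast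
  have "invertible_op (poly_op B (moebius_factor m t))"
  proof (rule invertible_op_factor)
    show "invertible_op (poly_op B p)" using inv by (simp add: B_def)
    show "poly_op B (moebius_factor m t) (poly_op B q x) = poly_op B p x" for x
      unfolding q by (simp add: poly_op_mult[OF bB])
    show "poly_op B q (poly_op B (moebius_factor m t) x) = poly_op B p x" for x
      unfolding q by (subst mult.commute) (simp add: poly_op_mult[OF bB])
  qed (intro bounded_clinear_poly_op bB)+
  then have "t \<in> resolvent_set A" using resolvent_set_iff_invertible[OF m] unfolding B_def by simp
  then show False using t by (simp add: spectrum_def)
qed

text \<open>At w = 0 the transformed polynomials take these coefficients as values, so
  multiplicativity of \<open>moebius_poly\<close> replaces a convolution sum.\<close>

lemma coeff_mult_sum:
  fixes p q :: "complex poly"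
  assumes "degree p \<le> a" "degree q \<le> b"
  shows "coeff (p * q) (a + b) = coeff p a * coeff q b"
proof -
  have "degree (p * q) \<le> a + b" using degree_mult_le[of p q] assms by linarith
  then show ?thesis using moebius_poly_mult[OF assms, of 0] assms
    by (metis poly_moebius_poly_0 poly_mult)
qed

text \<open>Scalar counterpart of the equation in \<open>calc_rel\<close>. Nonvanishing of the
  transformed denominator excludes a pole at t; at infinity it says that the denominator has full
  degree n.\<close>

lemma rat_eval_moebius:
  assumes r: "r = Fract N D" and D: "D \<noteq> 0" and n: "degree N \<le> n" "degree D \<le> n" and t: "t \<noteq> Some m"
    and nz: "poly (moebius_poly m n D) (moebius_point m t) \<noteq> 0"
  shows "poly (moebius_poly m n N) (moebius_point m t)
    = rat_eval r t * poly (moebius_poly m n D) (moebius_point m t)"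
proof (cases t)
  case None
  have D': "coeff D n \<noteq> 0" using nz None n by (simp add: poly_moebius_poly_0)
  then have dD: "degree D = n" using n(2) le_degree by force
  then have "None \<notin> rat_poles r" unfolding not_pole_None_iff using r D n by blast
  then have "degree (rnum r) \<le> degree (rden r)" by (auto simp: rat_poles_def)
  then have "coeff N n * lead_coeff (rden r) = coeff (rnum r) (degree (rden r)) * coeff D n"
    using coeff_mult_sum[OF n(1), of "rden r" "degree (rden r)"] coeff_mult_sum[of "rnum r" "degree (rden r)" D n] n
      rnum_rden_cross[OF r D] by (simp add: add.commute)
  then show ?thesis using None n by (simp add: poly_moebius_poly_0 field_simps)
next
  case (Some \<alpha>)
  define w where "w = 1 / (\<alpha> - m)"
  have w: "w \<noteq> 0" "m + 1 / w = \<alpha>" using t Some by (auto simp: w_def)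
  have D\<alpha>: "poly D \<alpha> \<noteq> 0" using nz n w Some by (auto simp: poly_moebius_poly w_def[symmetric])
  then have "poly (rden r) \<alpha> \<noteq> 0" using rden_dvd[OF r D] by auto
  moreover have "poly N \<alpha> * poly (rden r) \<alpha> = poly (rnum r) \<alpha> * poly D \<alpha>"
    using rnum_rden_cross[OF r D] by (metis poly_mult)
  ultimately have eq: "poly N \<alpha> = poly (rnum r) \<alpha> / poly (rden r) \<alpha> * poly D \<alpha>" by (simp add: field_simps)
  have p: "moebius_point m t = w" by (simp add: Some w_def)
  show ?thesis unfolding p poly_moebius_poly[OF n(1) w(1)] poly_moebius_poly[OF n(2) w(1)] w(2)
    unfolding Some rat_eval.simps eq by simp
qed

text \<open>Spectral radius argument: if v = r(t) exceeds a bound of the operator R = r(A), then R -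
  v is invertible as a small perturbation of a multiple of the identity, and so is D(B) (R - v), the
  operator of the transformed N - v D. But this polynomial vanishes at the image of t, contrary to
  spectral mapping.\<close>

lemma rat_eval_bounded:
  fixes A :: "('k::{complex_normed_vector, complete_space} \<times> 'k) set"
  assumes m: "Some m \<in> resolvent_set A" and r: "r \<in> rat_algebra A"
  shows "\<exists>K. \<forall>t\<in>spectrum A. cmod (rat_eval r t) \<le> K"
proof -
  define B where "B = resolvent A (Some m)"
  define R where "R = rat_calc A r"
  have bB: "bounded_clinear B" unfolding B_def by (rule resolvent_setD(1)[OF m])
  obtain N D n where D: "D \<noteq> 0" and rND: "r = Fract N D" and n: "degree N \<le> n" "degree D \<le> n"
    and inv: "invertible_op (poly_op B (moebius_poly m n D))"
    and eq: "\<And>x. poly_op B (moebius_poly m n D) (R x) = poly_op B (moebius_poly m n N) x"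
    and bR: "bounded_clinear R"
    using calc_rel_rat_calc[OF m r] unfolding R_def[symmetric] B_def[symmetric] by (rule calc_relE) blast
  obtain K where K: "0 < K" "\<And>x. norm (R x) \<le> norm x * K" using bounded_clinear_bound[OF bR] by metis
  have "cmod (rat_eval r t) \<le> K" if t: "t \<in> spectrum A" for t
  proof (rule ccontr)
    define v where "v = rat_eval r t"
    assume "\<not> cmod (rat_eval r t) \<le> K"
    then have v: "K < cmod v" unfolding v_def by simp
    then have v0: "v \<noteq> 0" using K(1) by auto
    have tm: "t \<noteq> Some m" using m t by (auto simp: spectrum_def)
    have nz: "poly (moebius_poly m n D) (moebius_point m t) \<noteq> 0"
      using spectrum_poly_nonzero[OF m t] inv unfolding B_def by blast
    have "invertible_op (\<lambda>x. x - (1 / v) *\<^sub>C R x)"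
    proof (rule invertible_op_perturb)
      show "bounded_clinear (\<lambda>x. (1 / v) *\<^sub>C R x)" by (intro bounded_clinear_intros bR)
      have "0 < cmod v" using K(1) v by linarith
      then show "0 \<le> K / cmod v" "K / cmod v < 1" using K v by (simp_all add: divide_less_eq)
      show "norm ((1 / v) *\<^sub>C R x) \<le> K / cmod v * norm x" for x
        using K(2)[of x] by (simp add: norm_scaleC norm_divide divide_right_mono mult.commute)
    qed
    then have "invertible_op (poly_op B (moebius_poly m n D) \<circ> (\<lambda>x. (- v) *\<^sub>C (x - (1 / v) *\<^sub>C R x)))"
      using v0 by (intro invertible_op_comp inv invertible_op_scale) auto
    moreover have "poly_op B (moebius_poly m n D) \<circ> (\<lambda>x. (- v) *\<^sub>C (x - (1 / v) *\<^sub>C R x))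
      = poly_op B (moebius_poly m n N - smult v (moebius_poly m n D))"
    proof
      fix x
      have "(- v) *\<^sub>C (x - (1 / v) *\<^sub>C R x) = R x - v *\<^sub>C x"
        using v0 by (simp add: cv.scale_right_diff_distrib scaleC_scaleC scaleC_one)
      then show "(poly_op B (moebius_poly m n D) \<circ> (\<lambda>x. (- v) *\<^sub>C (x - (1 / v) *\<^sub>C R x))) x
        = poly_op B (moebius_poly m n N - smult v (moebius_poly m n D)) x"
        using poly_op_add[of B "moebius_poly m n N" "smult (- v) (moebius_poly m n D)" x]
        by (simp add: bounded_clinear_diff_apply[OF bounded_clinear_poly_op[OF bB]] eq poly_op_smult
            bounded_clinear_scale_apply[OF bounded_clinear_poly_op[OF bB]] flip: smult_minus_left)
          (simp add: poly_op_smult)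
    qed
    ultimately have "invertible_op (poly_op B (moebius_poly m n N - smult v (moebius_poly m n D)))" by (simp only:)
    then have "poly (moebius_poly m n N - smult v (moebius_poly m n D)) (moebius_point m t) \<noteq> 0"
      unfolding B_def by (rule spectrum_poly_nonzero[OF m t])
    then show False using rat_eval_moebius[OF rND D n tm nz] unfolding v_def by simp
  qed
  then show ?thesis by blast
qed

text \<open>With K a bound of the resolvent R at \<alpha>, the operator 1 - (\<beta> - \<alpha>) R
  is invertible for |\<beta> - \<alpha>| < 1 / K; it is the linear factor of \<beta> in the
  coordinate based at \<alpha>.\<close>

lemma open_resolvent_set:
  fixes A :: "('k::{complex_normed_vector, complete_space} \<times> 'k) set"
  shows "open {z. Some z \<in> resolvent_set A}"
  unfolding open_dist
proof
  fix \<alpha>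
  assume "\<alpha> \<in> {z. Some z \<in> resolvent_set A}"
  then have \<alpha>: "Some \<alpha> \<in> resolvent_set A" by simp
  define R where "R = resolvent A (Some \<alpha>)"
  have bR: "bounded_clinear R" unfolding R_def by (rule resolvent_setD(1)[OF \<alpha>])
  obtain K where K: "0 < K" "\<And>x. norm (R x) \<le> norm x * K" using bounded_clinear_bound[OF bR] by metis
  have "Some \<beta> \<in> resolvent_set A" if "dist \<beta> \<alpha> < 1 / K" for \<beta>
  proof -
    have d: "cmod (\<beta> - \<alpha>) * K < 1" using that K by (simp add: dist_norm field_simps)
    have "invertible_op (\<lambda>x. x - (\<beta> - \<alpha>) *\<^sub>C R x)"
    proof (rule invertible_op_perturb[OF _ _ d])
      show "bounded_clinear (\<lambda>x. (\<beta> - \<alpha>) *\<^sub>C R x)" by (intro bounded_clinear_intros bR)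
      show "norm ((\<beta> - \<alpha>) *\<^sub>C R x) \<le> cmod (\<beta> - \<alpha>) * K * norm x" for x
        using mult_left_mono[OF K(2), of "cmod (\<beta> - \<alpha>)" x] by (simp add: norm_scaleC mult_ac)
    qed (use K in auto)
    moreover have "(\<lambda>x. x - (\<beta> - \<alpha>) *\<^sub>C R x) = poly_op R (moebius_factor \<alpha> (Some \<beta>))"
      by (auto simp: fun_eq_iff moebius_factor_def poly_op_linear[OF bR] scaleC_one cv.scale_left_diff_distrib)
    ultimately show ?thesis using resolvent_set_iff_invertible[OF \<alpha>] unfolding R_def by simp
  qed
  then show "\<exists>e>0. \<forall>\<beta>. dist \<beta> \<alpha> < e \<longrightarrow> \<beta> \<in> {z. Some z \<in> resolvent_set A}"
    using K(1) by (intro exI[of _ "1 / K"]) auto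
qed

text \<open>A priori the resolvent set might contain infinity alone. Then \<open>A\<close> is a
  bounded operator, and numbers of large modulus are resolvent points. Openness of the finite
  resolvent set allows a move off the real axis.\<close>

lemma nonreal_resolvent_point:
  fixes A :: "('k::{complex_normed_vector, complete_space} \<times> 'k) set"
  assumes "resolvent_set A \<noteq> {}"
  obtains m where "Im m \<noteq> 0" "Some m \<in> resolvent_set A"
proof -
  have "\<exists>\<alpha>. Some \<alpha> \<in> resolvent_set A"
  proof (cases "None \<in> resolvent_set A")
    case True
    define R where "R = resolvent A None"
    have bR: "bounded_clinear R" unfolding R_def by (rule resolvent_setD(1)[OF True])
    obtain K where K: "0 < K" "\<And>x. norm (R x) \<le> norm x * K" using bounded_clinear_bound[OF bR] by metis
    \<comment> \<open>Twice the bound of R makes R / a a contraction with constant 1 / 2.\<close>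
    define a where "a = complex_of_real (2 * K)"
    have a: "a \<noteq> 0" using K by (simp add: a_def)
    have "invertible_op (\<lambda>x. x - (1 / a) *\<^sub>C R x)"
    proof (rule invertible_op_perturb[of _ "1/2"])
      show "bounded_clinear (\<lambda>x. (1 / a) *\<^sub>C R x)" by (intro bounded_clinear_intros bR)
      show "norm ((1 / a) *\<^sub>C R x) \<le> 1 / 2 * norm x" for x
        using K(2)[of x] K(1) by (simp add: norm_scaleC norm_divide a_def field_simps)
    qed auto
    then have "invertible_op (\<lambda>x. (- a) *\<^sub>C (x - (1 / a) *\<^sub>C R x))" using a by (intro invertible_op_scale) auto
    moreover have "(\<lambda>x. (- a) *\<^sub>C (x - (1 / a) *\<^sub>C R x)) = (\<lambda>x. R x - a *\<^sub>C x)"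
      using a by (auto simp: cv.scale_right_diff_distrib scaleC_scaleC scaleC_one)
    ultimately obtain Q where Q: "bounded_clinear Q" "(\<lambda>x. R x - a *\<^sub>C x) \<circ> Q = id" "Q \<circ> (\<lambda>x. R x - a *\<^sub>C x) = id"
      unfolding invertible_op_def by auto
    have "(x, y) \<in> A \<longleftrightarrow> Q (y - a *\<^sub>C x) = x" for x y
    proof -
      have "(x, y) \<in> A \<longleftrightarrow> R x = y" unfolding R_def by (rule mem_iff_resolvent_None[OF True])
      moreover have "R (Q (y - a *\<^sub>C x)) - a *\<^sub>C Q (y - a *\<^sub>C x) = y - a *\<^sub>C x" "Q (R x - a *\<^sub>C x) = x"
        using Q(2,3) by (auto simp: fun_eq_iff)
      ultimately show ?thesis by (metis diff_add_cancel)
    qed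
    then show ?thesis using resolvent_setI(1)[OF Q(1)] by blast
  next
    case False
    then show ?thesis using assms by (metis all_not_in_conv option.exhaust)
  qed
  then obtain \<alpha> where "Some \<alpha> \<in> resolvent_set A" by blast
  then obtain e where e: "0 < e" "\<And>\<beta>. dist \<beta> \<alpha> < e \<Longrightarrow> Some \<beta> \<in> resolvent_set A"
    using open_resolvent_set[of A] unfolding open_dist by blast
  show ?thesis
  proof (cases "Im \<alpha> = 0")
    case True
    have "Some (\<alpha> + \<i> * of_real (e / 2)) \<in> resolvent_set A"
      using e(1) by (intro e(2)) (simp add: dist_norm norm_mult)
    then show ?thesis using True e(1) by (intro that[of "\<alpha> + \<i> * of_real (e / 2)"]) auto
  next
    case False
    then show ?thesis using \<open>Some \<alpha> \<in> resolvent_set A\<close> that by blast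
  qed
qed

section \<open>Local expansions of rational functions\<close>

text \<open>\<open>local_poly w n N\<close> is \<open>N\<close> in the local coordinate \<open>v\<close> at \<open>w\<close>, that is \<open>z = w + v\<close>, or \<open>z = 1 / v\<close>
  for \<open>w = \<infinity>\<close>; in the latter case it is multiplied by \<open>v ^ n\<close>.\<close>

definition local_poly :: "sphere \<Rightarrow> nat \<Rightarrow> complex poly \<Rightarrow> complex poly" where
  "local_poly w n N = (case w of None \<Rightarrow> moebius_poly 0 n N | Some z \<Rightarrow> pcompose N [:z, 1:])"

definition local_point :: "sphere \<Rightarrow> complex \<Rightarrow> sphere" where
  "local_point w v = (case w of None \<Rightarrow> if v = 0 then None else Some (1 / v) | Some z \<Rightarrow> Some (z + v))"

lemma local_poly_mult:
  assumes "degree N \<le> n" "degree M \<le> k"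
  shows "local_poly w (n + k) (N * M) = local_poly w n N * local_poly w k M"
  using assms by (cases w) (simp_all add: local_poly_def moebius_poly_mult pcompose_mult)

lemma local_poly_add:
  assumes "degree N \<le> n" "degree M \<le> n"
  shows "local_poly w n (N + M) = local_poly w n N + local_poly w n M"
  using assms by (cases w) (simp_all add: local_poly_def moebius_poly_add pcompose_add)

lemma rat_eval_Some:
  assumes "r = Fract N D" "poly D z \<noteq> 0"
  shows "rat_eval r (Some z) = poly N z / poly D z"
proof -
  have D: "D \<noteq> 0" using assms(2) by auto
  then have "poly (rden r) z \<noteq> 0" using rden_dvd[OF assms(1)] assms(2) by auto
  moreover have "poly N z * poly (rden r) z = poly (rnum r) z * poly D z"
    using rnum_rden_cross[OF assms(1) D] by (metis poly_mult)
  ultimately show ?thesis using assms(2) by (simp add: field_simps)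
qed

lemma rat_eval_None:
  assumes "r = Fract N D" "degree N \<le> n" "degree D \<le> n" "coeff D n \<noteq> 0"
  shows "rat_eval r None = coeff N n / coeff D n"
proof -
  have "D \<noteq> 0" using assms(4) by auto
  then have "poly (moebius_poly 0 n N) (moebius_point 0 None) = rat_eval r None * poly (moebius_poly 0 n D) (moebius_point 0 None)"
    using assms by (intro rat_eval_moebius) (auto simp: poly_moebius_poly_0)
  then show ?thesis using assms by (simp add: poly_moebius_poly_0)
qed

lemma rat_eval_local:
  assumes "r = Fract N D" "degree N \<le> n" "degree D \<le> n" "poly (local_poly w n D) v \<noteq> 0"
  shows "rat_eval r (local_point w v) = poly (local_poly w n N) v / poly (local_poly w n D) v"
proof (cases w)
  case (Some z)
  then show ?thesis using assms rat_eval_Some[OF assms(1), of "z + v"]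
    by (simp add: local_poly_def local_point_def poly_pcompose add.commute)
next
  case None
  show ?thesis
  proof (cases "v = 0")
    case True
    then show ?thesis using assms None rat_eval_None[OF assms(1-3)]
      by (simp add: local_poly_def local_point_def poly_moebius_poly_0)
  next
    case False
    then show ?thesis using assms None rat_eval_Some[OF assms(1), of "1 / v"]
      by (simp add: local_poly_def local_point_def poly_moebius_poly)
  qed
qed

lemma deriv_funpow_shift:
  fixes g :: "complex \<Rightarrow> complex"
  shows "(deriv ^^ j) (\<lambda>v. g (z + v)) = (\<lambda>v. (deriv ^^ j) g (z + v))"
proof (induction j)
  case (Suc j)
  have "deriv (\<lambda>v. h (z + v)) = (\<lambda>v. deriv h (z + v))" for h :: "complex \<Rightarrow> complex"
    unfolding deriv_def fun_eq_iff by (simp add: DERIV_shift add.commute)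
  then show ?case by (simp add: Suc)
qed simp

lemma taylor_coeff_local:
  "taylor_coeff f w j = (deriv ^^ j) (\<lambda>v. f (local_point w v)) 0 / fact j"
proof (cases w)
  case None
  then show ?thesis by (simp add: local_point_def)
next
  case (Some z)
  then show ?thesis
    using fun_cong[OF deriv_funpow_shift[of j "\<lambda>z. f (Some z)" z], of 0] by (simp add: local_point_def)
qed

section \<open>Taylor series at a point of the sphere\<close>

lemma poly_has_fps_expansion: "poly p has_fps_expansion fps_of_poly (p :: complex poly)"
  unfolding has_fps_expansion_def by simp

text \<open>\<open>F\<close> is the Taylor series of \<open>r\<close> in the local coordinate at
  \<open>w\<close>. It is described by an equation F D = N with D a unit, so that sums, products and
  conjugates are a matter of algebra instead of derivatives.\<close>

definition local_fps :: "sphere \<Rightarrow> complex poly fract \<Rightarrow> complex fps \<Rightarrow> bool" where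
  "local_fps w r F \<longleftrightarrow> (\<exists>N D n. D \<noteq> 0 \<and> r = Fract N D \<and> degree N \<le> n \<and> degree D \<le> n \<and>
     poly (local_poly w n D) 0 \<noteq> 0 \<and> F * fps_of_poly (local_poly w n D) = fps_of_poly (local_poly w n N))"

lemma local_fpsI:
  assumes "D \<noteq> 0" "r = Fract N D" "degree N \<le> n" "degree D \<le> n" "poly (local_poly w n D) 0 \<noteq> 0"
    "F * fps_of_poly (local_poly w n D) = fps_of_poly (local_poly w n N)"
  shows "local_fps w r F"
  using assms unfolding local_fps_def by blast

lemma local_fpsE:
  assumes "local_fps w r F"
  obtains N D n where "D \<noteq> 0" "r = Fract N D" "degree N \<le> n" "degree D \<le> n" "poly (local_poly w n D) 0 \<noteq> 0"
    "F * fps_of_poly (local_poly w n D) = fps_of_poly (local_poly w n N)"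
  using assms unfolding local_fps_def by blast

text \<open>Near 0 the local denominator does not vanish, so the quotient of the local polynomials
  agrees with \<open>r\<close> there and its analytic expansion is the formal quotient. This ties
  iterated derivatives to the algebraic series.\<close>

lemma local_fps_taylor:
  assumes "local_fps w r F"
  shows "taylor_coeff (rat_eval r) w j = fps_nth F j"
proof -
  obtain N D n where D: "D \<noteq> 0" and r: "r = Fract N D" and n: "degree N \<le> n" "degree D \<le> n"
    and D0: "poly (local_poly w n D) 0 \<noteq> 0"
    and F: "F * fps_of_poly (local_poly w n D) = fps_of_poly (local_poly w n N)"
    using assms by (rule local_fpsE)
  let ?P = "local_poly w n N" and ?Q = "local_poly w n D"
  have Q0: "fps_nth (fps_of_poly ?Q) 0 \<noteq> 0" using D0 by (simp add: poly_0_coeff_0)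
  then have Q: "fps_of_poly ?Q \<noteq> 0" by auto
  have "F = fps_of_poly ?P / fps_of_poly ?Q" using F Q by (metis nonzero_mult_div_cancel_right)
  moreover have "(\<lambda>v. poly ?P v / poly ?Q v) has_fps_expansion fps_of_poly ?P / fps_of_poly ?Q"
    using Q0 by (intro has_fps_expansion_divide' poly_has_fps_expansion) auto
  moreover have "eventually (\<lambda>v. poly ?P v / poly ?Q v = rat_eval r (local_point w v)) (nhds 0)"
  proof -
    have "open {v. poly ?Q v \<noteq> 0}" by (intro open_Collect_neq continuous_intros)
    then have "eventually (\<lambda>v. v \<in> {v. poly ?Q v \<noteq> 0}) (nhds 0)"
      using D0 by (intro eventually_nhds_in_open) auto
    then show ?thesis by eventually_elim (simp add: rat_eval_local[OF r n])
  qed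
  ultimately have "(\<lambda>v. rat_eval r (local_point w v)) has_fps_expansion F"
    unfolding has_fps_expansion_def by (auto elim: eventually_elim2)
  then show ?thesis by (simp add: taylor_coeff_local fps_nth_fps_expansion)
qed

lemma local_fps_unique: "local_fps w r F \<Longrightarrow> local_fps w r G \<Longrightarrow> F = G"
  by (simp add: fps_eq_iff flip: local_fps_taylor)

lemma local_fps_ex_of_rep:
  assumes "D \<noteq> 0" "r = Fract N D" "degree N \<le> n" "degree D \<le> n" "poly (local_poly w n D) 0 \<noteq> 0"
  obtains F where "local_fps w r F" "F * fps_of_poly (local_poly w n D) = fps_of_poly (local_poly w n N)"
proof -
  have Q0: "fps_nth (fps_of_poly (local_poly w n D)) 0 \<noteq> 0" using assms(5) by (simp add: poly_0_coeff_0)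
  define F where "F = fps_of_poly (local_poly w n N) * inverse (fps_of_poly (local_poly w n D))"
  have "F * fps_of_poly (local_poly w n D) = fps_of_poly (local_poly w n N)"
    unfolding F_def using inverse_mult_eq_1[OF Q0] by (simp add: mult.assoc)
  then show ?thesis using that local_fpsI[OF assms] by blast
qed

lemma local_poly_rden:
  assumes "w \<notin> rat_poles r"
  defines "n \<equiv> max (degree (rnum r)) (degree (rden r))"
  shows "poly (local_poly w n (rden r)) 0 \<noteq> 0"
proof (cases w)
  case None
  then have "n = degree (rden r)" using assms by (auto simp: rat_poles_def)
  then show ?thesis using None by (simp add: local_poly_def poly_moebius_poly_0)
next
  case (Some z)
  then show ?thesis using assms by (auto simp: rat_poles_def local_poly_def poly_pcompose)
qed

lemma local_fps_rnum_rden: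
  assumes "w \<notin> rat_poles r"
  defines "n \<equiv> max (degree (rnum r)) (degree (rden r))"
  obtains F where "local_fps w r F" "F * fps_of_poly (local_poly w n (rden r)) = fps_of_poly (local_poly w n (rnum r))"
  by (rule local_fps_ex_of_rep[of "rden r" r "rnum r" n w])
    (use local_poly_rden[OF assms(1)] in \<open>auto simp: n_def Fract_rnum_rden\<close>)

lemma local_fps_add:
  assumes "local_fps w r F" "local_fps w r' F'"
  shows "local_fps w (r + r') (F + F')"
proof -
  obtain N D n where D: "D \<noteq> 0" and r: "r = Fract N D" and n: "degree N \<le> n" "degree D \<le> n"
    and D0: "poly (local_poly w n D) 0 \<noteq> 0"
    and F: "F * fps_of_poly (local_poly w n D) = fps_of_poly (local_poly w n N)"
    using assms(1) by (rule local_fpsE)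
  obtain N' D' n' where D': "D' \<noteq> 0" and r': "r' = Fract N' D'" and n': "degree N' \<le> n'" "degree D' \<le> n'"
    and D0': "poly (local_poly w n' D') 0 \<noteq> 0"
    and F': "F' * fps_of_poly (local_poly w n' D') = fps_of_poly (local_poly w n' N')"
    using assms(2) by (rule local_fpsE)
  have d: "degree (N * D') \<le> n + n'" "degree (N' * D) \<le> n + n'" "degree (D * D') \<le> n + n'"
    using n n' degree_mult_le[of N D'] degree_mult_le[of N' D] degree_mult_le[of D D'] by linarith+
  have DD: "local_poly w (n + n') (D * D') = local_poly w n D * local_poly w n' D'"
    and ND: "local_poly w (n + n') (N * D') = local_poly w n N * local_poly w n' D'"
    using n n' by (simp_all add: local_poly_mult)
  have ND': "local_poly w (n + n') (N' * D) = local_poly w n' N' * local_poly w n D"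
    using local_poly_mult[OF n'(1) n(2)] by (simp add: add.commute)
  show ?thesis
  proof (rule local_fpsI[of "D * D'" _ "N * D' + N' * D" "n + n'"])
    show "(F + F') * fps_of_poly (local_poly w (n + n') (D * D')) = fps_of_poly (local_poly w (n + n') (N * D' + N' * D))"
      unfolding local_poly_add[OF d(1,2)] DD ND ND' fps_of_poly_add fps_of_poly_mult F[symmetric] F'[symmetric]
      by (simp add: algebra_simps)
  qed (use D D' r r' d D0 D0' DD in \<open>auto intro: degree_add_le\<close>)
qed

lemma local_fps_mult:
  assumes "local_fps w r F" "local_fps w r' F'"
  shows "local_fps w (r * r') (F * F')"
proof -
  obtain N D n where D: "D \<noteq> 0" and r: "r = Fract N D" and n: "degree N \<le> n" "degree D \<le> n"
    and D0: "poly (local_poly w n D) 0 \<noteq> 0"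
    and F: "F * fps_of_poly (local_poly w n D) = fps_of_poly (local_poly w n N)"
    using assms(1) by (rule local_fpsE)
  obtain N' D' n' where D': "D' \<noteq> 0" and r': "r' = Fract N' D'" and n': "degree N' \<le> n'" "degree D' \<le> n'"
    and D0': "poly (local_poly w n' D') 0 \<noteq> 0"
    and F': "F' * fps_of_poly (local_poly w n' D') = fps_of_poly (local_poly w n' N')"
    using assms(2) by (rule local_fpsE)
  have d: "degree (N * N') \<le> n + n'" "degree (D * D') \<le> n + n'"
    using n n' degree_mult_le[of N N'] degree_mult_le[of D D'] by linarith+
  have DD: "local_poly w (n + n') (D * D') = local_poly w n D * local_poly w n' D'"
    and NN: "local_poly w (n + n') (N * N') = local_poly w n N * local_poly w n' N'"
    using n n' by (simp_all add: local_poly_mult)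
  show ?thesis
  proof (rule local_fpsI[of "D * D'" _ "N * N'" "n + n'"])
    show "(F * F') * fps_of_poly (local_poly w (n + n') (D * D')) = fps_of_poly (local_poly w (n + n') (N * N'))"
      unfolding DD NN fps_of_poly_mult F[symmetric] F'[symmetric] by (simp add: algebra_simps)
  qed (use D D' r r' d D0 D0' DD in auto)
qed

lemma local_fps_const: "local_fps w (Fract [:c:] 1) (fps_const c)"
proof (rule local_fpsI[of 1 _ "[:c:]" 0])
  have *: "local_poly w 0 [:a:] = [:a:]" for a
    by (cases w) (simp_all add: local_poly_def moebius_poly_const monom_0)
  show "poly (local_poly w 0 1) 0 \<noteq> 0" using *[of 1] by (simp add: one_pCons)
  show "fps_const c * fps_of_poly (local_poly w 0 1) = fps_of_poly (local_poly w 0 [:c:])"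
    using *[of 1] *[of c] by (simp add: one_pCons fps_of_poly_const)
qed auto

lemma local_fps_exists:
  assumes "w \<notin> rat_poles r"
  obtains F where "local_fps w r F"
  using local_fps_rnum_rden[OF assms] by blast

lemma taylor_coeff_add:
  assumes "w \<notin> rat_poles r" "w \<notin> rat_poles r'"
  shows "taylor_coeff (rat_eval (r + r')) w j = taylor_coeff (rat_eval r) w j + taylor_coeff (rat_eval r') w j"
proof -
  obtain F F' where "local_fps w r F" "local_fps w r' F'" using assms local_fps_exists by metis
  then show ?thesis using local_fps_add[of w r F r' F'] by (simp add: local_fps_taylor)
qed

lemma taylor_coeff_mult:
  assumes "w \<notin> rat_poles r" "w \<notin> rat_poles r'"
  shows "taylor_coeff (rat_eval (r * r')) w j
    = (\<Sum>k\<le>j. taylor_coeff (rat_eval r) w k * taylor_coeff (rat_eval r') w (j - k))"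
proof -
  obtain F F' where "local_fps w r F" "local_fps w r' F'" using assms local_fps_exists by metis
  then show ?thesis using local_fps_mult[of w r F r' F']
    by (simp add: local_fps_taylor fps_mult_nth atLeast0AtMost)
qed

lemma taylor_coeff_scale:
  assumes "w \<notin> rat_poles r"
  shows "taylor_coeff (rat_eval (Fract [:c:] 1 * r)) w j = c * taylor_coeff (rat_eval r) w j"
proof -
  obtain F where "local_fps w r F" using assms local_fps_exists by metis
  then show ?thesis using local_fps_mult[OF local_fps_const, of w r F c] by (simp add: local_fps_taylor)
qed

lemma taylor_coeff_0: "taylor_coeff f w 0 = f w"
  by (simp add: taylor_coeff_local local_point_def split: option.splits)

section \<open>Orders of zeros and divisibility\<close>

lemma fps_mult_low_order:
  fixes P Q :: "complex fps"
  assumes "\<forall>j<d. fps_nth P j = 0"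
  shows "\<forall>j<d. fps_nth (P * Q) j = 0" "fps_nth (P * Q) d = fps_nth P d * fps_nth Q 0"
proof -
  show "\<forall>j<d. fps_nth (P * Q) j = 0" using assms by (auto simp: fps_mult_nth intro!: sum.neutral)
  have "fps_nth (P * Q) d = (\<Sum>i\<in>{d}. fps_nth P i * fps_nth Q (d - i))"
    unfolding fps_mult_nth using assms by (intro sum.mono_neutral_right) auto
  then show "fps_nth (P * Q) d = fps_nth P d * fps_nth Q 0" by simp
qed

lemma coeff_moebius_poly_0:
  assumes "degree N \<le> n" "j \<le> n"
  shows "coeff (moebius_poly 0 n N) j = coeff N (n - j)"
  using assms by (auto simp: moebius_poly_def coeff_monom_mult coeff_reflect_poly coeff_eq_0)

lemma pcompose_power: "pcompose (p ^ n) q = pcompose p q ^ n"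
  for p q :: "complex poly"
  by (induction n) (simp_all add: pcompose_mult pcompose_1)

lemma pcompose_shift_inverse: "pcompose (pcompose p [:z, 1:]) [:- z, 1:] = (p :: complex poly)"
  by (simp flip: pcompose_assoc add: pcompose_pCons)

text \<open>The local denominator is a unit, so the order of vanishing is that of the local
  numerator. At infinity the latter lists the coefficients of the numerator in reverse, beginning
  with that of z^n for n the degree of the denominator; at a finite point the root factor becomes a
  power of the coordinate.\<close>

lemma zero_order_local_fps:
  assumes w: "w \<notin> rat_poles q" and q: "q \<noteq> 0" and F: "local_fps w q F"
  defines "d \<equiv> rat_zero_order q w"
  shows "\<forall>j<d. fps_nth F j = 0" "fps_nth F d \<noteq> 0"
proof -
  define n where "n = max (degree (rnum q)) (degree (rden q))"
  have num: "rnum q \<noteq> 0" using q by (simp add: rnum_def)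
  let ?P = "fps_of_poly (local_poly w n (rnum q))" and ?Q = "fps_of_poly (local_poly w n (rden q))"
  obtain G where "local_fps w q G" "G * ?Q = ?P" using local_fps_rnum_rden[OF w] unfolding n_def by blast
  then have FQ: "F * ?Q = ?P" using local_fps_unique[OF F] by blast
  have Q0: "fps_nth ?Q 0 \<noteq> 0" using local_poly_rden[OF w] by (simp add: n_def poly_0_coeff_0)
  then have FP: "F = ?P * inverse ?Q"
    unfolding FQ[symmetric] using inverse_mult_eq_1[OF Q0] by (simp add: mult.assoc mult.commute)
  have "(\<forall>j<d. fps_nth ?P j = 0) \<and> fps_nth ?P d \<noteq> 0"
  proof (cases w)
    case None
    then have "n = degree (rden q)" using w by (auto simp: rat_poles_def n_def)
    then have d: "d = n - degree (rnum q)" "d \<le> n" "degree (rnum q) \<le> n" using None by (auto simp: d_def n_def)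
    have c: "fps_nth ?P j = coeff (rnum q) (n - j)" if "j \<le> d" for j
      using None that d by (simp add: local_poly_def coeff_moebius_poly_0)
    have "coeff (rnum q) (n - j) = 0" if "j < d" for j using that d by (intro coeff_eq_0) linarith
    moreover have "n - d = degree (rnum q)" using d by simp
    ultimately show ?thesis using num c by simp
  next
    case (Some z)
    obtain a where a: "rnum q = [:- z, 1:] ^ d * a" "\<not> [:- z, 1:] dvd a"
      using order_decomp[OF num, of z] Some by (auto simp: d_def)
    have "pcompose [:- z, 1:] [:z, 1:] = [:0, 1:]" by (simp add: pcompose_pCons)
    then have "local_poly w n (rnum q) = monom 1 d * pcompose a [:z, 1:]"
      unfolding Some local_poly_def a(1) by (simp add: pcompose_mult pcompose_power monom_altdef)
    moreover have "coeff (pcompose a [:z, 1:]) 0 \<noteq> 0"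
      using a(2) by (simp add: poly_eq_0_iff_dvd poly_pcompose flip: poly_0_coeff_0)
    ultimately show ?thesis by (simp add: coeff_monom_mult)
  qed
  moreover have "fps_nth (inverse ?Q) 0 \<noteq> 0" using Q0 by simp
  ultimately show "\<forall>j<d. fps_nth F j = 0" "fps_nth F d \<noteq> 0"
    unfolding FP using fps_mult_low_order[of d ?P "inverse ?Q"] by auto
qed

lemma zero_order_taylor_coeff:
  assumes "w \<notin> rat_poles q" "q \<noteq> 0"
  shows "\<forall>j<rat_zero_order q w. taylor_coeff (rat_eval q) w j = 0"
    "taylor_coeff (rat_eval q) w (rat_zero_order q w) \<noteq> 0"
proof -
  obtain F where F: "local_fps w q F" using assms local_fps_exists by metis
  show "\<forall>j<rat_zero_order q w. taylor_coeff (rat_eval q) w j = 0"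
    "taylor_coeff (rat_eval q) w (rat_zero_order q w) \<noteq> 0"
    using zero_order_local_fps[OF assms F] by (auto simp: local_fps_taylor[OF F])
qed

text \<open>\<open>r\<close> vanishes at \<open>w\<close> at least to the order of \<open>q\<close>,
  so the zero of \<open>q\<close> cancels. At a finite point a common power of the root factor is
  removed from the two numerators; at infinity orders are degree differences, and the claim is a
  comparison of degrees.\<close>

lemma divide_not_pole:
  assumes wr: "w \<notin> rat_poles r" and wq: "w \<notin> rat_poles q" and q: "q \<noteq> 0"
    and low: "\<forall>j<rat_zero_order q w. taylor_coeff (rat_eval r) w j = 0"
  shows "w \<notin> rat_poles (r / q)"
proof -
  define d where "d = rat_zero_order q w"
  define n where "n = max (degree (rnum r)) (degree (rden r))"
  have num: "rnum q \<noteq> 0" using q by (simp add: rnum_def)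
  obtain F where F: "local_fps w r F"
    "F * fps_of_poly (local_poly w n (rden r)) = fps_of_poly (local_poly w n (rnum r))"
    using local_fps_rnum_rden[OF wr] unfolding n_def by blast
  have lowP: "\<forall>j<d. coeff (local_poly w n (rnum r)) j = 0"
    using fps_mult_low_order(1)[of d F "fps_of_poly (local_poly w n (rden r))"] low F(2)
    by (simp add: d_def local_fps_taylor[OF F(1)])
  have k: "r / q = Fract (rnum r * rden q) (rden r * rnum q)"
    using num by (subst Fract_rnum_rden[of r, symmetric], subst Fract_rnum_rden[of q, symmetric]) simp
  show ?thesis
  proof (cases w)
    case None
    have n: "n = degree (rden r)" and nq: "degree (rnum q) \<le> degree (rden q)"
      using wr wq None by (auto simp: rat_poles_def n_def)
    have c: "coeff (rnum r) (n - j) = 0" if "j < d" "j \<le> n" for j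
      using lowP[rule_format, OF that(1)] that(2) None coeff_moebius_poly_0[of "rnum r" n j]
      by (simp add: local_poly_def n_def)
    show ?thesis
    \<comment> \<open>The zero polynomial has degree 0 by convention, which the degree count would
      mistake for a low order of vanishing.\<close>
    proof (cases "rnum r = 0")
      case True
      then have eq: "r / q = Fract [:0:] 1" using k by (simp add: fract_collapse)
      show ?thesis unfolding eq by (rule not_pole_const)
    next
      case False
      have "degree (rnum r) + d \<le> n"
      proof (rule ccontr)
        assume "\<not> degree (rnum r) + d \<le> n"
        moreover have "degree (rnum r) \<le> n" by (simp add: n_def)
        \<comment> \<open>The index is chosen so that this coefficient is the leading one.\<close>
        ultimately have "coeff (rnum r) (n - (n - degree (rnum r))) = 0" by (intro c) auto
        then show False using False \<open>degree (rnum r) \<le> n\<close> by simp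
      qed
      then have "degree (rnum r) + degree (rden q) \<le> degree (rden r) + degree (rnum q)"
        using nq None n by (simp add: d_def)
      then have "degree (rnum r * rden q) \<le> degree (rden r * rnum q)"
        using False num by (simp add: degree_mult_eq)
      moreover have "rden r * rnum q \<noteq> 0" using num by simp
      ultimately show ?thesis unfolding None not_pole_None_iff using k by blast
    qed
  next
    case (Some z)
    have "monom 1 d dvd pcompose (rnum r) [:z, 1:]"
      using lowP Some by (simp add: monom_1_dvd_iff' local_poly_def)
    then obtain M where "pcompose (rnum r) [:z, 1:] = monom 1 d * M" by blast
    then have "rnum r = pcompose (monom 1 d * M) [:- z, 1:]" by (metis pcompose_shift_inverse)
    then have nr: "rnum r = [:- z, 1:] ^ d * pcompose M [:- z, 1:]"
      by (simp add: pcompose_mult monom_altdef pcompose_power pcompose_pCons pcompose_smult)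
    obtain a where a: "rnum q = [:- z, 1:] ^ d * a" "\<not> [:- z, 1:] dvd a"
      using order_decomp[OF num, of z] Some by (auto simp: d_def)
    have "r / q = Fract (pcompose M [:- z, 1:] * rden q) (rden r * a)"
      unfolding k using num a(1) by (subst nr, subst a(1)) (simp add: eq_fract(1) mult_ac)
    moreover have "poly (rden r * a) z \<noteq> 0" using wr Some a(2) by (auto simp: rat_poles_def poly_eq_0_iff_dvd)
    ultimately show ?thesis unfolding Some not_pole_Some_iff by blast
  qed
qed

section \<open>Conjugation of rational functions\<close>

lemma coeff_cnj_poly: "coeff (map_poly cnj p) i = cnj (coeff p i)"
  by (simp add: coeff_map_poly)

lemma degree_cnj_poly: "degree (map_poly cnj p) = degree p"
  by (rule degree_map_poly) simp

lemma cnj_poly_mult: "map_poly cnj (p * q) = map_poly cnj p * map_poly cnj q"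
  by (rule poly_eqI) (simp add: coeff_cnj_poly coeff_mult)

lemma cnj_poly_eq_0_iff: "map_poly cnj p = 0 \<longleftrightarrow> p = 0"
  by (auto simp: poly_eq_iff coeff_cnj_poly)

lemma rat_sharp_Fract:
  assumes "D \<noteq> 0"
  shows "rat_sharp (Fract N D) = Fract (map_poly cnj N) (map_poly cnj D)"
proof -
  have "map_poly cnj (N * rden (Fract N D)) = map_poly cnj (rnum (Fract N D) * D)"
    using rnum_rden_cross[OF refl assms] by simp
  then show ?thesis unfolding rat_sharp_def using assms
    by (simp add: cnj_poly_mult eq_fract(1) cnj_poly_eq_0_iff)
qed

definition fps_cnj :: "complex fps \<Rightarrow> complex fps" where
  "fps_cnj F = Abs_fps (\<lambda>n. cnj (fps_nth F n))"

lemma fps_cnj_mult: "fps_cnj (F * G) = fps_cnj F * fps_cnj G"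
  by (simp add: fps_cnj_def fps_eq_iff fps_mult_nth)

lemma local_poly_cnj:
  assumes "degree N \<le> n"
  shows "local_poly (sphere_cnj w) n (map_poly cnj N) = map_poly cnj (local_poly w n N)"
proof (rule poly_eqI_nonzero)
  fix v :: complex
  assume v: "v \<noteq> 0"
  have p: "poly (map_poly cnj P) u = cnj (poly P (cnj u))" for P u by simp
  show "poly (local_poly (sphere_cnj w) n (map_poly cnj N)) v = poly (map_poly cnj (local_poly w n N)) v"
    using v assms by (cases w) (auto simp: local_poly_def p poly_moebius_poly degree_cnj_poly poly_pcompose)
qed

lemma local_fps_cnj:
  assumes "local_fps w r F"
  shows "local_fps (sphere_cnj w) (rat_sharp r) (fps_cnj F)"
proof -
  obtain N D n where D: "D \<noteq> 0" and r: "r = Fract N D" and n: "degree N \<le> n" "degree D \<le> n"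
    and D0: "poly (local_poly w n D) 0 \<noteq> 0"
    and F: "F * fps_of_poly (local_poly w n D) = fps_of_poly (local_poly w n N)"
    using assms by (rule local_fpsE)
  have c: "fps_of_poly (map_poly cnj P) = fps_cnj (fps_of_poly P)" for P
    by (simp add: fps_eq_iff fps_cnj_def coeff_cnj_poly)
  show ?thesis
  proof (rule local_fpsI[of "map_poly cnj D" _ "map_poly cnj N" n])
    show "poly (local_poly (sphere_cnj w) n (map_poly cnj D)) 0 \<noteq> 0"
      unfolding local_poly_cnj[OF n(2)] using D0 by (simp add: poly_0_coeff_0 coeff_cnj_poly)
    show "fps_cnj F * fps_of_poly (local_poly (sphere_cnj w) n (map_poly cnj D))
        = fps_of_poly (local_poly (sphere_cnj w) n (map_poly cnj N))"
      unfolding local_poly_cnj[OF n(1)] local_poly_cnj[OF n(2)] c F[symmetric] fps_cnj_mult ..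
  qed (use D n r in \<open>auto simp: rat_sharp_Fract degree_cnj_poly cnj_poly_eq_0_iff\<close>)
qed

lemma taylor_coeff_sharp:
  assumes "w \<notin> rat_poles r"
  shows "taylor_coeff (rat_eval (rat_sharp r)) (sphere_cnj w) j = cnj (taylor_coeff (rat_eval r) w j)"
proof -
  obtain F where F: "local_fps w r F" using assms local_fps_exists by metis
  show ?thesis by (simp add: local_fps_taylor[OF F] local_fps_taylor[OF local_fps_cnj[OF F]] fps_cnj_def)
qed

text \<open>Converse of \<open>local_fps_exists\<close>: regularity at a point means having a local
  series there. Since series can be conjugated, this locates the poles of
  \<open>rat_sharp\<close>.\<close>

lemma local_fps_not_pole:
  assumes "local_fps w r F"
  shows "w \<notin> rat_poles r"
proof -
  obtain N D n where D: "D \<noteq> 0" and r: "r = Fract N D" and n: "degree N \<le> n" "degree D \<le> n"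
    and D0: "poly (local_poly w n D) 0 \<noteq> 0"
    using assms by (rule local_fpsE)
  show ?thesis
  proof (cases w)
    case None
    then have "coeff D n \<noteq> 0" using D0 n by (simp add: local_poly_def poly_moebius_poly_0)
    then have "degree D = n" using n(2) le_degree by force
    then show ?thesis unfolding None not_pole_None_iff using D r n by blast
  next
    case (Some z)
    then have "poly D z \<noteq> 0" using D0 by (simp add: local_poly_def poly_pcompose)
    then show ?thesis unfolding Some not_pole_Some_iff using r by blast
  qed
qed

lemma not_pole_sharp: "w \<notin> rat_poles r \<Longrightarrow> sphere_cnj w \<notin> rat_poles (rat_sharp r)"
  by (metis local_fps_cnj local_fps_exists local_fps_not_pole)

section \<open>Spectral integrals of bounded Borel functions\<close>

lemma space_sphere_borel [simp]: "space sphere_borel = UNIV"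
  by (simp add: sphere_borel_def)

text \<open>The finite plane is open in the compactification, so the point at infinity is Borel by
  itself and a set is decided by its finite part. In the other direction the finite part of an open
  set is open, also for neighbourhoods of infinity, whose complements are closed.\<close>

lemma sets_sphere_borel_iff: "B \<in> sets sphere_borel \<longleftrightarrow> Some -` B \<in> sets borel"
proof
  have "Some \<in> measurable borel sphere_borel"
    unfolding sphere_borel_def
  proof (rule measurable_measure_of)
    fix U :: "sphere set"
    assume "U \<in> {U. openin (Alexandroff_compactification euclidean) U}"
    then consider V where "open V" "U = Some ` V"
      | C where "closed C" "U = insert None (Some ` (- C))"
      by (auto simp: openin_Alexandroff_compactification Compl_eq_Diff_UNIV)
    then show "Some -` U \<inter> space borel \<in> sets borel"
    proof cases
      case 1
      then have "Some -` U = V" by auto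
      then show ?thesis using 1 by simp
    next
      case 2
      then have "Some -` U = - C" by auto
      then show ?thesis using 2 by simp
    qed
  qed auto
  then show "B \<in> sets sphere_borel \<Longrightarrow> Some -` B \<in> sets borel"
    using measurable_sets[of Some borel sphere_borel B] by simp
next
  have opn: "Some ` V \<in> sets sphere_borel" if "open V" for V
  proof -
    have "Some ` V \<in> {U. openin (Alexandroff_compactification euclidean) U}"
      using that by (auto simp: openin_Alexandroff_compactification)
    then show ?thesis unfolding sphere_borel_def by (auto intro: sigma_sets.Basic)
  qed
  have None: "{None} \<in> sets sphere_borel"
  proof -
    have "{None} = space sphere_borel - Some ` (UNIV :: complex set)"
      by (auto simp: notin_range_Some)
    also have "\<dots> \<in> sets sphere_borel" using opn[of UNIV] by (intro sets.compl_sets) auto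
    finally show ?thesis .
  qed
  have bor: "Some ` V \<in> sets sphere_borel" if "V \<in> sets borel" for V
  proof -
    have "V \<in> sigma_sets UNIV {S. open S}" using that by (simp add: borel_def)
    then show ?thesis
    proof (induction rule: sigma_sets.induct)
      case (Compl a)
      have "x \<in> Some ` (UNIV - a) \<longleftrightarrow> x \<in> (space sphere_borel - Some ` a) - {None}" for x
        by (cases x) auto
      then have "Some ` (UNIV - a) = (space sphere_borel - Some ` a) - {None}" by blast
      then show ?case using sets.Diff[OF sets.compl_sets[OF Compl.IH] None] by (simp only:)
    next
      case (Union a)
      have "Some ` (\<Union>i. a i) = (\<Union>i. Some ` a i)" by auto
      then show ?case using Union.IH by auto
    qed (auto intro: opn)
  qed
  assume "Some -` B \<in> sets borel"
  then have "Some ` (Some -` B) \<in> sets sphere_borel" by (rule bor)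
  moreover have "B \<inter> {None} \<in> sets sphere_borel" using None by (cases "None \<in> B") auto
  moreover have "x \<in> B \<longleftrightarrow> x \<in> Some ` (Some -` B) \<union> (B \<inter> {None})" for x by (cases x) auto
  then have "B = Some ` (Some -` B) \<union> (B \<inter> {None})" by blast
  ultimately show "B \<in> sets sphere_borel" by (metis sets.Un)
qed

lemma ext_real_sphere_borel: "ext_real \<in> sets sphere_borel"
proof -
  have "Some -` ext_real = \<real>" by (auto simp: ext_real_def)
  then show ?thesis by (simp add: sets_sphere_borel_iff closed_complex_Reals)
qed

lemma space_ext_real_borel [simp]: "space ext_real_borel = ext_real"
  by (simp add: space_restrict_space)

lemma sets_ext_real_borel_iff: "B \<in> sets ext_real_borel \<longleftrightarrow> B \<subseteq> ext_real \<and> B \<in> sets sphere_borel"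
  using ext_real_sphere_borel by (intro sets_restrict_space_iff) simp

lemma borel_measurable_sphereI:
  fixes f :: "sphere \<Rightarrow> 'b::topological_space"
  assumes "(\<lambda>z. f (Some z)) \<in> borel_measurable borel"
  shows "f \<in> borel_measurable sphere_borel"
proof (rule borel_measurableI)
  fix S :: "'b set"
  assume "open S"
  then have "(\<lambda>z. f (Some z)) -` S \<inter> space borel \<in> sets borel" using assms by (intro measurable_sets) auto
  moreover have "Some -` (f -` S \<inter> space sphere_borel) = (\<lambda>z. f (Some z)) -` S \<inter> space borel" by auto
  ultimately show "f -` S \<inter> space sphere_borel \<in> sets sphere_borel" by (simp add: sets_sphere_borel_iff)
qed

section \<open>Bounded measurable functions on the extended real line\<close>

definition bounded_measurable :: "(sphere \<Rightarrow> complex) \<Rightarrow> bool" where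
  "bounded_measurable f \<longleftrightarrow> f \<in> borel_measurable ext_real_borel \<and> (\<exists>K. \<forall>t\<in>ext_real. cmod (f t) \<le> K)"

lemma bounded_measurableI:
  "f \<in> borel_measurable ext_real_borel \<Longrightarrow> (\<And>t. t \<in> ext_real \<Longrightarrow> cmod (f t) \<le> K) \<Longrightarrow> bounded_measurable f"
  unfolding bounded_measurable_def by blast

lemma bounded_measurableE:
  assumes "bounded_measurable f"
  obtains K where "0 \<le> K" "\<And>t. t \<in> ext_real \<Longrightarrow> cmod (f t) \<le> K" "f \<in> borel_measurable ext_real_borel"
proof -
  obtain K where "\<And>t. t \<in> ext_real \<Longrightarrow> cmod (f t) \<le> K" using assms unfolding bounded_measurable_def by blast
  then show ?thesis using assms unfolding bounded_measurable_def by (intro that[of "max K 0"]) (auto simp: le_max_iff_disj)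
qed

lemma bounded_measurable_add:
  assumes "bounded_measurable f" "bounded_measurable g"
  shows "bounded_measurable (\<lambda>t. f t + g t)"
proof -
  obtain K L where K: "\<And>t. t \<in> ext_real \<Longrightarrow> cmod (f t) \<le> K" and L: "\<And>t. t \<in> ext_real \<Longrightarrow> cmod (g t) \<le> L"
    and [measurable]: "f \<in> borel_measurable ext_real_borel" "g \<in> borel_measurable ext_real_borel"
    using assms by (metis bounded_measurableE)
  show ?thesis
  proof (rule bounded_measurableI[of _ "K + L"])
    show "cmod (f t + g t) \<le> K + L" if "t \<in> ext_real" for t
      using K[OF that] L[OF that] norm_triangle_ineq[of "f t" "g t"] by linarith
  qed measurable
qed

lemma bounded_measurable_mult:
  assumes "bounded_measurable f" "bounded_measurable g"
  shows "bounded_measurable (\<lambda>t. f t * g t)"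
proof -
  obtain K L where K: "\<And>t. t \<in> ext_real \<Longrightarrow> cmod (f t) \<le> K" and L: "\<And>t. t \<in> ext_real \<Longrightarrow> cmod (g t) \<le> L"
    and K0: "0 \<le> K" and [measurable]: "f \<in> borel_measurable ext_real_borel" "g \<in> borel_measurable ext_real_borel"
    using assms by (metis bounded_measurableE)
  show ?thesis
  proof (rule bounded_measurableI[of _ "K * L"])
    show "cmod (f t * g t) \<le> K * L" if "t \<in> ext_real" for t
      unfolding norm_mult using K[OF that] L[OF that] K0 by (intro mult_mono) auto
  qed measurable
qed

lemma bounded_measurable_const: "bounded_measurable (\<lambda>t. c)"
  by (rule bounded_measurableI[of _ "cmod c"]) auto

lemma bounded_measurable_indicator: "B \<in> sets ext_real_borel \<Longrightarrow> bounded_measurable (indicator B)"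
  by (rule bounded_measurableI[of _ 1]) (auto simp: indicator_def)

lemma bounded_measurable_cnj:
  assumes "bounded_measurable f"
  shows "bounded_measurable (\<lambda>t. cnj (f t))"
proof -
  have "cnj \<in> borel_measurable borel" by (intro borel_measurable_continuous_onI continuous_intros)
  then have "(\<lambda>t. cnj (f t)) \<in> borel_measurable ext_real_borel" if "f \<in> borel_measurable ext_real_borel"
    using measurable_compose[OF that] by blast
  then show ?thesis using assms unfolding bounded_measurable_def by simp
qed

lemma bounded_measurable_cong:
  assumes "bounded_measurable f" "\<And>t. t \<in> ext_real \<Longrightarrow> f t = g t"
  shows "bounded_measurable g"
proof -
  have "f \<in> borel_measurable ext_real_borel \<longleftrightarrow> g \<in> borel_measurable ext_real_borel"
    by (rule measurable_cong) (simp add: assms(2))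
  then show ?thesis using assms unfolding bounded_measurable_def by simp
qed

text \<open>A bounded measurable function is a pointwise limit of simple functions, uniformly
  bounded by twice its bound. A change of values outside \<open>ext_real\<close> is covered by the
  limit rule, applied to a constant sequence.\<close>

lemma bounded_measurable_induct [consumes 1, case_names indicator add scale limit]:
  assumes f: "bounded_measurable f"
    and ind: "\<And>B. B \<in> sets ext_real_borel \<Longrightarrow> P (indicator B)"
    and add: "\<And>f g. bounded_measurable f \<Longrightarrow> bounded_measurable g \<Longrightarrow> P f \<Longrightarrow> P g \<Longrightarrow> P (\<lambda>t. f t + g t)"
    and scale: "\<And>c f. bounded_measurable f \<Longrightarrow> P f \<Longrightarrow> P (\<lambda>t. c * f t)"
    and lim: "\<And>F f K. (\<And>i::nat. bounded_measurable (F i)) \<Longrightarrow> (\<And>i. P (F i)) \<Longrightarrow>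
      (\<And>i t. t \<in> ext_real \<Longrightarrow> cmod (F i t) \<le> K) \<Longrightarrow>
      (\<And>t. t \<in> ext_real \<Longrightarrow> (\<lambda>i. F i t) \<longlonglongrightarrow> f t) \<Longrightarrow> bounded_measurable f \<Longrightarrow> P f"
  shows "P f"
proof -
  have cong: "P g" if Ph: "P h" and bh: "bounded_measurable h" and eq: "\<And>t. t \<in> ext_real \<Longrightarrow> h t = g t" for g h
  proof -
    obtain K where K: "\<And>t. t \<in> ext_real \<Longrightarrow> cmod (h t) \<le> K" using bounded_measurableE[OF bh] by metis
    show ?thesis
      by (rule lim[of "\<lambda>i. h" K]) (use Ph bh eq K bounded_measurable_cong[OF bh eq] in auto)
  qed
  have sum: "finite I \<Longrightarrow> (\<And>i. i \<in> I \<Longrightarrow> bounded_measurable (h i) \<and> P (h i)) \<Longrightarrow>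
     bounded_measurable (\<lambda>t. \<Sum>i\<in>I. h i t) \<and> P (\<lambda>t. \<Sum>i\<in>I. h i t)" for I :: "complex set" and h
  proof (induction I rule: finite_induct)
    case empty
    have "P (\<lambda>t. 0 * indicator {} t)" by (intro scale ind bounded_measurable_indicator) auto
    then show ?case using bounded_measurable_const by simp
  next
    case (insert i I)
    then show ?case using add bounded_measurable_add by simp
  qed
  obtain K where K: "0 \<le> K" "\<And>t. t \<in> ext_real \<Longrightarrow> cmod (f t) \<le> K" and mf: "f \<in> borel_measurable ext_real_borel"
    using bounded_measurableE[OF f] by metis
  obtain F where F0: "\<forall>i. simple_function ext_real_borel (F i)"
    "\<forall>t\<in>ext_real. (\<lambda>i. F i t) \<longlonglongrightarrow> f t" "\<forall>i. \<forall>t\<in>ext_real. dist (F i t) 0 \<le> 2 * dist (f t) 0"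
    using borel_measurable_implies_sequence_metric[OF mf, of 0] unfolding space_ext_real_borel by blast
  have F: "simple_function ext_real_borel (F i)" for i using F0(1) by blast
  have Flim: "\<And>t. t \<in> ext_real \<Longrightarrow> (\<lambda>i. F i t) \<longlonglongrightarrow> f t" using F0(2) by blast
  have Fb: "\<And>i t. t \<in> ext_real \<Longrightarrow> dist (F i t) 0 \<le> 2 * dist (f t) 0" using F0(3) by blast
  have Fb': "cmod (F i t) \<le> 2 * K" if "t \<in> ext_real" for i t
    using Fb[OF that, of i] K(2)[OF that] by simp
  have bm: "bounded_measurable (F i)" for i
    by (rule bounded_measurableI[OF borel_measurable_simple_function[OF F] Fb'])
  have "P (F i)" for i
  proof -
    let ?B = "\<lambda>y. F i -` {y} \<inter> ext_real"
    let ?h = "\<lambda>t. \<Sum>y\<in>F i ` ext_real. y * indicator (?B y) t"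
    have B: "?B y \<in> sets ext_real_borel" for y using simple_functionD(2)[OF F, of i "{y}"] by simp
    have "finite (F i ` ext_real)" using simple_functionD(1)[OF F, of i] by simp
    then have h: "bounded_measurable ?h \<and> P ?h"
      by (intro sum conjI scale ind bounded_measurable_indicator bounded_measurable_mult bounded_measurable_const B)
    have "?h t = F i t" if "t \<in> ext_real" for t
    proof -
      have "?h t = (\<Sum>y\<in>F i ` space ext_real_borel. indicator (F i -` {y} \<inter> space ext_real_borel) t *\<^sub>R y)"
        unfolding space_ext_real_borel by (intro sum.cong refl) (simp add: indicator_def)
      also have "\<dots> = F i t"
        by (rule simple_function_indicator_representation_banach[OF F, symmetric]) (simp add: that)
      finally show ?thesis .
    qed
    then show ?thesis using h by (intro cong[of ?h "F i"]) blast+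
  qed
  then show ?thesis by (rule lim[OF bm _ Fb' Flim f])
qed

section \<open>Integration with respect to a spectral measure\<close>

definition spectral_op :: "(sphere set \<Rightarrow> 'v::complex_inner \<Rightarrow> 'v) \<Rightarrow> (sphere \<Rightarrow> complex) \<Rightarrow> 'v \<Rightarrow> 'v" where
  "spectral_op E f = (THE R. bounded_clinear R \<and> (\<forall>x. cinner (R x) x = (LINT t|scalar_measure E x. f t)))"

lemma spectral_integral_eq_spectral_op:
  "spectral_integral E S f = spectral_op E (\<lambda>t. indicator S t *\<^sub>R f t)"
  unfolding spectral_integral_def spectral_op_def set_lebesgue_integral_def ..

lemma cinner_polarization:
  fixes R :: "'v::complex_inner \<Rightarrow> 'v"
  assumes R: "bounded_clinear R"
  shows "cinner (R x) y = (\<Sum>k<4. \<i> ^ k * cinner (R (x + \<i> ^ k *\<^sub>C y)) (x + \<i> ^ k *\<^sub>C y)) / 4"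
proof -
  have 4: "{..<4::nat} = {0, 1, 2, 3}" by auto
  have i3: "\<i> ^ 3 = - \<i>" by (simp add: power3_eq_cube)
  show ?thesis
    by (simp add: 4 i3 cinner_simps bounded_clinear_add_apply[OF R] bounded_clinear_diff_apply[OF R]
        bounded_clinear_scale_apply[OF R] algebra_simps scaleC_one)
qed

lemma bounded_clinear_quadratic_eqI:
  fixes R :: "'v::complex_hilbert \<Rightarrow> 'v"
  assumes R: "bounded_clinear R" and R': "bounded_clinear R'" and eq: "\<And>x. cinner (R x) x = cinner (R' x) x"
  shows "R = R'"
proof
  fix x
  have "cinner (R x) y = cinner (R' x) y" for y
    unfolding cinner_polarization[OF R, of x y] cinner_polarization[OF R', of x y] eq ..
  then have "cinner y (R x) = cinner y (R' x)" for y
    using cinner_cnj[of "R x" y] cinner_cnj[of "R' x" y] by simp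
  then show "R x = R' x" by (rule riesz_form_eqI[OF riesz_form_cinner])
qed

locale projection_valued =
  fixes E :: "sphere set \<Rightarrow> 'v::complex_hilbert \<Rightarrow> 'v"
  assumes spectral: "spectral_measure E"
begin

lemma E_projection: "B \<in> sets ext_real_borel \<Longrightarrow> orth_projection (E B)"
  using spectral by (simp add: spectral_measure_def)

lemma bounded_clinear_E: "B \<in> sets ext_real_borel \<Longrightarrow> bounded_clinear (E B)"
  using E_projection by (simp add: orth_projection_def)

lemma E_sym: "B \<in> sets ext_real_borel \<Longrightarrow> cinner (E B x) y = cinner x (E B y)"
  using E_projection by (simp add: orth_projection_def)

lemma E_Int: "B \<in> sets ext_real_borel \<Longrightarrow> C \<in> sets ext_real_borel \<Longrightarrow> E (B \<inter> C) x = E B (E C x)"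
  using spectral unfolding spectral_measure_def by (metis comp_apply)

lemma E_ext_real [simp]: "E ext_real x = x"
  using spectral by (simp add: spectral_measure_def)

lemma E_sums:
  "range B \<subseteq> sets ext_real_borel \<Longrightarrow> disjoint_family (B :: nat \<Rightarrow> sphere set) \<Longrightarrow> (\<lambda>n. E (B n) x) sums E (\<Union>n. B n) x"
  using spectral by (simp add: spectral_measure_def)

lemma E_empty: "E {} x = 0"
proof -
  have "(\<lambda>n::nat. E {} x) sums E {} x" using E_sums[of "\<lambda>n. {}" x] by (simp add: disjoint_family_on_def)
  then show ?thesis using sums_summable summable_const_iff by blast
qed

lemma E_quadratic:
  assumes "B \<in> sets ext_real_borel"
  shows "cinner (E B x) x = of_real ((norm (E B x))\<^sup>2)"
proof -
  have "cinner (E B x) x = cinner (E B (E B x)) x" using E_Int[OF assms assms, of x] by simp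
  also have "\<dots> = cinner (E B x) (E B x)" using E_sym[OF assms] by simp
  finally show ?thesis by (simp add: cinner_self)
qed

lemma E_sums_cinner:
  assumes "range B \<subseteq> sets ext_real_borel" "disjoint_family (B :: nat \<Rightarrow> sphere set)"
  shows "(\<lambda>n. cinner (E (B n) x) y) sums cinner (E (\<Union>n. B n) x) y"
proof -
  have "bounded_linear (\<lambda>u. cinner u y)"
    by (rule bounded_linear_intro[of _ "norm y"])
      (auto simp: cinner_simps scaleR_eq_scaleC cinner_Cauchy_Schwarz scaleR_conv_of_real)
  from bounded_linear.sums[OF this E_sums[OF assms]] show ?thesis .
qed

lemma sets_scalar_measure [measurable_cong, simp]: "sets (scalar_measure E x) = sets ext_real_borel"
proof -
  have "sets ext_real_borel \<subseteq> Pow ext_real" using sets_ext_real_borel_iff by blast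
  then show ?thesis unfolding scalar_measure_def
    using sets.sigma_sets_eq[of ext_real_borel] by simp
qed

lemma space_scalar_measure [simp]: "space (scalar_measure E x) = ext_real"
  using sets_eq_imp_space_eq[OF sets_scalar_measure] by simp

text \<open>For a projection (E B x, x) = |E B x|^2 is real and nonnegative, so the coercion to
  \<open>ennreal\<close> loses nothing; countable additivity comes from strong convergence of the
  projections.\<close>

lemma emeasure_scalar_measure:
  assumes "B \<in> sets ext_real_borel"
  shows "emeasure (scalar_measure E x) B = ennreal ((norm (E B x))\<^sup>2)"
proof -
  have "emeasure (scalar_measure E x) B = ennreal (Re (cinner (E B x) x))"
  proof (rule emeasure_measure_of[OF scalar_measure_def])
    show "sets ext_real_borel \<subseteq> Pow ext_real" using sets_ext_real_borel_iff by blast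
    show "B \<in> sets (scalar_measure E x)" using assms by simp
    show "positive (sets (scalar_measure E x)) (\<lambda>B. ennreal (Re (cinner (E B x) x)))"
      by (simp add: positive_def E_empty cinner_simps)
    show "countably_additive (sets (scalar_measure E x)) (\<lambda>B. ennreal (Re (cinner (E B x) x)))"
    proof (rule countably_additiveI)
      fix A :: "nat \<Rightarrow> sphere set"
      assume A: "range A \<subseteq> sets (scalar_measure E x)" "disjoint_family A"
      then have A': "range A \<subseteq> sets ext_real_borel" by simp
      have "(\<lambda>n. Re (cinner (E (A n) x) x)) sums Re (cinner (E (\<Union>n. A n) x) x)"
        using E_sums_cinner[OF A' A(2)] by (rule sums_Re)
      then show "(\<Sum>i. ennreal (Re (cinner (E (A i) x) x))) = ennreal (Re (cinner (E (\<Union>i. A i) x) x))"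
        using A' E_quadratic by (intro suminf_ennreal_eq) (auto simp: image_subset_iff)
    qed
  qed
  then show ?thesis by (simp add: E_quadratic[OF assms])
qed

lemma finite_scalar_measure: "finite_measure (scalar_measure E x)"
proof (rule finite_measureI)
  have "ext_real \<in> sets ext_real_borel" using ext_real_sphere_borel by (simp add: sets_ext_real_borel_iff)
  then show "emeasure (scalar_measure E x) (space (scalar_measure E x)) \<noteq> \<infinity>"
    by (simp add: emeasure_scalar_measure)
qed

lemma measure_scalar_measure:
  "B \<in> sets ext_real_borel \<Longrightarrow> measure (scalar_measure E x) B = (norm (E B x))\<^sup>2"
  by (simp add: measure_def emeasure_scalar_measure)

lemma integrable_scalar_measure:
  assumes "bounded_measurable f"
  shows "integrable (scalar_measure E x) f"
proof -
  interpret finite_measure "scalar_measure E x" by (rule finite_scalar_measure)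
  obtain K where "\<And>t. t \<in> ext_real \<Longrightarrow> cmod (f t) \<le> K" "f \<in> borel_measurable ext_real_borel"
    using bounded_measurableE[OF assms] by metis
  then show ?thesis by (intro integrable_const_bound[of _ K]) (auto cong: measurable_cong_sets)
qed

lemma norm_integral_scalar_measure:
  assumes "bounded_measurable f" "\<And>t. t \<in> ext_real \<Longrightarrow> cmod (f t) \<le> K"
  shows "cmod (LINT t|scalar_measure E x. f t) \<le> K * (norm x)\<^sup>2"
proof -
  interpret finite_measure "scalar_measure E x" by (rule finite_scalar_measure)
  have m: "ext_real \<in> sets ext_real_borel" using ext_real_sphere_borel by (simp add: sets_ext_real_borel_iff)
  have "cmod (LINT t|scalar_measure E x. f t) \<le> (LINT t|scalar_measure E x. cmod (f t))"
    by (rule integral_norm_bound)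
  also have "\<dots> \<le> (LINT t|scalar_measure E x. K)"
    using assms by (intro integral_mono integrable_norm integrable_scalar_measure) auto
  also have "\<dots> = K * (norm x)\<^sup>2" using measure_scalar_measure[OF m, of x] by simp
  finally show ?thesis .
qed

lemma integral_scalar_measure_limit:
  assumes "\<And>i::nat. bounded_measurable (F i)" "bounded_measurable f"
    and "\<And>i t. t \<in> ext_real \<Longrightarrow> cmod (F i t) \<le> K"
    and "\<And>t. t \<in> ext_real \<Longrightarrow> (\<lambda>i. F i t) \<longlonglongrightarrow> f t"
  shows "(\<lambda>i. LINT t|scalar_measure E x. F i t) \<longlonglongrightarrow> (LINT t|scalar_measure E x. f t)"
proof -
  interpret finite_measure "scalar_measure E x" by (rule finite_scalar_measure)
  show ?thesis
    by (rule integral_dominated_convergence[where w="\<lambda>t. K"])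
      (use assms in \<open>auto intro!: borel_measurable_integrable integrable_scalar_measure\<close>)
qed

definition represents :: "(sphere \<Rightarrow> complex) \<Rightarrow> ('v \<Rightarrow> 'v) \<Rightarrow> bool" where
  "represents f R \<longleftrightarrow> bounded_clinear R \<and> (\<forall>x. cinner (R x) x = (LINT t|scalar_measure E x. f t))"

lemma represents_unique: "represents f R \<Longrightarrow> represents f R' \<Longrightarrow> R = R'"
  unfolding represents_def by (auto intro: bounded_clinear_quadratic_eqI)

text \<open>Dominated convergence handles the quadratic forms, and polarization extends it to all
  matrix coefficients. Their limit is sesquilinear as a pointwise limit, bounded by polarization
  again, and hence comes from an operator by Riesz.\<close>

lemma represents_limit:
  assumes F: "\<And>i::nat. bounded_measurable (F i)" "\<And>i. represents (F i) (R i)"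
    and K: "\<And>i t. t \<in> ext_real \<Longrightarrow> cmod (F i t) \<le> K"
    and lim: "\<And>t. t \<in> ext_real \<Longrightarrow> (\<lambda>i. F i t) \<longlonglongrightarrow> f t" and f: "bounded_measurable f"
  shows "\<exists>R. represents f R"
proof -
  define I where "I x = (LINT t|scalar_measure E x. f t)" for x
  define L where "L x y = (\<Sum>k<4. \<i> ^ k * I (x + \<i> ^ k *\<^sub>C y)) / 4" for x y
  have bR: "bounded_clinear (R i)" and qR: "cinner (R i x) x = (LINT t|scalar_measure E x. F i t)" for i x
    using F(2) unfolding represents_def by blast+
  have conv: "(\<lambda>i. cinner (R i x) y) \<longlonglongrightarrow> L x y" for x y
    unfolding cinner_polarization[OF bR, where x = x and y = y] qR L_def I_def
    by (intro tendsto_intros integral_scalar_measure_limit[OF F(1) f K lim]) auto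
  have Lq: "L x x = I x" for x
  proof (rule LIMSEQ_unique[OF conv])
    show "(\<lambda>i. cinner (R i x) x) \<longlonglongrightarrow> I x" unfolding qR I_def
      by (rule integral_scalar_measure_limit[OF F(1) f K lim])
  qed
  have L1: "L (x + x') y = L x y + L x' y" for x x' y
    by (rule LIMSEQ_unique[OF conv])
      (use tendsto_add[OF conv[of x y] conv[of x' y]] in \<open>simp add: bounded_clinear_add_apply[OF bR] cinner_simps\<close>)
  have L2: "L (a *\<^sub>C x) y = a * L x y" for a x y
    by (rule LIMSEQ_unique[OF conv])
      (use tendsto_mult_left[OF conv[of x y], of a] in \<open>simp add: bounded_clinear_scale_apply[OF bR] cinner_simps\<close>)
  have L3: "L x (y + y') = L x y + L x y'" for x y y'
    by (rule LIMSEQ_unique[OF conv])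
      (use tendsto_add[OF conv[of x y] conv[of x y']] in \<open>simp add: cinner_simps\<close>)
  have L4: "L x (a *\<^sub>C y) = cnj a * L x y" for a x y
    by (rule LIMSEQ_unique[OF conv])
      (use tendsto_mult_left[OF conv[of x y], of "cnj a"] in \<open>simp add: cinner_simps\<close>)
  obtain C where C: "0 \<le> C" "\<And>t. t \<in> ext_real \<Longrightarrow> cmod (f t) \<le> C" using bounded_measurableE[OF f] by metis
  \<comment> \<open>Four polarization terms, each at most C |x + i^k y|^2 \<le> 4 C, divided by 4.
    The estimate is not homogeneous, so general vectors are normalized afterwards.\<close>
  have b1: "cmod (L x y) \<le> 4 * C" if "norm x = 1" "norm y = 1" for x y
  proof -
    have "cmod (\<i> ^ k * I (x + \<i> ^ k *\<^sub>C y)) \<le> 4 * C" for k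
    proof -
      have "norm (x + \<i> ^ k *\<^sub>C y) \<le> norm x + norm (\<i> ^ k *\<^sub>C y)" by (rule norm_triangle_ineq)
      then have "norm (x + \<i> ^ k *\<^sub>C y) \<le> 2" using that by (simp add: norm_scaleC norm_power)
      then have "(norm (x + \<i> ^ k *\<^sub>C y))\<^sup>2 \<le> 2\<^sup>2" by (intro power_mono) auto
      then have "C * (norm (x + \<i> ^ k *\<^sub>C y))\<^sup>2 \<le> C * 4" using C(1) by (intro mult_left_mono) auto
      then show ?thesis using norm_integral_scalar_measure[OF f C(2), of "x + \<i> ^ k *\<^sub>C y"]
        unfolding I_def by (simp add: norm_mult norm_power)
    qed
    then have "cmod (\<Sum>k<4. \<i> ^ k * I (x + \<i> ^ k *\<^sub>C y)) \<le> (\<Sum>k<4::nat. 4 * C)"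
      by (intro sum_norm_le) auto
    then show ?thesis unfolding L_def by (simp add: norm_divide)
  qed
  have b2: "cmod (L x y) \<le> 4 * C * norm x * norm y" for x y
  proof (cases "x = 0 \<or> y = 0")
    case True
    then have "L x y = 0" using L2[of 0 0 y] L4[of x 0 0] by auto
    then show ?thesis using C(1) by simp
  next
    case False
    define a b where "a = complex_of_real (norm x)" and "b = complex_of_real (norm y)"
    have ab: "a \<noteq> 0" "b \<noteq> 0" using False by (auto simp: a_def b_def)
    have "L x y = L (a *\<^sub>C ((1 / a) *\<^sub>C x)) (b *\<^sub>C ((1 / b) *\<^sub>C y))"
      using ab by (simp add: scaleC_scaleC scaleC_one)
    also have "\<dots> = a * cnj b * L ((1 / a) *\<^sub>C x) ((1 / b) *\<^sub>C y)" by (simp only: L2 L4 mult_ac)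
    finally have "cmod (L x y) = norm x * norm y * cmod (L ((1 / a) *\<^sub>C x) ((1 / b) *\<^sub>C y))"
      by (simp add: norm_mult a_def b_def)
    also have "\<dots> \<le> norm x * norm y * (4 * C)"
      using False by (intro mult_left_mono b1) (auto simp: norm_scaleC norm_divide a_def b_def)
    finally show ?thesis by (simp add: mult_ac)
  qed
  \<comment> \<open>\<open>L x\<close> is conjugate linear, so it is its conjugate that Riesz
    represents.\<close>
  have "\<exists>v. (\<forall>y. cnj (L x y) = cinner y v) \<and> norm v \<le> 4 * C * norm x" for x
  proof -
    obtain v where "v \<in> UNIV" "\<And>y. y \<in> UNIV \<Longrightarrow> cnj (L x y) = cinner y v" "sqrt (Re (cinner v v)) \<le> 4 * C * norm x"
      by (rule riesz_on_subspace[OF hermitian_form_cinner hilbert_subspace_cinner, of UNIV "\<lambda>y. cnj (L x y)" "4 * C * norm x"])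
        (use C(1) b2[of x] in \<open>auto simp: L3 L4 norm_eq_sqrt_cinner[symmetric] cv.subspace_UNIV\<close>)
    then show ?thesis by (auto simp: norm_eq_sqrt_cinner)
  qed
  then obtain S where S: "\<And>x y. cnj (L x y) = cinner y (S x)" "\<And>x. norm (S x) \<le> 4 * C * norm x" by metis
  have "represents f S" unfolding represents_def
  proof
    show "bounded_clinear S"
    proof (rule bounded_clinearI[of _ "4 * C"])
      show "S (x + y) = S x + S y" for x y
        by (rule riesz_form_eqI[OF riesz_form_cinner]) (simp add: cinner_simps L1 flip: S(1))
      show "S (a *\<^sub>C x) = a *\<^sub>C S x" for a x
        by (rule riesz_form_eqI[OF riesz_form_cinner]) (simp add: cinner_simps L2 flip: S(1))
      show "norm (S x) \<le> norm x * (4 * C)" for x using S(2)[of x] by (simp add: mult_ac)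
    qed
    show "\<forall>x. cinner (S x) x = (LINT t|scalar_measure E x. f t)"
    proof
      fix x
      have "cinner (S x) x = cnj (cinner x (S x))" by (rule cinner_cnj[symmetric])
      also have "\<dots> = L x x" unfolding S(1)[symmetric] by simp
      finally show "cinner (S x) x = (LINT t|scalar_measure E x. f t)" by (simp add: Lq I_def)
    qed
  qed
  then show ?thesis by blast
qed

lemma represents_indicator:
  assumes "B \<in> sets ext_real_borel"
  shows "represents (indicator B) (E B)"
  unfolding represents_def
proof (intro conjI allI)
  show "bounded_clinear (E B)" by (rule bounded_clinear_E[OF assms])
  fix x
  have B: "B \<inter> ext_real = B" using assms by (auto simp: sets_ext_real_borel_iff)
  have "(LINT t|scalar_measure E x. indicator B t) = complex_of_real (LINT t|scalar_measure E x. indicator B t)"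
    by (simp add: integral_complex_of_real[symmetric] indicator_def of_bool_def if_distrib cong: if_cong)
  then show "cinner (E B x) x = (LINT t|scalar_measure E x. indicator B t)"
    by (simp add: B measure_scalar_measure[OF assms] E_quadratic[OF assms])
qed

lemma represents_add:
  assumes "bounded_measurable f" "bounded_measurable g" "represents f R" "represents g Q"
  shows "represents (\<lambda>t. f t + g t) (\<lambda>x. R x + Q x)"
  using assms unfolding represents_def
  by (auto intro: bounded_clinear_add simp: cinner_simps integrable_scalar_measure)

lemma represents_scale:
  assumes "bounded_measurable f" "represents f R"
  shows "represents (\<lambda>t. c * f t) (\<lambda>x. c *\<^sub>C R x)"
  using assms unfolding represents_def by (auto intro: bounded_clinear_scale simp: cinner_simps)

lemma represents_exists: "bounded_measurable f \<Longrightarrow> \<exists>R. represents f R"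
proof (induction rule: bounded_measurable_induct)
  case (limit F f K)
  then obtain R where "\<And>i. represents (F i) (R i)" by metis
  then show ?case using represents_limit[of F R K f] limit by blast
qed (blast intro: represents_indicator represents_add represents_scale)+

lemma represents_spectral_op:
  assumes "bounded_measurable f"
  shows "represents f (spectral_op E f)"
proof -
  obtain R where "represents f R" using represents_exists[OF assms] by blast
  then have "spectral_op E f = R" unfolding spectral_op_def represents_def[symmetric]
    using represents_unique by blast
  then show ?thesis using \<open>represents f R\<close> by simp
qed

lemma spectral_op_eqI: "bounded_measurable f \<Longrightarrow> represents f R \<Longrightarrow> spectral_op E f = R"
  using represents_unique represents_spectral_op by blast

lemma bounded_clinear_spectral_op: "bounded_measurable f \<Longrightarrow> bounded_clinear (spectral_op E f)"
  using represents_spectral_op represents_def by blast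

lemma spectral_op_quadratic:
  "bounded_measurable f \<Longrightarrow> cinner (spectral_op E f x) x = (LINT t|scalar_measure E x. f t)"
  using represents_spectral_op represents_def by blast

lemma spectral_op_indicator: "B \<in> sets ext_real_borel \<Longrightarrow> spectral_op E (indicator B) = E B"
  by (intro spectral_op_eqI represents_indicator bounded_measurable_indicator)

lemma spectral_op_add:
  "bounded_measurable f \<Longrightarrow> bounded_measurable g \<Longrightarrow>
    spectral_op E (\<lambda>t. f t + g t) = (\<lambda>x. spectral_op E f x + spectral_op E g x)"
  by (intro spectral_op_eqI represents_add represents_spectral_op bounded_measurable_add)

lemma spectral_op_scale:
  "bounded_measurable f \<Longrightarrow> spectral_op E (\<lambda>t. c * f t) = (\<lambda>x. c *\<^sub>C spectral_op E f x)"
  by (intro spectral_op_eqI represents_scale represents_spectral_op bounded_measurable_mult bounded_measurable_const)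

lemma spectral_op_limit:
  assumes "\<And>i::nat. bounded_measurable (F i)" "bounded_measurable f"
    and "\<And>i t. t \<in> ext_real \<Longrightarrow> cmod (F i t) \<le> K"
    and "\<And>t. t \<in> ext_real \<Longrightarrow> (\<lambda>i. F i t) \<longlonglongrightarrow> f t"
  shows "(\<lambda>i. cinner (spectral_op E (F i) x) y) \<longlonglongrightarrow> cinner (spectral_op E f x) y"
  unfolding cinner_polarization[OF bounded_clinear_spectral_op[OF assms(1)], where x = x and y = y]
    cinner_polarization[OF bounded_clinear_spectral_op[OF assms(2)], where x = x and y = y]
    spectral_op_quadratic[OF assms(1)] spectral_op_quadratic[OF assms(2)]
  by (intro tendsto_intros integral_scalar_measure_limit[OF assms]) auto

text \<open>The adjoint has the conjugate quadratic form, and a quadratic form determines its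
  operator.\<close>

lemma spectral_op_cnj:
  assumes "bounded_measurable f"
  shows "cinner (spectral_op E f x) y = cinner x (spectral_op E (\<lambda>t. cnj (f t)) y)"
proof -
  note a = riesz_form_adjoint[OF riesz_form_cinner riesz_form_cinner bounded_clinear_spectral_op[OF assms]]
  let ?T = "adj cinner cinner (spectral_op E f)"
  have "represents (\<lambda>t. cnj (f t)) ?T" unfolding represents_def
  proof (intro conjI allI)
    fix x
    have "cinner (?T x) x = cnj (cinner x (?T x))" by (rule cinner_cnj[symmetric])
    also have "cinner x (?T x) = cinner (spectral_op E f x) x" using a by simp
    finally have "cinner (?T x) x = cnj (cinner (spectral_op E f x) x)" .
    then show "cinner (?T x) x = (LINT t|scalar_measure E x. cnj (f t))"
      by (simp add: spectral_op_quadratic[OF assms])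
  qed (use a in blast)
  then show ?thesis using a spectral_op_eqI[OF bounded_measurable_cnj[OF assms]] by simp
qed

lemma cinner_right_eqI:
  assumes "\<And>y. cinner u y = cinner v y"
  shows "u = (v :: 'v)"
proof (rule riesz_form_eqI[OF riesz_form_cinner])
  show "cinner y u = cinner y v" for y
    using assms[of y] cinner_cnj[of u y] cinner_cnj[of v y] by simp
qed

text \<open>First half of multiplicativity, by induction on \<open>f\<close> starting from E (B
  \<inter> C) = E B E C. Weak limits suffice because E B can be moved to the other side of the inner
  product.\<close>

lemma spectral_op_mult_indicator:
  assumes "bounded_measurable f" "B \<in> sets ext_real_borel"
  shows "spectral_op E (\<lambda>t. indicator B t * f t) x = E B (spectral_op E f x)"
  using assms(1)
proof (induction rule: bounded_measurable_induct)
  case (indicator C)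
  have "(\<lambda>t. indicator B t * indicator C t :: complex) = indicator (B \<inter> C)" by (auto simp: indicator_def)
  then show ?case using indicator assms(2) by (simp add: spectral_op_indicator E_Int)
next
  case (add f g)
  then show ?case using assms(2)
    by (simp add: distrib_left spectral_op_add bounded_measurable_mult bounded_measurable_indicator
        bounded_clinear_add_apply[OF bounded_clinear_E])
next
  case (scale c f)
  have "(\<lambda>t. indicator B t * (c * f t)) = (\<lambda>t. c * (indicator B t * f t))" by (simp add: mult_ac)
  then show ?case using scale assms(2)
    by (simp add: spectral_op_scale bounded_measurable_mult bounded_measurable_indicator
        bounded_clinear_scale_apply[OF bounded_clinear_E])
next
  case (limit F f K)
  show ?case
  proof (rule cinner_right_eqI)
    fix y
    note bi = bounded_measurable_indicator[OF assms(2)]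
    have "(\<lambda>i. cinner (spectral_op E (\<lambda>t. indicator B t * F i t) x) y)
        \<longlonglongrightarrow> cinner (spectral_op E (\<lambda>t. indicator B t * f t) x) y"
    proof (rule spectral_op_limit[where K=K])
      show "cmod (indicator B t * F i t) \<le> K" if "t \<in> ext_real" for i t
        using limit.hyps(2)[OF that, of i] order_trans[OF norm_ge_zero limit.hyps(2)[OF that, of i]]
        by (auto simp: indicator_def)
    qed (auto intro!: tendsto_intros bounded_measurable_mult bi limit)
    moreover have "(\<lambda>i. cinner (E B (spectral_op E (F i) x)) y) \<longlonglongrightarrow> cinner (E B (spectral_op E f x)) y"
      unfolding E_sym[OF assms(2)] by (rule spectral_op_limit[of F f K]) (use limit in auto)
    ultimately show "cinner (spectral_op E (\<lambda>t. indicator B t * f t) x) y = cinner (E B (spectral_op E f x)) y"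
      unfolding limit.IH by (rule LIMSEQ_unique)
  qed
qed

text \<open>Induction on the first factor with the second one fixed; indicators have just been
  settled. Treating one factor at a time avoids products of two weakly convergent sequences.\<close>

lemma spectral_op_mult:
  assumes "bounded_measurable f" "bounded_measurable g"
  shows "spectral_op E (\<lambda>t. f t * g t) x = spectral_op E f (spectral_op E g x)"
  using assms(1)
proof (induction rule: bounded_measurable_induct)
  case (indicator C)
  then show ?case using assms(2) by (simp add: spectral_op_mult_indicator spectral_op_indicator)
next
  case (add f h)
  then show ?case using assms(2) by (simp add: distrib_right spectral_op_add bounded_measurable_mult)
next
  case (scale c f)
  then show ?case using assms(2) by (simp add: mult.assoc spectral_op_scale bounded_measurable_mult)
next
  case (limit F f K)
  show ?case
  proof (rule cinner_right_eqI)
    fix y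
    obtain L where L: "0 \<le> L" "\<And>t. t \<in> ext_real \<Longrightarrow> cmod (g t) \<le> L" using bounded_measurableE[OF assms(2)] by metis
    have "(\<lambda>i. cinner (spectral_op E (\<lambda>t. F i t * g t) x) y)
        \<longlonglongrightarrow> cinner (spectral_op E (\<lambda>t. f t * g t) x) y"
    proof (rule spectral_op_limit[where K="K * L"])
      show "cmod (F i t * g t) \<le> K * L" if "t \<in> ext_real" for i t
        using limit.hyps(2)[OF that, of i] order_trans[OF norm_ge_zero limit.hyps(2)[OF that, of i]] L(2)[OF that]
        unfolding norm_mult by (intro mult_mono) auto
    qed (auto intro!: tendsto_intros bounded_measurable_mult limit assms)
    moreover have "(\<lambda>i. cinner (spectral_op E (F i) (spectral_op E g x)) y) \<longlonglongrightarrow> cinner (spectral_op E f (spectral_op E g x)) y"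
      by (rule spectral_op_limit[of F f K]) (use limit in auto)
    ultimately show "cinner (spectral_op E (\<lambda>t. f t * g t) x) y = cinner (spectral_op E f (spectral_op E g x)) y"
      unfolding limit.IH by (rule LIMSEQ_unique)
  qed
qed

end

section \<open>Determination of a spectral measure by polynomials in resolvents\<close>

lemma ext_real_cases:
  assumes "t \<in> ext_real"
  obtains "t = None" | x where "t = Some (complex_of_real x)"
  using assms by (auto simp: ext_real_def elim!: Reals_cases)

lemma moebius_point_bound:
  assumes "Im m \<noteq> 0" "t \<in> ext_real"
  shows "cmod (moebius_point m t) \<le> 1 / \<bar>Im m\<bar>"
  using assms(2)
proof (cases rule: ext_real_cases)
  case (2 x)
  have "\<bar>Im m\<bar> \<le> cmod (of_real x - m)" using abs_Im_le_cmod[of "of_real x - m"] by simp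
  then show ?thesis using 2 assms(1) by (simp add: norm_divide frac_le)
qed simp

lemma moebius_point_measurable: "moebius_point m \<in> borel_measurable sphere_borel"
  by (rule borel_measurable_sphereI) (simp add: moebius_point_def)

lemma moebius_point_measurable_ext_real: "moebius_point m \<in> borel_measurable ext_real_borel"
  by (rule measurable_restrict_space1[OF moebius_point_measurable])

lemma bounded_measurable_continuous_moebius:
  fixes h :: "complex \<Rightarrow> real"
  assumes m: "Im m \<noteq> 0" and h: "continuous_on UNIV h"
  shows "bounded_measurable (\<lambda>t. of_real (h (moebius_point m t)))"
proof -
  have "compact (h ` cball 0 (1 / \<bar>Im m\<bar>))"
    by (intro compact_continuous_image continuous_on_subset[OF h]) auto
  then have "bounded (h ` cball 0 (1 / \<bar>Im m\<bar>))" by (rule compact_imp_bounded)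
  then obtain K where "\<forall>x\<in>h ` cball 0 (1 / \<bar>Im m\<bar>). norm x \<le> K" unfolding bounded_iff by blast
  then have K: "\<And>w. w \<in> cball 0 (1 / \<bar>Im m\<bar>) \<Longrightarrow> \<bar>h w\<bar> \<le> K" by simp
  show ?thesis
  proof (rule bounded_measurableI[of _ K])
    have "h \<in> borel_measurable borel" using h by (rule borel_measurable_continuous_onI)
    then have [measurable]: "(\<lambda>t. h (moebius_point m t)) \<in> borel_measurable ext_real_borel"
      using measurable_compose[OF moebius_point_measurable_ext_real] by blast
    show "(\<lambda>t. complex_of_real (h (moebius_point m t))) \<in> borel_measurable ext_real_borel" by measurable
    show "cmod (of_real (h (moebius_point m t))) \<le> K" if "t \<in> ext_real" for t
      using K moebius_point_bound[OF m that] by simp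
  qed
qed

context projection_valued
begin

text \<open>The extended real line is mapped into the disc of radius 1 / |Im m|, on which
  Stone-Weierstrass approximates uniformly. Real polynomials on the plane are used, since complex
  polynomials in w alone are not dense on a disc.\<close>

lemma cinner_spectral_op_continuous:
  assumes m: "Im m \<noteq> 0"
    and poly: "\<And>p. real_polynomial_function p \<Longrightarrow>
      cinner (spectral_op E (\<lambda>t. of_real (p (moebius_point m t))) u) v
      = cinner (spectral_op E (\<lambda>t. of_real (p (moebius_point m t))) u') v'"
    and h: "continuous_on UNIV h"
  shows "cinner (spectral_op E (\<lambda>t. of_real (h (moebius_point m t))) u) v
      = cinner (spectral_op E (\<lambda>t. of_real (h (moebius_point m t))) u') v'"
proof -
  let ?C = "cball 0 (1 / \<bar>Im m\<bar>) :: complex set"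
  have "\<exists>p. real_polynomial_function p \<and> (\<forall>w\<in>?C. \<bar>h w - p w\<bar> < 1 / (real n + 1))" for n
    by (rule Stone_Weierstrass_real_polynomial_function[of ?C h "1 / (real n + 1)"])
      (use continuous_on_subset[OF h] in auto)
  then obtain p where p: "\<And>n. real_polynomial_function (p n)"
    "\<And>n w. w \<in> ?C \<Longrightarrow> \<bar>h w - p n w\<bar> < 1 / (real n + 1)" by metis
  have bh: "bounded_measurable (\<lambda>t. of_real (h (moebius_point m t)))"
    by (rule bounded_measurable_continuous_moebius[OF m h])
  obtain K where K: "\<And>t. t \<in> ext_real \<Longrightarrow> cmod (of_real (h (moebius_point m t))) \<le> K"
    using bounded_measurableE[OF bh] by metis
  have bp: "bounded_measurable (\<lambda>t. of_real (p n (moebius_point m t)))" for n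
    using p(1)[of n] by (intro bounded_measurable_continuous_moebius[OF m] continuous_on_polymonial_function)
      (simp add: real_polynomial_function_eq)
  have C: "moebius_point m t \<in> ?C" if "t \<in> ext_real" for t using moebius_point_bound[OF m that] by simp
  have Kp: "cmod (of_real (p n (moebius_point m t))) \<le> K + 1" if "t \<in> ext_real" for n t
  proof -
    have "1 / (real n + 1) \<le> 1" by simp
    then have "\<bar>h (moebius_point m t) - p n (moebius_point m t)\<bar> \<le> 1" using p(2)[OF C[OF that], of n] by linarith
    moreover have "\<bar>h (moebius_point m t)\<bar> \<le> K" using K[OF that] by simp
    ultimately have "\<bar>p n (moebius_point m t)\<bar> \<le> K + 1" by linarith
    then show ?thesis by simp
  qed
  have lim: "(\<lambda>n. complex_of_real (p n (moebius_point m t))) \<longlonglongrightarrow> of_real (h (moebius_point m t))" if "t \<in> ext_real" for t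
  proof (intro tendsto_of_real)
    have "(\<lambda>n. 1 / (real n + 1)) \<longlonglongrightarrow> 0"
      using LIMSEQ_inverse_real_of_nat by (simp add: inverse_eq_divide add.commute)
    moreover have "\<forall>\<^sub>F n in sequentially. norm (p n (moebius_point m t) - h (moebius_point m t)) \<le> 1 / (real n + 1)"
      using p(2)[OF C[OF that]] by (auto simp: abs_minus_commute less_imp_le)
    ultimately have "(\<lambda>n. p n (moebius_point m t) - h (moebius_point m t)) \<longlonglongrightarrow> 0"
      by (rule Lim_null_comparison[rotated])
    then show "(\<lambda>n. p n (moebius_point m t)) \<longlonglongrightarrow> h (moebius_point m t)" by (simp add: LIM_zero_iff)
  qed
  note l = spectral_op_limit[OF bp bh Kp lim]
  show ?thesis using LIMSEQ_unique[OF l[of u v]] l[of u' v'] poly[OF p(1)] by simp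
qed

lemma moebius_vimage_sets:
  "W \<in> sets borel \<Longrightarrow> moebius_point m -` W \<inter> ext_real \<in> sets ext_real_borel"
  using measurable_sets[OF moebius_point_measurable_ext_real[of m], of W] by simp

text \<open>The indicator of a closed set is the pointwise limit of the continuous functions max 0
  (1 - n dist(w, F)), all bounded by 1.\<close>

lemma cinner_E_closed:
  assumes m: "Im m \<noteq> 0"
    and poly: "\<And>p. real_polynomial_function p \<Longrightarrow>
      cinner (spectral_op E (\<lambda>t. of_real (p (moebius_point m t))) u) v
      = cinner (spectral_op E (\<lambda>t. of_real (p (moebius_point m t))) u') v'"
    and F: "closed F"
  shows "cinner (E (moebius_point m -` F \<inter> ext_real) u) v = cinner (E (moebius_point m -` F \<inter> ext_real) u') v'"
\<comment> \<open>\<open>infdist\<close> to the empty set is 0 by convention, so the approximating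
  functions would be constantly 1.\<close>
proof (cases "F = {}")
  case True
  then show ?thesis by (simp add: E_empty cinner_simps)
next
  case False
  let ?B = "moebius_point m -` F \<inter> ext_real"
  have B: "?B \<in> sets ext_real_borel" using F by (intro moebius_vimage_sets) simp
  define h where "h n w = max 0 (1 - real n * infdist w F)" for n w
  have ch: "continuous_on UNIV (h n)" for n unfolding h_def by (intro continuous_intros)
  note bh = bounded_measurable_continuous_moebius[OF m ch]
  have Kh: "cmod (of_real (h n (moebius_point m t))) \<le> 1" for n t
    unfolding h_def using infdist_nonneg[of "moebius_point m t" F] by (simp add: abs_if max_def)
  have lim: "(\<lambda>n. complex_of_real (h n (moebius_point m t))) \<longlonglongrightarrow> indicator ?B t" if t: "t \<in> ext_real" for t
  proof (cases "moebius_point m t \<in> F")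
    case True
    then show ?thesis using t by (simp add: h_def indicator_def)
  next
    case nF: False
    then have pos: "0 < infdist (moebius_point m t) F"
      using F False by (metis in_closed_iff_infdist_zero infdist_nonneg less_eq_real_def)
    obtain k where k: "1 / infdist (moebius_point m t) F < real k" using reals_Archimedean2 by blast
    have "h n (moebius_point m t) = 0" if "k \<le> n" for n
    proof -
      have "1 < real k * infdist (moebius_point m t) F" using k pos by (simp add: field_simps)
      also have "\<dots> \<le> real n * infdist (moebius_point m t) F" using that pos by (intro mult_right_mono) auto
      finally show ?thesis by (simp add: h_def)
    qed
    then have "\<forall>\<^sub>F n in sequentially. complex_of_real (h n (moebius_point m t)) = indicator ?B t"
      using nF by (auto simp: eventually_sequentially indicator_def)
    then show ?thesis by (rule tendsto_eventually)
  qed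
  note l = spectral_op_limit[OF bh bounded_measurable_indicator[OF B] Kh lim]
  show ?thesis
    using LIMSEQ_unique[OF l[of u v]] l[of u' v'] cinner_spectral_op_continuous[OF m poly ch]
    by (simp add: spectral_op_indicator[OF B])
qed

lemma ext_real_sets: "ext_real \<in> sets ext_real_borel"
  using ext_real_sphere_borel by (simp add: sets_ext_real_borel_iff)

lemma E_Compl:
  assumes "B \<in> sets ext_real_borel"
  shows "E (ext_real - B) x = x - E B x"
proof -
  have C: "ext_real - B \<in> sets ext_real_borel" using assms ext_real_sets by blast
  have "B \<subseteq> ext_real" using assms by (simp add: sets_ext_real_borel_iff)
  then have "(\<lambda>t. indicator (ext_real - B) t + indicator B t) = (indicator ext_real :: sphere \<Rightarrow> complex)"
    by (auto simp: indicator_def fun_eq_iff)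
  then have "(\<lambda>x. E (ext_real - B) x + E B x) = E ext_real"
    using spectral_op_add[OF bounded_measurable_indicator[OF C] bounded_measurable_indicator[OF assms]]
    by (simp add: spectral_op_indicator assms C ext_real_sets)
  then have "E (ext_real - B) x + E B x = E ext_real x" by (rule fun_cong)
  then show ?thesis by (simp add: algebra_simps)
qed

text \<open>Dynkin's argument: the sets on which both set functions agree are closed under
  complements and countable disjoint unions, and the closed sets form an intersection-stable
  generator. Equality of the total masses, needed for complements, is the closed case of the whole
  plane.\<close>

lemma cinner_E_vimage:
  assumes m: "Im m \<noteq> 0"
    and poly: "\<And>p. real_polynomial_function p \<Longrightarrow>
      cinner (spectral_op E (\<lambda>t. of_real (p (moebius_point m t))) u) v
      = cinner (spectral_op E (\<lambda>t. of_real (p (moebius_point m t))) u') v'"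
    and W: "W \<in> sets borel"
  shows "cinner (E (moebius_point m -` W \<inter> ext_real) u) v = cinner (E (moebius_point m -` W \<inter> ext_real) u') v'"
proof -
  have "Int_stable (Collect closed :: complex set set)" by (auto simp: Int_stable_def)
  moreover have "Collect closed \<subseteq> Pow (UNIV :: complex set)" by simp
  moreover have "W \<in> sigma_sets UNIV (Collect closed)" using W unfolding borel_eq_closed by simp
  ultimately show ?thesis
  proof (induction rule: sigma_sets_induct_disjoint)
    case (basic A)
    then show ?case using cinner_E_closed[OF m poly] by simp
  next
    case empty
    then show ?case by (simp add: E_empty cinner_simps)
  next
    case (compl A)
    then have A: "A \<in> sets borel" unfolding borel_eq_closed by simp
    have "moebius_point m -` (UNIV - A) \<inter> ext_real = ext_real - (moebius_point m -` A \<inter> ext_real)" by auto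
    moreover have "cinner u v = cinner u' v'"
      using cinner_E_closed[OF m poly closed_UNIV] by simp
    ultimately show ?case using compl.IH by (simp add: E_Compl[OF moebius_vimage_sets[OF A]] cinner_simps)
  next
    case (union A)
    then have "A i \<in> sets borel" for i unfolding borel_eq_closed by auto
    then have r: "range (\<lambda>i. moebius_point m -` A i \<inter> ext_real) \<subseteq> sets ext_real_borel"
      using moebius_vimage_sets by blast
    have d: "disjoint_family (\<lambda>i. moebius_point m -` A i \<inter> ext_real)"
      using union.hyps(1) by (auto simp: disjoint_family_on_def)
    have "moebius_point m -` (\<Union>i. A i) \<inter> ext_real = (\<Union>i. moebius_point m -` A i \<inter> ext_real)" by auto
    then show ?case
      using sums_unique2[OF E_sums_cinner[OF r d, of u v]] E_sums_cinner[OF r d, of u' v'] union.IH by simp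
  qed
qed

text \<open>The real polynomials in \<open>1 / (t - m)\<close> and its conjugate determine the measure, since \<open>t \<mapsto> 1 / (t - m)\<close>
  maps the extended real line homeomorphically onto a circle.\<close>

lemma cinner_spectral_op_eqI:
  assumes m: "Im m \<noteq> 0"
    and poly: "\<And>p. real_polynomial_function p \<Longrightarrow>
      cinner (spectral_op E (\<lambda>t. of_real (p (moebius_point m t))) u) v
      = cinner (spectral_op E (\<lambda>t. of_real (p (moebius_point m t))) u') v'"
    and f: "bounded_measurable f"
  shows "cinner (spectral_op E f u) v = cinner (spectral_op E f u') v'"
  using f
proof (induction rule: bounded_measurable_induct)
  case (indicator B)
  \<comment> \<open>\<open>W\<close> is the image of \<open>B\<close> under
    \<open>moebius_point m\<close>, written as a preimage under the inverse map w \<mapsto> m + 1 /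
    w so that it is visibly Borel; infinity corresponds to 0.\<close>
  define W where "W = (if None \<in> B then {0} else {}) \<union> ((\<lambda>w. m + 1 / w) -` (Some -` B) \<inter> (- {0}))"
  have SB: "Some -` B \<in> sets borel" and Be: "B \<subseteq> ext_real"
    using indicator by (simp_all add: sets_ext_real_borel_iff sets_sphere_borel_iff)
  have "(\<lambda>w. m + 1 / w) \<in> borel_measurable borel" by simp
  from measurable_sets[OF this SB] have W: "W \<in> sets borel" unfolding W_def by auto
  have "t \<in> moebius_point m -` W \<inter> ext_real \<longleftrightarrow> t \<in> B" for t
  proof (cases "t \<in> ext_real")
    case True
    then show ?thesis
    proof (cases rule: ext_real_cases)
      case 1
      then show ?thesis using True by (auto simp: W_def)
    next
      case (2 x)
      have "of_real x \<noteq> m" using m by auto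
      then show ?thesis using True 2 by (auto simp: W_def)
    qed
  qed (use Be in auto)
  then have B: "moebius_point m -` W \<inter> ext_real = B" by blast
  show ?case using cinner_E_vimage[OF m poly W] unfolding B spectral_op_indicator[OF indicator] .
next
  case (limit F f K)
  note l = spectral_op_limit[of F f K, OF limit.hyps(1) limit.hyps(4) limit.hyps(2) limit.hyps(3)]
  show ?case using LIMSEQ_unique[OF l[of u v]] l[of u' v'] limit.IH by simp
qed (simp_all add: spectral_op_add spectral_op_scale cinner_simps)

end

section \<open>Spectral measures living on a given set\<close>

locale supported_projection_valued = projection_valued +
  fixes S
  assumes S_real: "S \<subseteq> ext_real" and S_borel: "S \<in> sets sphere_borel" and E_S: "E S = id"
begin

lemma S_sets: "S \<in> sets ext_real_borel"
  using S_real S_borel by (simp add: sets_ext_real_borel_iff)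

lemma bounded_measurable_restrict:
  assumes "f \<in> bounded_borel_on S"
  shows "bounded_measurable (\<lambda>t. indicator S t *\<^sub>R f t)"
proof -
  obtain K where K: "\<And>t. t \<in> S \<Longrightarrow> cmod (f t) \<le> K"
    using assms unfolding bounded_borel_on_def bounded_iff by auto
  have "(\<lambda>t. indicator S t *\<^sub>R f t) \<in> borel_measurable sphere_borel"
    using assms S_borel unfolding bounded_borel_on_def by (simp add: borel_measurable_restrict_space_iff)
  then have "(\<lambda>t. indicator S t *\<^sub>R f t) \<in> borel_measurable ext_real_borel"
    by (rule measurable_restrict_space1)
  then show ?thesis
  proof (rule bounded_measurableI[of _ "max K 0"])
    show "cmod (indicator S t *\<^sub>R f t) \<le> max K 0" for t
      using K[of t] by (auto simp: indicator_def)
  qed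
qed

text \<open>Truncating the integrand to \<open>S\<close> applies \<open>E S\<close>, which is the
  identity.\<close>

lemma spectral_integral_eq:
  assumes "bounded_measurable f"
  shows "spectral_integral E S f = spectral_op E f"
proof -
  have "(\<lambda>t. indicator S t *\<^sub>R f t) = (\<lambda>t. indicator S t * f t)" by (auto simp: indicator_def)
  then show ?thesis unfolding spectral_integral_eq_spectral_op
    using spectral_op_mult_indicator[OF assms S_sets] E_S by (auto simp: fun_eq_iff)
qed

lemma bounded_clinear_spectral_integral:
  "f \<in> bounded_borel_on S \<Longrightarrow> bounded_clinear (spectral_integral E S f)"
  unfolding spectral_integral_eq_spectral_op
  by (intro bounded_clinear_spectral_op bounded_measurable_restrict)

lemma spectral_integral_cong:
  assumes "\<And>t. t \<in> S \<Longrightarrow> f t = g t"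
  shows "spectral_integral E S f = spectral_integral E S g"
proof -
  have "indicator S t *\<^sub>R f t = indicator S t *\<^sub>R g t" for t using assms by (cases "t \<in> S") auto
  then have "(\<lambda>t. indicator S t *\<^sub>R f t) = (\<lambda>t. indicator S t *\<^sub>R g t)" by blast
  then show ?thesis unfolding spectral_integral_eq_spectral_op by (rule arg_cong)
qed

lemma spectral_integral_add:
  assumes "f \<in> bounded_borel_on S" "g \<in> bounded_borel_on S"
  shows "spectral_integral E S (\<lambda>t. f t + g t) x = spectral_integral E S f x + spectral_integral E S g x"
  using spectral_op_add[OF bounded_measurable_restrict[OF assms(1)] bounded_measurable_restrict[OF assms(2)]]
  unfolding spectral_integral_eq_spectral_op by (simp add: scaleR_add_right)

lemma spectral_integral_scale:
  assumes "f \<in> bounded_borel_on S"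
  shows "spectral_integral E S (\<lambda>t. c * f t) x = c *\<^sub>C spectral_integral E S f x"
  using spectral_op_scale[OF bounded_measurable_restrict[OF assms], of c]
  unfolding spectral_integral_eq_spectral_op by simp

lemma spectral_integral_mult:
  assumes "f \<in> bounded_borel_on S" "g \<in> bounded_borel_on S"
  shows "spectral_integral E S (\<lambda>t. f t * g t) x = spectral_integral E S f (spectral_integral E S g x)"
proof -
  have "(\<lambda>t. (indicator S t *\<^sub>R f t) * (indicator S t *\<^sub>R g t)) = (\<lambda>t. indicator S t *\<^sub>R (f t * g t))"
    by (auto simp: indicator_def)
  then show ?thesis
    using spectral_op_mult[OF bounded_measurable_restrict[OF assms(1)] bounded_measurable_restrict[OF assms(2)]]
    unfolding spectral_integral_eq_spectral_op by simp
qed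

lemma spectral_integral_cnj:
  assumes "f \<in> bounded_borel_on S"
  shows "cinner (spectral_integral E S f x) y = cinner x (spectral_integral E S (\<lambda>t. cnj (f t)) y)"
proof -
  have "(\<lambda>t. cnj (indicator S t *\<^sub>R f t)) = (\<lambda>t. indicator S t *\<^sub>R cnj (f t))" by (auto simp: indicator_def)
  then show ?thesis
    using spectral_op_cnj[OF bounded_measurable_restrict[OF assms]]
    unfolding spectral_integral_eq_spectral_op by simp
qed

lemma spectral_integral_1: "spectral_integral E S (\<lambda>t. 1) = id"
proof -
  have "(\<lambda>t. indicator S t *\<^sub>R (1 :: complex)) = indicator S" by (auto simp: indicator_def)
  then show ?thesis unfolding spectral_integral_eq_spectral_op
    by (simp add: spectral_op_indicator[OF S_sets] E_S)
qed

lemma cinner_spectral_integral_eqI: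
  assumes m: "Im m \<noteq> 0"
    and poly: "\<And>p. real_polynomial_function p \<Longrightarrow>
      cinner (spectral_integral E S (\<lambda>t. of_real (p (moebius_point m t))) u) v
      = cinner (spectral_integral E S (\<lambda>t. of_real (p (moebius_point m t))) u') v'"
    and f: "f \<in> bounded_borel_on S"
  shows "cinner (spectral_integral E S f u) v = cinner (spectral_integral E S f u') v'"
  unfolding spectral_integral_eq_spectral_op
proof (rule cinner_spectral_op_eqI[OF m _ bounded_measurable_restrict[OF f]])
  fix p :: "complex \<Rightarrow> real"
  assume p: "real_polynomial_function p"
  have "bounded_measurable (\<lambda>t. of_real (p (moebius_point m t)))"
    using p by (intro bounded_measurable_continuous_moebius[OF m] continuous_on_polymonial_function)
      (simp add: real_polynomial_function_eq)
  then show "cinner (spectral_op E (\<lambda>t. of_real (p (moebius_point m t))) u) v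
      = cinner (spectral_op E (\<lambda>t. of_real (p (moebius_point m t))) u') v'"
    using poly[OF p] by (simp add: spectral_integral_eq)
qed

end

section \<open>Bounded Borel functions on a subset of the sphere\<close>

lemma bounded_borel_onI:
  "f \<in> borel_measurable (restrict_space sphere_borel S) \<Longrightarrow> (\<And>t. t \<in> S \<Longrightarrow> cmod (f t) \<le> K) \<Longrightarrow> f \<in> bounded_borel_on S"
  unfolding bounded_borel_on_def bounded_iff by blast

lemma bounded_borel_onE:
  assumes "f \<in> bounded_borel_on S"
  obtains K where "0 \<le> K" "\<And>t. t \<in> S \<Longrightarrow> cmod (f t) \<le> K" "f \<in> borel_measurable (restrict_space sphere_borel S)"
proof -
  obtain K where "\<And>t. t \<in> S \<Longrightarrow> cmod (f t) \<le> K" using assms unfolding bounded_borel_on_def bounded_iff by auto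
  then show ?thesis using assms unfolding bounded_borel_on_def
    by (intro that[of "max K 0"]) (auto simp: le_max_iff_disj)
qed

lemma bounded_borel_on_subset: "f \<in> bounded_borel_on S \<Longrightarrow> S' \<subseteq> S \<Longrightarrow> f \<in> bounded_borel_on S'"
  unfolding bounded_borel_on_def by (auto intro: measurable_restrict_mono bounded_subset)

lemma bounded_borel_on_add:
  assumes "f \<in> bounded_borel_on S" "g \<in> bounded_borel_on S"
  shows "(\<lambda>t. f t + g t) \<in> bounded_borel_on S"
proof -
  obtain K L where K: "\<And>t. t \<in> S \<Longrightarrow> cmod (f t) \<le> K" and L: "\<And>t. t \<in> S \<Longrightarrow> cmod (g t) \<le> L"
    and [measurable]: "f \<in> borel_measurable (restrict_space sphere_borel S)" "g \<in> borel_measurable (restrict_space sphere_borel S)"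
    using assms by (metis bounded_borel_onE)
  show ?thesis
  proof (rule bounded_borel_onI[of _ _ "K + L"])
    show "cmod (f t + g t) \<le> K + L" if "t \<in> S" for t
      using K[OF that] L[OF that] norm_triangle_ineq[of "f t" "g t"] by linarith
  qed measurable
qed

lemma bounded_borel_on_mult:
  assumes "f \<in> bounded_borel_on S" "g \<in> bounded_borel_on S"
  shows "(\<lambda>t. f t * g t) \<in> bounded_borel_on S"
proof -
  obtain K L where K: "\<And>t. t \<in> S \<Longrightarrow> cmod (f t) \<le> K" and L: "\<And>t. t \<in> S \<Longrightarrow> cmod (g t) \<le> L" and K0: "0 \<le> K"
    and [measurable]: "f \<in> borel_measurable (restrict_space sphere_borel S)" "g \<in> borel_measurable (restrict_space sphere_borel S)"
    using assms by (metis bounded_borel_onE)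
  show ?thesis
  proof (rule bounded_borel_onI[of _ _ "K * L"])
    show "cmod (f t * g t) \<le> K * L" if "t \<in> S" for t
      unfolding norm_mult using K[OF that] L[OF that] K0 by (intro mult_mono) auto
  qed measurable
qed

lemma bounded_borel_on_const: "(\<lambda>t. c) \<in> bounded_borel_on S"
  by (rule bounded_borel_onI[of _ _ "cmod c"]) auto

lemma bounded_borel_on_cnj:
  assumes "f \<in> bounded_borel_on S"
  shows "(\<lambda>t. cnj (f t)) \<in> bounded_borel_on S"
proof -
  obtain K where K: "\<And>t. t \<in> S \<Longrightarrow> cmod (f t) \<le> K" and f: "f \<in> borel_measurable (restrict_space sphere_borel S)"
    using assms by (metis bounded_borel_onE)
  have "cnj \<in> borel_measurable borel" by (intro borel_measurable_continuous_onI continuous_intros)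
  from measurable_compose[OF f this] show ?thesis by (rule bounded_borel_onI) (use K in simp)
qed

lemma bounded_borel_on_sharp:
  assumes f: "f \<in> bounded_borel_on S" and S: "\<And>t. t \<in> S \<Longrightarrow> sphere_cnj t \<in> S"
  shows "(\<lambda>t. cnj (f (sphere_cnj t))) \<in> bounded_borel_on S"
proof -
  obtain K where K: "\<And>t. t \<in> S \<Longrightarrow> cmod (f t) \<le> K" and m: "f \<in> borel_measurable (restrict_space sphere_borel S)"
    using f by (metis bounded_borel_onE)
  have c: "cnj \<in> borel_measurable borel" by (intro borel_measurable_continuous_onI continuous_intros)
  have "sphere_cnj \<in> measurable sphere_borel sphere_borel"
  proof (rule measurableI)
    fix B
    assume "B \<in> sets sphere_borel"
    then have "cnj -` (Some -` B) \<in> sets borel"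
      using measurable_sets[OF c, of "Some -` B"] by (simp add: sets_sphere_borel_iff)
    moreover have "Some -` (sphere_cnj -` B) = cnj -` (Some -` B)" by auto
    ultimately show "sphere_cnj -` B \<inter> space sphere_borel \<in> sets sphere_borel"
      by (simp add: sets_sphere_borel_iff)
  qed simp
  then have "sphere_cnj \<in> measurable (restrict_space sphere_borel S) (restrict_space sphere_borel S)"
    using S by (intro measurable_restrict_space3) auto
  then have "(\<lambda>t. cnj (f (sphere_cnj t))) \<in> borel_measurable (restrict_space sphere_borel S)"
    using measurable_compose[OF measurable_compose[OF _ m] c] by blast
  then show ?thesis by (rule bounded_borel_onI[where K = K]) (use K S in simp)
qed

lemma rat_eval_bounded_borel:
  fixes A :: "('k::{complex_normed_vector, complete_space} \<times> 'k) set"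
  assumes "Some m \<in> resolvent_set A" "r \<in> rat_algebra A"
  shows "rat_eval r \<in> bounded_borel_on (spectrum A)"
proof -
  obtain K where K: "\<And>t. t \<in> spectrum A \<Longrightarrow> cmod (rat_eval r t) \<le> K" using rat_eval_bounded[OF assms] by blast
  have "(\<lambda>z. poly p z) \<in> borel_measurable borel" for p :: "complex poly"
    by (intro borel_measurable_continuous_onI continuous_intros)
  then have "rat_eval r \<in> borel_measurable sphere_borel"
    by (intro borel_measurable_sphereI) simp
  then show ?thesis by (rule bounded_borel_onI[OF measurable_restrict_space1 K])
qed

lemma moebius_point_bounded_borel:
  assumes "Im m \<noteq> 0" "S \<subseteq> ext_real"
  shows "moebius_point m \<in> bounded_borel_on S"
  using moebius_point_bound[OF assms(1)] assms(2)
  by (intro bounded_borel_onI[OF measurable_restrict_space1[OF moebius_point_measurable]]) blast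

section \<open>Spectra and resolvents of self-adjoint relations\<close>

lemma spectrum_sphere_borel:
  fixes A :: "('k::{complex_normed_vector, complete_space} \<times> 'k) set"
  shows "spectrum A \<in> sets sphere_borel"
proof -
  have "Some -` spectrum A = - {z. Some z \<in> resolvent_set A}" by (auto simp: spectrum_def)
  then show ?thesis using open_resolvent_set[of A] by (simp add: sets_sphere_borel_iff)
qed

text \<open>For finite \<alpha> = a the elements of \<open>A\<close> are the pairs (R k, k + a R k).
  Testing against all of them turns the condition in \<open>rel_adj\<close> into the resolvent
  equation at the conjugate point for the adjoint of R. The argument runs on nondegeneracy of the
  form and so covers Krein spaces.\<close>

lemma selfadjoint_resolvent_adjoint:
  assumes ip: "riesz_form ip" and A: "rel_adj ip A = A" and \<alpha>: "\<alpha> \<in> resolvent_set A"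
  shows "sphere_cnj \<alpha> \<in> resolvent_set A"
    and "ip (resolvent A \<alpha> x) y = ip x (resolvent A (sphere_cnj \<alpha>) y)"
proof -
  have h: "hermitian_form ip" by (rule riesz_form_hermitian[OF ip])
  define R where "R = resolvent A \<alpha>"
  define R' where "R' = adj ip ip R"
  have bR: "bounded_clinear R" unfolding R_def by (rule resolvent_setD(1)[OF \<alpha>])
  have bR': "bounded_clinear R'" and RR': "ip (R u) y = ip u (R' y)" for u y
    using riesz_form_adjoint[OF ip ip bR] unfolding R'_def by auto
  have R'R: "ip (R' y) u = ip y (R u)" for u y
    using RR'[of u y] hermitian_form_cnj[OF h, of "R u" y] hermitian_form_cnj[OF h, of u "R' y"] by simp
  have eqI: "(\<forall>k. ip x k = ip y k) \<longleftrightarrow> x = y" for x y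
  proof
    assume *: "\<forall>k. ip x k = ip y k"
    show "x = y"
    proof (rule riesz_form_eqI[OF ip])
      show "ip k x = ip k y" for k
        using * hermitian_form_cnj[OF h, of x k] hermitian_form_cnj[OF h, of y k] by simp
    qed
  qed simp
  have memA: "(x, y) \<in> A \<longleftrightarrow> (\<forall>(u, v)\<in>A. ip x v = ip y u)" for x y
    by (subst A[symmetric]) (simp add: rel_adj_def)
  have "sphere_cnj \<alpha> \<in> resolvent_set A \<and> resolvent A (sphere_cnj \<alpha>) = R'"
  proof (cases \<alpha>)
    case None
    have g: "(u, v) \<in> A \<longleftrightarrow> R u = v" for u v
      using mem_iff_resolvent_None[of A u v] \<alpha> None unfolding R_def by simp
    have "(x, y) \<in> A \<longleftrightarrow> R' x = y" for x y
    proof -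
      have "(x, y) \<in> A \<longleftrightarrow> (\<forall>u. ip x (R u) = ip y u)" unfolding memA by (auto simp: g)
      then show ?thesis unfolding R'R[symmetric] eqI .
    qed
    from resolvent_set_NoneI[OF bR' this] show ?thesis using None by simp
  next
    case (Some a)
    have g: "(u, v) \<in> A \<longleftrightarrow> R (v - a *\<^sub>C u) = u" for u v
      using mem_iff_resolvent[of a A u v] \<alpha> Some unfolding R_def by simp
    have "(x, y) \<in> A \<longleftrightarrow> R' (y - cnj a *\<^sub>C x) = x" for x y
    proof -
      have "(x, y) \<in> A \<longleftrightarrow> (\<forall>k. ip x (k + a *\<^sub>C R k) = ip y (R k))"
      proof
        assume "(x, y) \<in> A"
        moreover have "(R k, k + a *\<^sub>C R k) \<in> A" for k unfolding g by simp
        ultimately show "\<forall>k. ip x (k + a *\<^sub>C R k) = ip y (R k)" using memA[of x y] by blast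
      next
        assume *: "\<forall>k. ip x (k + a *\<^sub>C R k) = ip y (R k)"
        show "(x, y) \<in> A" unfolding memA
        proof safe
          fix u v
          assume "(u, v) \<in> A"
          then show "ip x v = ip y u" using *[rule_format, of "v - a *\<^sub>C u"] unfolding g by simp
        qed
      qed
      also have "\<dots> \<longleftrightarrow> (\<forall>k. ip (R' (y - cnj a *\<^sub>C x)) k = ip x k)"
        unfolding R'R using h by (simp add: hermitian_form_simps algebra_simps) metis
      finally show ?thesis unfolding eqI .
    qed
    from resolvent_setI[OF bR' this] show ?thesis using Some by simp
  qed
  then show "sphere_cnj \<alpha> \<in> resolvent_set A" "ip (resolvent A \<alpha> x) y = ip x (resolvent A (sphere_cnj \<alpha>) y)"
    using RR' unfolding R_def by auto
qed

text \<open>Symmetry gives |Im z| |u| \<le> |v - z u| for (u, v) in \<open>H\<close>, hence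
  injectivity and a bound. Surjectivity comes from Riesz: for given w the functional v - cnj z u
  \<mapsto> (u, w) on the range of H - cnj z is bounded by the same estimate, and its representing
  vector h puts (h, w + z h) into the adjoint of \<open>H\<close>, which is
  \<open>H\<close>.\<close>

lemma selfadjoint_nonreal_resolvent:
  fixes H :: "('v::complex_hilbert \<times> 'v) set"
  assumes H: "rel_adj cinner H = H" and sub: "csubspace H" and z: "Im z \<noteq> 0"
  shows "Some z \<in> resolvent_set H"
proof -
  have mem: "(x, y) \<in> H \<longleftrightarrow> (\<forall>(u, v)\<in>H. cinner x v = cinner y u)" for x y
    by (subst H[symmetric]) (simp add: rel_adj_def)
  \<comment> \<open>Formulated for every \<zeta> with the same |Im \<zeta>|, as it is applied to
    both z and its conjugate.\<close>
  have bound: "\<bar>Im z\<bar> * norm u \<le> norm (v - \<zeta> *\<^sub>C u)" if uv: "(u, v) \<in> H" and \<zeta>: "\<bar>Im \<zeta>\<bar> = \<bar>Im z\<bar>" for u v \<zeta>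
  proof -
    have "cinner u v = cinner v u" using mem[of u v] uv by auto
    then have "Im (cinner v u) = 0" using cinner_cnj[of v u] by (metis Reals_cnj_iff complex_is_Real_iff)
    then have "\<bar>Im (cinner (v - \<zeta> *\<^sub>C u) u)\<bar> = \<bar>Im z\<bar> * (norm u)\<^sup>2"
      using \<zeta> by (simp add: cinner_simps cinner_self abs_mult)
    then have "\<bar>Im z\<bar> * norm u * norm u \<le> norm (v - \<zeta> *\<^sub>C u) * norm u"
      using abs_Im_le_cmod[of "cinner (v - \<zeta> *\<^sub>C u) u"] cinner_Cauchy_Schwarz[of "v - \<zeta> *\<^sub>C u" u]
      by (simp add: power2_eq_square)
    then show ?thesis by (cases "u = 0") auto
  qed
  have Hadd: "(u, v) \<in> H \<Longrightarrow> (u', v') \<in> H \<Longrightarrow> (u + u', v + v') \<in> H" for u v u' v'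
    using cv.subspace_add[OF sub, of "(u, v)" "(u', v')"] by simp
  have Hscale: "(u, v) \<in> H \<Longrightarrow> (a *\<^sub>C u, a *\<^sub>C v) \<in> H" for u v a
    using cv.subspace_scale[OF sub, of "(u, v)" a] by (simp add: scaleC_prod_def)
  have H0: "(0, 0) \<in> H" using cv.subspace_0[OF sub] by (simp add: zero_prod_def)
  have uniq: "u = u'" if "(u, v) \<in> H" "(u', v') \<in> H" "v - \<zeta> *\<^sub>C u = v' - \<zeta> *\<^sub>C u'" "\<bar>Im \<zeta>\<bar> = \<bar>Im z\<bar>" for u v u' v' \<zeta>
  proof -
    have "(u + (- 1) *\<^sub>C u', v + (- 1) *\<^sub>C v') \<in> H" by (rule Hadd[OF that(1) Hscale[OF that(2)]])
    then have "(u - u', v - v') \<in> H" by (simp add: scaleC_one)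
    from bound[OF this that(4)] have "\<bar>Im z\<bar> * norm (u - u') \<le> norm ((v - v') - \<zeta> *\<^sub>C (u - u'))" .
    also have "(v - v') - \<zeta> *\<^sub>C (u - u') = 0"
      using that(3) by (simp add: cv.scale_right_diff_distrib algebra_simps)
    finally show ?thesis using z by (simp add: mult_le_0_iff)
  qed
  define M where "M = {v - cnj z *\<^sub>C u |u v. (u, v) \<in> H}"
  \<comment> \<open>The inverse of H - cnj z on its range \<open>M\<close>; the choice is unique by
    \<open>uniq\<close>.\<close>
  define g where "g x = (SOME u. \<exists>v. (u, v) \<in> H \<and> x = v - cnj z *\<^sub>C u)" for x
  have g: "g (v - cnj z *\<^sub>C u) = u" if "(u, v) \<in> H" for u v
  proof -
    have "\<exists>u' v'. (u', v') \<in> H \<and> v - cnj z *\<^sub>C u = v' - cnj z *\<^sub>C u'" using that by blast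
    then have "\<exists>v'. (g (v - cnj z *\<^sub>C u), v') \<in> H \<and> v - cnj z *\<^sub>C u = v' - cnj z *\<^sub>C g (v - cnj z *\<^sub>C u)"
      unfolding g_def by (rule someI_ex)
    then obtain v' where v': "(g (v - cnj z *\<^sub>C u), v') \<in> H" "v - cnj z *\<^sub>C u = v' - cnj z *\<^sub>C g (v - cnj z *\<^sub>C u)"
      by blast
    show ?thesis by (rule uniq[OF v'(1) that v'(2)[symmetric]]) simp
  qed
  have ga: "g (x + y) = g x + g y \<and> x + y \<in> M" if xM: "x \<in> M" and yM: "y \<in> M" for x y
  proof -
    obtain u v u' v' where uv: "(u, v) \<in> H" "x = v - cnj z *\<^sub>C u" "(u', v') \<in> H" "y = v' - cnj z *\<^sub>C u'"
      using xM yM unfolding M_def by blast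
    have e: "x + y = (v + v') - cnj z *\<^sub>C (u + u')" using uv by (simp add: scaleC_add_right)
    have "g (x + y) = g x + g y"
      unfolding e g[OF Hadd[OF uv(1,3)]] using g[OF uv(1)] g[OF uv(3)] uv(2,4) by simp
    moreover have "x + y \<in> M" unfolding M_def e using Hadd[OF uv(1,3)] by blast
    ultimately show ?thesis ..
  qed
  have gs: "g (a *\<^sub>C x) = a *\<^sub>C g x \<and> a *\<^sub>C x \<in> M" if xM: "x \<in> M" for a x
  proof -
    obtain u v where uv: "(u, v) \<in> H" "x = v - cnj z *\<^sub>C u" using xM unfolding M_def by blast
    have e: "a *\<^sub>C x = a *\<^sub>C v - cnj z *\<^sub>C (a *\<^sub>C u)"
      using uv by (simp add: cv.scale_right_diff_distrib scaleC_scaleC mult.commute)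
    have "g (a *\<^sub>C x) = a *\<^sub>C g x" unfolding e g[OF Hscale[OF uv(1)]] using g[OF uv(1)] uv(2) by simp
    moreover have "a *\<^sub>C x \<in> M" unfolding M_def e using Hscale[OF uv(1)] by blast
    ultimately show ?thesis ..
  qed
  have sM: "csubspace M"
    using H0 ga gs by (intro cv.subspaceI) (auto simp: M_def intro!: exI[of _ 0])
  have "\<exists>h. (h, w + z *\<^sub>C h) \<in> H \<and> norm h \<le> norm w / \<bar>Im z\<bar>" for w
  proof -
    have b: "cmod (cinner (g x) w) \<le> (norm w / \<bar>Im z\<bar>) * sqrt (Re (cinner x x))" if "x \<in> M" for x
    proof -
      obtain u v where uv: "(u, v) \<in> H" "x = v - cnj z *\<^sub>C u" using \<open>x \<in> M\<close> unfolding M_def by blast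
      have "norm u \<le> norm x / \<bar>Im z\<bar>"
        unfolding uv(2) using bound[OF uv(1), of "cnj z"] z by (simp add: pos_le_divide_eq mult.commute)
      then have "norm u * norm w \<le> norm x / \<bar>Im z\<bar> * norm w" by (intro mult_right_mono) auto
      then show ?thesis using cinner_Cauchy_Schwarz[of u w] g[OF uv(1)] uv(2)
        by (simp add: norm_eq_sqrt_cinner[symmetric] mult.commute)
    qed
    obtain h where h: "\<And>x. x \<in> M \<Longrightarrow> cinner (g x) w = cinner x h" "sqrt (Re (cinner h h)) \<le> norm w / \<bar>Im z\<bar>"
      by (rule riesz_on_subspace[OF hermitian_form_cinner hilbert_subspace_cinner sM, of "\<lambda>x. cinner (g x) w" "norm w / \<bar>Im z\<bar>"])
        (use ga gs b in \<open>auto simp: cinner_simps\<close>)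
    have "cinner h v = cinner (w + z *\<^sub>C h) u" if uv: "(u, v) \<in> H" for u v
    proof -
      have "cinner u w = cinner (v - cnj z *\<^sub>C u) h"
        using h(1)[of "v - cnj z *\<^sub>C u"] g[OF uv] uv unfolding M_def by auto
      then have "cinner v h = cinner u (w + z *\<^sub>C h)" by (simp add: cinner_simps)
      then have "cnj (cinner v h) = cnj (cinner u (w + z *\<^sub>C h))" by (rule arg_cong)
      then show ?thesis unfolding cinner_cnj .
    qed
    then have "(h, w + z *\<^sub>C h) \<in> H" using mem[of h "w + z *\<^sub>C h"] by blast
    then show ?thesis using h(2) by (auto simp: norm_eq_sqrt_cinner)
  qed
  then obtain R where R: "\<And>w. (R w, w + z *\<^sub>C R w) \<in> H" "\<And>w. norm (R w) \<le> norm w / \<bar>Im z\<bar>" by metis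
  have Ru: "R (v - z *\<^sub>C u) = u" if "(u, v) \<in> H" for u v
    using uniq[OF R(1)[of "v - z *\<^sub>C u"] that, of z] by simp
  show ?thesis
  proof (rule resolvent_setI(1)[of R])
    show "bounded_clinear R"
    proof (rule bounded_clinearI[of _ "1 / \<bar>Im z\<bar>"])
      show "R (x + y) = R x + R y" for x y
        using Ru[OF Hadd[OF R(1)[of x] R(1)[of y]]] by (simp add: scaleC_add_right algebra_simps)
      show "R (a *\<^sub>C x) = a *\<^sub>C R x" for a x
        using Ru[OF Hscale[OF R(1)[of x], of a]] by (simp add: scaleC_add_right scaleC_scaleC mult.commute)
      show "norm (R x) \<le> norm x * (1 / \<bar>Im z\<bar>)" for x using R(2)[of x] by simp
    qed
    show "(x, y) \<in> H \<longleftrightarrow> R (y - z *\<^sub>C x) = x" for x y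
      using Ru[of x y] R(1)[of "y - z *\<^sub>C x"] by auto
  qed
qed

section \<open>The functional calculus\<close>

text \<open>If c 0 = x a L with x > 1, the recursion forces c n \<ge> a (x L)^(2^n), which outgrows
  K L^(2^n). The factor K may be arbitrarily bad, since it does not enter the conclusion.\<close>

lemma iteration_bound:
  fixes a K L :: real and c :: "nat \<Rightarrow> real"
  assumes a: "0 \<le> a" and L: "0 < L" and c0: "\<And>n. 0 \<le> c n"
    and sq: "\<And>n. (c n)\<^sup>2 \<le> a * c (Suc n)" and b: "\<And>n. c n \<le> K * L ^ (2 ^ n)"
  shows "c 0 \<le> a * L"
proof (rule ccontr)
  assume "\<not> c 0 \<le> a * L"
  then have c: "a * L < c 0" by simp
  have a0: "0 < a"
  proof (rule ccontr)
    assume "\<not> 0 < a"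
    then have "(c 0)\<^sup>2 \<le> 0" using a sq[of 0] by simp
    then show False using c a \<open>\<not> 0 < a\<close> by simp
  qed
  define x where "x = c 0 / (a * L)"
  have x1: "1 < x" using c a0 L by (simp add: x_def field_simps)
  have cx: "a * (x * L) ^ (2 ^ n) \<le> c n" for n
  proof (induction n)
    case 0
    then show ?case using a0 L by (simp add: x_def)
  next
    case (Suc n)
    have "0 \<le> a * (x * L) ^ (2 ^ n)" using a0 L x1 by simp
    then have "(a * (x * L) ^ (2 ^ n))\<^sup>2 \<le> (c n)\<^sup>2" using Suc by (intro power_mono)
    moreover have "(a * y ^ k)\<^sup>2 = a * (a * y ^ (2 * k))" for y and k :: nat
      by (simp add: power2_eq_square mult_2 power_add)
    ultimately have "a * (a * (x * L) ^ (2 * 2 ^ n)) \<le> a * c (Suc n)" using sq[of n] by simp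
    then show ?case using a0 by simp
  qed
  obtain N where N: "K / a < x ^ N" using real_arch_pow[OF x1] by blast
  have "x ^ N \<le> x ^ (2 ^ N)" using x1 by (intro power_increasing) (auto simp: less_imp_le)
  then have "a * x ^ N \<le> a * x ^ (2 ^ N)" using a0 by simp
  moreover have "K < a * x ^ N" using N a0 by (simp add: field_simps)
  ultimately have "K < a * x ^ (2 ^ N)" by linarith
  moreover have "a * x ^ (2 ^ N) * L ^ (2 ^ N) \<le> K * L ^ (2 ^ N)"
    using cx[of N] b[of N] by (simp add: power_mult_distrib mult_ac)
  ultimately show False using L by (simp add: mult_le_cancel_right)
qed

section \<open>The algebra of jets\<close>

lemma compose_jet_apply:
  "compose_jet q A s g w j = (if w \<in> spectrum A \<and> j \<le> rat_zero_order q w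
     then taylor_coeff (rat_eval s) w j + g w * taylor_coeff (rat_eval q) w j else 0)"
  by (simp add: compose_jet_def jet_add_def jet_embed_def jet_domain_def)

text \<open>All Taylor coefficients of \<open>q\<close> with index below j vanish, so the Cauchy
  product keeps the single term in which \<open>q\<close> carries index j and the other factor index
  0.\<close>

lemma zero_order_sum:
  assumes "w \<notin> rat_poles q" "q \<noteq> 0" "j \<le> rat_zero_order q w"
  shows "(\<Sum>k\<le>j. a k * taylor_coeff (rat_eval q) w (j - k)) = a 0 * taylor_coeff (rat_eval q) w j"
    and "(\<Sum>k\<le>j. taylor_coeff (rat_eval q) w k * a (j - k)) = taylor_coeff (rat_eval q) w j * a 0"
proof -
  have z: "taylor_coeff (rat_eval q) w i = 0" if "i < j" for i
    using zero_order_taylor_coeff(1)[OF assms(1,2)] that assms(3) by simp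
  have "(\<Sum>k\<le>j. a k * taylor_coeff (rat_eval q) w (j - k)) = (\<Sum>k\<in>{0}. a k * taylor_coeff (rat_eval q) w (j - k))"
    by (intro sum.mono_neutral_right) (auto simp: z)
  then show "(\<Sum>k\<le>j. a k * taylor_coeff (rat_eval q) w (j - k)) = a 0 * taylor_coeff (rat_eval q) w j" by simp
  have "(\<Sum>k\<le>j. taylor_coeff (rat_eval q) w k * a (j - k)) = (\<Sum>k\<in>{j}. taylor_coeff (rat_eval q) w k * a (j - k))"
    by (intro sum.mono_neutral_right) (auto simp: z)
  then show "(\<Sum>k\<le>j. taylor_coeff (rat_eval q) w k * a (j - k)) = taylor_coeff (rat_eval q) w j * a 0" by simp
qed

lemma compose_jet_add:
  assumes "s \<in> rat_algebra A" "s' \<in> rat_algebra A"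
  shows "jet_add (compose_jet q A s g) (compose_jet q A s' g') = compose_jet q A (s + s') (\<lambda>t. g t + g' t)"
  using assms unfolding not_pole_iff_rat_algebra
  by (auto simp: fun_eq_iff jet_add_def compose_jet_apply taylor_coeff_add distrib_right)

lemma compose_jet_scale:
  assumes "s \<in> rat_algebra A"
  shows "jet_scale a (compose_jet q A s g) = compose_jet q A (Fract [:a:] 1 * s) (\<lambda>t. a * g t)"
  using assms unfolding not_pole_iff_rat_algebra
  by (auto simp: fun_eq_iff jet_scale_def compose_jet_apply taylor_coeff_scale distrib_left)

text \<open>The Borel part on the right is the coefficient of \<open>q\<close> in the expanded
  product (s + g q)(s' + g' q). The rational functions enter it by their values alone, because
  multiplication by the jet of \<open>q\<close> annihilates higher Taylor coefficients.\<close>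

lemma compose_jet_mult:
  assumes s: "s \<in> rat_algebra A" "s' \<in> rat_algebra A" and q: "q \<in> rat_algebra A" "q \<noteq> 0"
  shows "jet_mult q (compose_jet q A s g) (compose_jet q A s' g')
    = compose_jet q A (s * s') (\<lambda>t. rat_eval s t * g' t + g t * rat_eval s' t + g t * g' t * rat_eval q t)"
proof (intro ext)
  fix w j
  let ?t = "\<lambda>r i. taylor_coeff (rat_eval r) w i"
  show "jet_mult q (compose_jet q A s g) (compose_jet q A s' g') w j
    = compose_jet q A (s * s') (\<lambda>t. rat_eval s t * g' t + g t * rat_eval s' t + g t * g' t * rat_eval q t) w j"
  proof (cases "w \<in> spectrum A \<and> j \<le> rat_zero_order q w")
    case False
    then show ?thesis by (auto simp: jet_mult_def compose_jet_apply)
  next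
    case True
    then have np: "w \<notin> rat_poles s" "w \<notin> rat_poles s'" "w \<notin> rat_poles q"
      using s q unfolding not_pole_iff_rat_algebra by auto
    have "jet_mult q (compose_jet q A s g) (compose_jet q A s' g') w j
       = (\<Sum>k\<le>j. compose_jet q A s g w k * compose_jet q A s' g' w (j - k))"
      using True by (simp add: jet_mult_def)
    also have "\<dots> = (\<Sum>k\<le>j. (?t s k + g w * ?t q k) * (?t s' (j - k) + g' w * ?t q (j - k)))"
    proof (intro sum.cong refl)
      fix k
      assume "k \<in> {..j}"
      then have "k \<le> rat_zero_order q w" "j - k \<le> rat_zero_order q w" using True by auto
      then show "compose_jet q A s g w k * compose_jet q A s' g' w (j - k)
          = (?t s k + g w * ?t q k) * (?t s' (j - k) + g' w * ?t q (j - k))"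
        using True by (simp add: compose_jet_apply)
    qed
    also have "\<dots> = (\<Sum>k\<le>j. ?t s k * ?t s' (j - k)) + g' w * (\<Sum>k\<le>j. ?t s k * ?t q (j - k))
        + g w * (\<Sum>k\<le>j. ?t q k * ?t s' (j - k)) + g w * g' w * (\<Sum>k\<le>j. ?t q k * ?t q (j - k))"
      by (simp add: sum.distrib sum_distrib_left algebra_simps)
    also have "\<dots> = ?t (s * s') j + g' w * (?t s 0 * ?t q j) + g w * (?t q j * ?t s' 0) + g w * g' w * (?t q 0 * ?t q j)"
    proof -
      note z = zero_order_sum[OF np(3) q(2) conjunct2[OF True]]
      show ?thesis
        unfolding taylor_coeff_mult[OF np(1,2)] z(1)[of "?t s"] z(2)[of "?t s'"] z(1)[of "?t q"] ..
    qed
    also have "\<dots> = compose_jet q A (s * s') (\<lambda>t. rat_eval s t * g' t + g t * rat_eval s' t + g t * g' t * rat_eval q t) w j"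
      using True by (simp add: compose_jet_apply taylor_coeff_0 algebra_simps)
    finally show ?thesis .
  qed
qed

text \<open>The order is the index of the first nonzero Taylor coefficient, and for a real
  \<open>q\<close> the coefficients at conjugate points are conjugate to each other.\<close>

lemma rat_zero_order_sharp:
  assumes "w \<notin> rat_poles q" "q \<noteq> 0" "rat_sharp q = q"
  shows "rat_zero_order q (sphere_cnj w) = rat_zero_order q w"
proof -
  have np: "sphere_cnj w \<notin> rat_poles q" using not_pole_sharp[OF assms(1)] assms(3) by simp
  have t: "taylor_coeff (rat_eval q) (sphere_cnj w) j = cnj (taylor_coeff (rat_eval q) w j)" for j
    using taylor_coeff_sharp[OF assms(1), of j] assms(3) by simp
  show ?thesis
    using zero_order_taylor_coeff[OF assms(1,2)] zero_order_taylor_coeff[OF np assms(2)] unfolding t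
    by (metis complex_cnj_zero_iff linorder_neqE_nat)
qed

lemma sphere_cnj_cnj [simp]: "sphere_cnj (sphere_cnj w) = w"
  by (cases w) auto

lemma compose_jet_sharp:
  assumes s: "s \<in> rat_algebra A" and q: "q \<in> rat_algebra A" "q \<noteq> 0" "rat_sharp q = q"
    and sp: "\<And>w. w \<in> spectrum A \<Longrightarrow> sphere_cnj w \<in> spectrum A"
  shows "jet_sharp (compose_jet q A s g) = compose_jet q A (rat_sharp s) (\<lambda>t. cnj (g (sphere_cnj t)))"
proof (intro ext)
  fix w j
  have sp': "sphere_cnj w \<in> spectrum A \<longleftrightarrow> w \<in> spectrum A" using sp[of w] sp[of "sphere_cnj w"] by auto
  show "jet_sharp (compose_jet q A s g) w j = compose_jet q A (rat_sharp s) (\<lambda>t. cnj (g (sphere_cnj t))) w j"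
  proof (cases "w \<in> spectrum A")
    case True
    then have np: "sphere_cnj w \<notin> rat_poles s" "sphere_cnj w \<notin> rat_poles q" "w \<notin> rat_poles q"
      using s q sp' unfolding not_pole_iff_rat_algebra by auto
    show ?thesis
      using True sp' rat_zero_order_sharp[OF np(3) q(2,3)] taylor_coeff_sharp[OF np(1), of j] taylor_coeff_sharp[OF np(2), of j] q(3)
      by (auto simp: jet_sharp_def compose_jet_apply)
  next
    case False
    then show ?thesis using sp' by (simp add: jet_sharp_def compose_jet_apply)
  qed
qed

text \<open>Equal jets force \<open>s - s'\<close> to be divisible by \<open>q\<close>, and comparing the last components shows that
  the quotient is the difference of the two Borel functions, also at the zeros of \<open>q\<close>.\<close>

lemma compose_jet_eqD:
  assumes s: "s \<in> rat_algebra A" "s' \<in> rat_algebra A" and q: "q \<in> rat_algebra A" "q \<noteq> 0"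
    and eq: "compose_jet q A s g = compose_jet q A s' g'"
  obtains k where "k \<in> rat_algebra A" "s = s' + k * q" "\<And>w. w \<in> spectrum A \<Longrightarrow> rat_eval k w = g' w - g w"
proof -
  define r where "r = s - s'"
  have r: "r \<in> rat_algebra A" unfolding r_def by (rule rat_algebra_diff[OF s])
  have t: "taylor_coeff (rat_eval r) w j = (g' w - g w) * taylor_coeff (rat_eval q) w j"
    if w: "w \<in> spectrum A" and j: "j \<le> rat_zero_order q w" for w j
  proof -
    have "w \<notin> rat_poles r" "w \<notin> rat_poles s'" using r s w unfolding not_pole_iff_rat_algebra by auto
    then have "taylor_coeff (rat_eval s) w j = taylor_coeff (rat_eval r) w j + taylor_coeff (rat_eval s') w j"
      using taylor_coeff_add[of w r s' j] by (simp add: r_def)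
    moreover have "compose_jet q A s g w j = compose_jet q A s' g' w j" using eq by simp
    ultimately show ?thesis using w j by (simp add: compose_jet_apply algebra_simps)
  qed
  define k where "k = r / q"
  have np: "w \<notin> rat_poles r" "w \<notin> rat_poles q" if "w \<in> spectrum A" for w
    using r q that unfolding not_pole_iff_rat_algebra by auto
  have npk: "w \<notin> rat_poles k" if w: "w \<in> spectrum A" for w unfolding k_def
    by (rule divide_not_pole[OF np[OF w] q(2)]) (use t[OF w] zero_order_taylor_coeff(1)[OF np(2)[OF w] q(2)] in auto)
  have kq: "r = k * q" using q(2) by (simp add: k_def)
  show ?thesis
  proof (rule that[of k])
    show "k \<in> rat_algebra A" unfolding not_pole_iff_rat_algebra using npk by blast
    show "s = s' + k * q" using kq by (simp add: r_def algebra_simps)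
    fix w
    assume w: "w \<in> spectrum A"
    let ?d = "rat_zero_order q w"
    have "taylor_coeff (rat_eval r) w ?d = rat_eval k w * taylor_coeff (rat_eval q) w ?d"
      unfolding kq taylor_coeff_mult[OF npk[OF w] np(2)[OF w]]
      using zero_order_sum(1)[OF np(2)[OF w] q(2) order_refl, of "taylor_coeff (rat_eval k) w"] by (simp add: taylor_coeff_0)
    then show "rat_eval k w = g' w - g w"
      using t[OF w order_refl] zero_order_taylor_coeff(2)[OF np(2)[OF w] q(2)] by simp
  qed
qed

section \<open>Lifting operators from the Krein space to the Hilbert space\<close>

locale definitizable_setting =
  fixes ip :: "'k::complex_banach \<Rightarrow> 'k \<Rightarrow> complex"
    and A :: "('k \<times> 'k) set"
    and q :: "complex poly fract"
    and T :: "'v::complex_hilbert \<Rightarrow> 'k"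
    and E :: "sphere set \<Rightarrow> 'v \<Rightarrow> 'v"
  assumes krein: "krein_space ip"
    and subspace: "csubspace A"
    and selfadjoint: "rel_adj ip A = A"
    and definitizable: "definitizable ip A"
    and definitizing: "definitizing ip A q"
    and q_sharp: "rat_sharp q = q"
    and q_nonzero: "q \<noteq> 0"
    and T: "bounded_clinear T"
    and inj: "inj T"
    and TT: "T \<circ> adj cinner ip T = rat_calc A q"
    and E: "spectral_measure_of (rel_preimage T A) E"
begin

abbreviation Tp where "Tp \<equiv> adj cinner ip T"
abbreviation H where "H \<equiv> rel_preimage T A"
abbreviation J where "J \<equiv> spectral_integral E (spectrum H)"

lemmas rf = riesz_form_krein[OF krein]
lemmas herm = riesz_form_hermitian[OF rf]

lemma Tp: "bounded_clinear Tp" and T_adj: "ip (T u) y = cinner u (Tp y)"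
  using riesz_form_adjoint[OF riesz_form_cinner rf T] by auto

lemma Tp_adj: "ip y (T u) = cinner (Tp y) u"
  using T_adj[of u y] hermitian_form_cnj[OF herm, of "T u" y] cinner_cnj[of u "Tp y"] by simp

lemma TTp: "T (Tp x) = rat_calc A q x"
  using TT by (auto simp: fun_eq_iff)

lemma T_eqD: "T u = T v \<Longrightarrow> u = v"
  using inj by (simp add: inj_def)

lemma ip_eqI:
  assumes "\<And>k. ip x k = ip y k"
  shows "x = y"
proof (rule riesz_form_eqI[OF rf])
  show "ip k x = ip k y" for k
    using assms[of k] hermitian_form_cnj[OF herm, of x k] hermitian_form_cnj[OF herm, of y k] by simp
qed

lemma q_algebra: "q \<in> rat_algebra A"
  using definitizing by (simp add: definitizing_def)

text \<open>\<open>M\<close> is symmetric for the semidefinite form (Tp x, Tp y) = [q(A) x, y], and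
  Cauchy-Schwarz gives |Tp M^k x|^2 \<le> |Tp x| |Tp M^(2k) x|. Iterating over k = 2^n against the
  crude bound |x| K L^(2^n) leaves just the factor \<open>L\<close>, the bound of \<open>M\<close>
  in the Krein space norm.\<close>

lemma symmetrized_bound:
  assumes M: "bounded_clinear M" and sym: "\<And>x y. ip (M x) y = ip x (M y)"
    and comm: "\<And>x. M (T (Tp x)) = T (Tp (M x))"
  obtains L where "0 < L" "\<And>x. norm (Tp (M x)) \<le> norm (Tp x) * L"
proof -
  obtain L where L: "0 < L" "\<And>x. norm (M x) \<le> norm x * L" using bounded_clinear_bound[OF M] by metis
  obtain K where K: "0 < K" "\<And>x. norm (Tp x) \<le> norm x * K" using bounded_clinear_bound[OF Tp] by metis
  have symn: "ip ((M ^^ n) x) y = ip x ((M ^^ n) y)" for n x y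
    by (induction n arbitrary: x y) (simp_all add: sym funpow_swap1)
  have commn: "(M ^^ n) (T (Tp x)) = T (Tp ((M ^^ n) x))" for n x
    by (induction n) (simp_all add: comm)
  have bn: "norm ((M ^^ n) x) \<le> norm x * L ^ n" for n x
  proof (induction n)
    case (Suc n)
    have "norm ((M ^^ Suc n) x) \<le> norm ((M ^^ n) x) * L" using L(2)[of "(M ^^ n) x"] by simp
    also have "\<dots> \<le> norm x * L ^ n * L" using Suc L(1) by (intro mult_right_mono) auto
    finally show ?case by (simp add: mult_ac)
  qed simp
  have "norm (Tp (M x)) \<le> norm (Tp x) * L" for x
  proof -
    define c where "c n = norm (Tp ((M ^^ (2 ^ n)) x))" for n
    have "c 0 \<le> norm (Tp x) * L"
    proof (rule iteration_bound[of _ _ _ "norm x * K"])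
      show "(c n)\<^sup>2 \<le> norm (Tp x) * c (Suc n)" for n
      proof -
        let ?P = "M ^^ (2 ^ n)"
        have PP: "?P (?P x) = (M ^^ (2 ^ Suc n)) x" by (simp add: mult_2 funpow_add)
        have "cinner (Tp (?P x)) (Tp (?P x)) = ip (T (Tp (?P x))) (?P x)" by (rule T_adj[symmetric])
        also have "\<dots> = ip (T (Tp x)) (?P (?P x))" unfolding commn[symmetric] by (rule symn)
        also have "\<dots> = cinner (Tp x) (Tp (?P (?P x)))" by (rule T_adj)
        finally have "complex_of_real ((c n)\<^sup>2) = cinner (Tp x) (Tp (?P (?P x)))"
          unfolding c_def by (simp add: cinner_self)
        then have "(c n)\<^sup>2 = cmod (cinner (Tp x) (Tp (?P (?P x))))"
          by (metis abs_of_nonneg norm_of_real zero_le_power2)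
        also have "\<dots> \<le> norm (Tp x) * c (Suc n)"
          unfolding c_def PP[symmetric] by (rule cinner_Cauchy_Schwarz)
        finally show ?thesis .
      qed
      show "c n \<le> norm x * K * L ^ (2 ^ n)" for n
      proof -
        have "c n \<le> norm ((M ^^ (2 ^ n)) x) * K" unfolding c_def by (rule K(2))
        also have "\<dots> \<le> norm x * L ^ (2 ^ n) * K" using bn K(1) by (intro mult_right_mono) auto
        finally show ?thesis by (simp add: mult_ac)
      qed
    qed (auto simp: c_def L)
    then show ?thesis by (simp add: c_def)
  qed
  then show ?thesis using that L(1) by blast
qed

text \<open>\<open>S u\<close> is the Riesz vector of the functional \<open>T\<^sup>+ k \<mapsto> (T\<^sup>+ R' k, u)\<close>, which is well defined and bounded
  on the range of \<open>T\<^sup>+\<close>.\<close>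

lemma lift_exists:
  assumes R: "bounded_clinear R" and R': "bounded_clinear R'" and adj: "\<And>x y. ip (R x) y = ip x (R' y)"
    and comm: "\<And>x. R (T (Tp x)) = T (Tp (R x))" "\<And>x. R' (T (Tp x)) = T (Tp (R' x))"
  obtains S where "bounded_clinear S" "\<And>u. T (S u) = R (T u)"
proof -
  have adj': "ip (R' x) y = ip x (R y)" for x y
    using adj[of y x] hermitian_form_cnj[OF herm, of "R y" x] hermitian_form_cnj[OF herm, of y "R' x"] by simp
  \<comment> \<open>\<open>R'\<close> need not be symmetric, so the bound is taken for R R' and
    transferred by |Tp R' x|^2 = (Tp x, Tp R R' x); this leads to the square root of
    \<open>L\<close>.\<close>
  obtain L where L: "0 < L" "\<And>x. norm (Tp ((R \<circ> R') x)) \<le> norm (Tp x) * L"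
    by (rule symmetrized_bound[of "R \<circ> R'"]) (auto simp: bounded_clinear_comp R R' adj adj' comm)
  have b: "norm (Tp (R' x)) \<le> sqrt L * norm (Tp x)" for x
  proof -
    have "cinner (Tp (R' x)) (Tp (R' x)) = ip (T (Tp (R' x))) (R' x)" by (rule T_adj[symmetric])
    also have "\<dots> = ip (T (Tp x)) ((R \<circ> R') x)" unfolding comm(2)[symmetric] adj' by simp
    also have "\<dots> = cinner (Tp x) (Tp ((R \<circ> R') x))" by (rule T_adj)
    finally have "complex_of_real ((norm (Tp (R' x)))\<^sup>2) = cinner (Tp x) (Tp ((R \<circ> R') x))"
      by (simp add: cinner_self)
    then have "(norm (Tp (R' x)))\<^sup>2 = cmod (cinner (Tp x) (Tp ((R \<circ> R') x)))"
      by (metis abs_of_nonneg norm_of_real zero_le_power2)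
    also have "\<dots> \<le> norm (Tp x) * norm (Tp ((R \<circ> R') x))" by (rule cinner_Cauchy_Schwarz)
    also have "\<dots> \<le> norm (Tp x) * (norm (Tp x) * L)" by (intro mult_left_mono L) auto
    also have "\<dots> = (sqrt L * norm (Tp x))\<^sup>2" using L(1) by (simp add: power2_eq_square mult_ac)
    finally show ?thesis by (rule power2_le_imp_le) (use L(1) in simp)
  qed
  \<comment> \<open>\<open>Tp\<close> need not be injective; the estimate, applied to a difference,
    shows that Tp R' k depends on Tp k alone.\<close>
  have wd: "Tp (R' k) = Tp (R' k')" if "Tp k = Tp k'" for k k'
    using b[of "k - k'"] that by (simp add: bounded_clinear_diff_apply[OF Tp] bounded_clinear_diff_apply[OF R'])
  define g where "g x = Tp (R' (SOME k. Tp k = x))" for x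
  have g: "g (Tp k) = Tp (R' k)" for k
    unfolding g_def by (rule wd, rule someI[of "\<lambda>k'. Tp k' = Tp k"]) simp
  have ga: "g (x + y) = g x + g y" if "x \<in> range Tp" "y \<in> range Tp" for x y
    using that g by (auto simp: bounded_clinear_add_apply[OF R'] bounded_clinear_add_apply[OF Tp]
        simp flip: bounded_clinear_add_apply[OF Tp])
  have gs: "g (a *\<^sub>C x) = a *\<^sub>C g x" if x: "x \<in> range Tp" for a x
  proof -
    obtain k where "x = Tp k" using x by blast
    then show ?thesis using g[of k] g[of "a *\<^sub>C k"]
      by (simp add: bounded_clinear_scale_apply[OF R'] bounded_clinear_scale_apply[OF Tp])
  qed
  have sub: "csubspace (range Tp)"
  proof (rule cv.subspaceI)
    show "0 \<in> range Tp" by (metis Tp bounded_clinear_zero_apply rangeI)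
    show "x + y \<in> range Tp" if "x \<in> range Tp" "y \<in> range Tp" for x y
      using that by (auto simp flip: bounded_clinear_add_apply[OF Tp])
    show "c *\<^sub>C x \<in> range Tp" if "x \<in> range Tp" for c x
      using that by (auto simp flip: bounded_clinear_scale_apply[OF Tp])
  qed
  have "\<exists>v. T v = R (T u) \<and> norm v \<le> norm u * sqrt L" for u
  proof -
    have gb: "cmod (cinner (g x) u) \<le> norm u * sqrt L * sqrt (Re (cinner x x))" if x: "x \<in> range Tp" for x
    proof -
      obtain k where k: "x = Tp k" using x by blast
      have "cmod (cinner (g x) u) \<le> norm (g x) * norm u" by (rule cinner_Cauchy_Schwarz)
      also have "\<dots> \<le> (sqrt L * norm x) * norm u" unfolding k g by (intro mult_right_mono b) auto
      finally show ?thesis by (simp add: norm_eq_sqrt_cinner[symmetric] mult_ac)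
    qed
    obtain v where v: "\<And>x. x \<in> range Tp \<Longrightarrow> cinner (g x) u = cinner x v" "sqrt (Re (cinner v v)) \<le> norm u * sqrt L"
      by (rule riesz_on_subspace[OF hermitian_form_cinner hilbert_subspace_cinner sub, of "\<lambda>x. cinner (g x) u" "norm u * sqrt L"])
        (use ga gs gb L(1) in \<open>auto simp: cinner_simps\<close>)
    have "T v = R (T u)"
    proof (rule riesz_form_eqI[OF rf])
      fix k
      have "ip k (T v) = cinner (Tp k) v" by (rule Tp_adj)
      also have "\<dots> = cinner (Tp (R' k)) u" using v(1)[of "Tp k"] g by simp
      also have "\<dots> = ip (R' k) (T u)" by (rule Tp_adj[symmetric])
      finally show "ip k (T v) = ip k (R (T u))" by (simp add: adj')
    qed
    then show ?thesis using v(2) by (auto simp: norm_eq_sqrt_cinner)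
  qed
  then obtain S where S: "\<And>u. T (S u) = R (T u)" "\<And>u. norm (S u) \<le> norm u * sqrt L" by metis
  have "bounded_clinear S"
  proof (rule bounded_clinearI[of _ "sqrt L"])
    show "S (x + y) = S x + S y" for x y
      by (rule T_eqD) (simp add: S(1) bounded_clinear_add_apply[OF T] bounded_clinear_add_apply[OF R])
    show "S (a *\<^sub>C x) = a *\<^sub>C S x" for a x
      by (rule T_eqD) (simp add: S(1) bounded_clinear_scale_apply[OF T] bounded_clinear_scale_apply[OF R])
  qed (rule S(2))
  then show ?thesis using that S(1) by blast
qed

section \<open>The rational calculus of A and the lifted relation H\<close>

lemma nonreal_point: "\<exists>m. Im m \<noteq> 0 \<and> Some m \<in> resolvent_set A"
  using definitizable nonreal_resolvent_point[of A] unfolding definitizable_def by blast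

lemma resolvent_cnj: "\<alpha> \<in> resolvent_set A \<Longrightarrow> sphere_cnj \<alpha> \<in> resolvent_set A"
  by (rule selfadjoint_resolvent_adjoint(1)[OF rf selfadjoint])

lemma resolvent_adj: "\<alpha> \<in> resolvent_set A \<Longrightarrow> ip (resolvent A \<alpha> x) y = ip x (resolvent A (sphere_cnj \<alpha>) y)"
  by (rule selfadjoint_resolvent_adjoint(2)[OF rf selfadjoint])

lemma spectrum_cnj: "w \<in> spectrum A \<Longrightarrow> sphere_cnj w \<in> spectrum A"
  using resolvent_cnj[of "sphere_cnj w"] unfolding spectrum_def by auto

lemma rat_sharp_algebra: "s \<in> rat_algebra A \<Longrightarrow> rat_sharp s \<in> rat_algebra A"
  unfolding not_pole_iff_rat_algebra using spectrum_cnj not_pole_sharp by (metis sphere_cnj_cnj)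

lemma bounded_clinear_rat_calc: "s \<in> rat_algebra A \<Longrightarrow> bounded_clinear (rat_calc A s)"
  using nonreal_point calc_rel_rat_calc calc_rel_def by blast

lemma rat_calc_add: "s \<in> rat_algebra A \<Longrightarrow> s' \<in> rat_algebra A \<Longrightarrow> rat_calc A (s + s') x = rat_calc A s x + rat_calc A s' x"
  and rat_calc_mult: "s \<in> rat_algebra A \<Longrightarrow> s' \<in> rat_algebra A \<Longrightarrow> rat_calc A (s * s') x = rat_calc A s (rat_calc A s' x)"
proof -
  assume s: "s \<in> rat_algebra A" "s' \<in> rat_algebra A"
  obtain m where m: "Some m \<in> resolvent_set A" using nonreal_point by blast
  note B = resolvent_setD(1)[OF m]
  note c = calc_rel_rat_calc[OF m]
  show "rat_calc A (s + s') x = rat_calc A s x + rat_calc A s' x"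
    using calc_rel_unique[OF B c[OF rat_algebra_add[OF s]] calc_rel_add[OF B c[OF s(1)] c[OF s(2)]]] by (simp add: fun_eq_iff)
  show "rat_calc A (s * s') x = rat_calc A s (rat_calc A s' x)"
    using calc_rel_unique[OF B c[OF rat_algebra_mult[OF s]] calc_rel_mult[OF B c[OF s(1)] c[OF s(2)]]] by (simp add: fun_eq_iff)
qed

lemma rat_calc_scale:
  assumes "s \<in> rat_algebra A"
  shows "rat_calc A (Fract [:a:] 1 * s) x = a *\<^sub>C rat_calc A s x"
proof -
  obtain m where m: "Some m \<in> resolvent_set A" using nonreal_point by blast
  note B = resolvent_setD(1)[OF m]
  note c = calc_rel_rat_calc[OF m]
  show ?thesis
    using calc_rel_unique[OF B c[OF rat_algebra_mult[OF rat_algebra_const assms]] calc_rel_scale[OF B c[OF assms]]]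
    by (simp add: fun_eq_iff)
qed

lemma commutant_resolvent:
  assumes C: "C \<in> rel_commutant A" and m: "Some m \<in> resolvent_set A"
  shows "C (resolvent A (Some m) x) = resolvent A (Some m) (C x)"
proof -
  let ?B = "resolvent A (Some m)"
  have bC: "bounded_clinear C" and CA: "\<And>u v. (u, v) \<in> A \<Longrightarrow> (C u, C v) \<in> A"
    using C unfolding rel_commutant_def by auto
  have "(?B x, x + m *\<^sub>C ?B x) \<in> A" unfolding mem_iff_resolvent[OF m] by simp
  then have "(C (?B x), C (x + m *\<^sub>C ?B x)) \<in> A" by (rule CA)
  then show ?thesis unfolding mem_iff_resolvent[OF m]
    by (simp add: bounded_clinear_add_apply[OF bC] bounded_clinear_scale_apply[OF bC])
qed

lemma commutant_rat_calc:
  assumes C: "C \<in> rel_commutant A" and s: "s \<in> rat_algebra A"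
  shows "C (rat_calc A s x) = rat_calc A s (C x)"
proof -
  obtain m where m: "Some m \<in> resolvent_set A" using nonreal_point by blast
  have bC: "bounded_clinear C" using C by (simp add: rel_commutant_def)
  show ?thesis
    by (rule calc_rel_commute[OF resolvent_setD(1)[OF m] calc_rel_rat_calc[OF m s] bC commutant_resolvent[OF C m]])
qed

lemma resolvent_rat_calc:
  assumes \<alpha>: "\<alpha> \<in> resolvent_set A" and s: "s \<in> rat_algebra A"
  shows "resolvent A \<alpha> (rat_calc A s x) = rat_calc A s (resolvent A \<alpha> x)"
proof -
  obtain m where m: "Some m \<in> resolvent_set A" using nonreal_point by blast
  note B = resolvent_setD(1)[OF m]
  have "\<exists>r. calc_rel (resolvent A (Some m)) m r (resolvent A \<alpha>)"
    using calc_rel_resolvent[OF m] calc_rel_resolvent_None[OF m] \<alpha> by (cases \<alpha>) auto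
  then obtain r where r: "calc_rel (resolvent A (Some m)) m r (resolvent A \<alpha>)" by blast
  have "resolvent A \<alpha> (resolvent A (Some m) x) = resolvent A (Some m) (resolvent A \<alpha> x)" for x
    using calc_rel_commute[OF B r B] by simp
  then show ?thesis
    by (rule calc_rel_commute[OF B calc_rel_rat_calc[OF m s] resolvent_setD(1)[OF \<alpha>]])
qed

text \<open>As T is injective, membership in \<open>H\<close> can be tested after applying T, where
  the lift of the resolvent of \<open>A\<close> satisfies the resolvent equation.\<close>

lemma resolvent_lift:
  assumes \<alpha>: "\<alpha> \<in> resolvent_set A"
  shows "\<alpha> \<in> resolvent_set H" and "T (resolvent H \<alpha> u) = resolvent A \<alpha> (T u)"
proof -
  let ?R = "resolvent A \<alpha>"
  obtain S where S: "bounded_clinear S" "\<And>u. T (S u) = ?R (T u)"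
    by (rule lift_exists[OF resolvent_setD(1)[OF \<alpha>] resolvent_setD(1)[OF resolvent_cnj[OF \<alpha>]] resolvent_adj[OF \<alpha>]])
      (simp_all add: TTp resolvent_rat_calc[OF _ q_algebra] \<alpha> resolvent_cnj)
  have "\<alpha> \<in> resolvent_set H \<and> resolvent H \<alpha> = S"
  proof (cases \<alpha>)
    case None
    have "(u, v) \<in> H \<longleftrightarrow> S u = v" for u v
    proof -
      have "(u, v) \<in> H \<longleftrightarrow> T (S u) = T v"
        using mem_iff_resolvent_None[of A] \<alpha> None by (simp add: rel_preimage_def S(2))
      then show ?thesis using T_eqD by auto
    qed
    from resolvent_set_NoneI[OF S(1) this] show ?thesis using None by simp
  next
    case (Some a)
    have "(u, v) \<in> H \<longleftrightarrow> S (v - a *\<^sub>C u) = u" for u v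
    proof -
      have "(u, v) \<in> H \<longleftrightarrow> T (S (v - a *\<^sub>C u)) = T u"
        using mem_iff_resolvent[of a A] \<alpha> Some
        by (simp add: rel_preimage_def S(2) bounded_clinear_diff_apply[OF T] bounded_clinear_scale_apply[OF T])
      then show ?thesis using T_eqD by auto
    qed
    from resolvent_setI[OF S(1) this] show ?thesis using Some by simp
  qed
  then show "\<alpha> \<in> resolvent_set H" "T (resolvent H \<alpha> u) = ?R (T u)" using S(2) by auto
qed

lemma spectrum_subset: "spectrum H \<subseteq> spectrum A"
  using resolvent_lift(1) unfolding spectrum_def by blast

lemma H_subspace: "csubspace H"
proof (rule cv.subspaceI)
  show "0 \<in> H" using cv.subspace_0[OF subspace]
    by (simp add: rel_preimage_def zero_prod_def bounded_clinear_zero_apply[OF T])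
  show "x + y \<in> H" if "x \<in> H" "y \<in> H" for x y
    using that cv.subspace_add[OF subspace, of "(T (fst x), T (snd x))" "(T (fst y), T (snd y))"]
    by (auto simp: rel_preimage_def bounded_clinear_add_apply[OF T])
  show "c *\<^sub>C x \<in> H" if "x \<in> H" for c x
    using that cv.subspace_scale[OF subspace, of "(T (fst x), T (snd x))" c]
    by (auto simp: rel_preimage_def bounded_clinear_scale_apply[OF T] scaleC_prod_def)
qed

text \<open>Resolvents of \<open>H\<close> also intertwine along \<open>Tp\<close>, because T Tp =
  q(A) commutes with the resolvents of \<open>A\<close>. The adjoint and its candidate are then
  compared after applying T, by means of the form on the Krein space.\<close>

lemma resolvent_H_adj:
  assumes \<alpha>: "\<alpha> \<in> resolvent_set A"
  shows "cinner (resolvent H \<alpha> x) y = cinner x (resolvent H (sphere_cnj \<alpha>) y)"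
proof -
  let ?S = "resolvent H \<alpha>" and ?S' = "resolvent H (sphere_cnj \<alpha>)"
  note \<alpha>' = resolvent_cnj[OF \<alpha>]
  note a = riesz_form_adjoint[OF riesz_form_cinner riesz_form_cinner resolvent_setD(1)[OF resolvent_lift(1)[OF \<alpha>']]]
  let ?Q = "adj cinner cinner ?S'"
  have S'Tp: "?S' (Tp k) = Tp (resolvent A (sphere_cnj \<alpha>) k)" for k
    by (rule T_eqD) (simp add: resolvent_lift(2)[OF \<alpha>'] TTp resolvent_rat_calc[OF \<alpha>' q_algebra])
  have Qy: "cinner u (?Q x) = cinner (?S' u) x" for u x using a by simp
  have "?Q x = ?S x"
  proof (rule T_eqD, rule riesz_form_eqI[OF rf])
    fix k
    have "ip k (T (?Q x)) = cinner (Tp k) (?Q x)" by (rule Tp_adj)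
    also have "\<dots> = cinner (Tp (resolvent A (sphere_cnj \<alpha>) k)) x" unfolding Qy S'Tp ..
    also have "\<dots> = ip (resolvent A (sphere_cnj \<alpha>) k) (T x)" by (rule Tp_adj[symmetric])
    also have "\<dots> = ip k (T (?S x))" using resolvent_adj[OF \<alpha>', of k "T x"] by (simp add: resolvent_lift(2)[OF \<alpha>])
    finally show "ip k (T (?Q x)) = ip k (T (?S x))" .
  qed
  then show ?thesis using Qy[of y x] cinner_cnj[of y "?Q x"] cinner_cnj[of "?S' y" x] by simp
qed

text \<open>\<open>H\<close> is parametrized by its resolvent S at m, so its adjoint consists of the
  (x, y) with S' (y - cnj m x) = x, where S' is the adjoint of S. As S' is the resolvent at cnj m,
  these are the elements of \<open>H\<close>.\<close>

lemma H_selfadjoint: "rel_adj cinner H = H"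
proof -
  obtain m where m: "Some m \<in> resolvent_set A" using nonreal_point by blast
  have m': "Some (cnj m) \<in> resolvent_set A" using resolvent_cnj[OF m] by simp
  let ?S = "resolvent H (Some m)" and ?S' = "resolvent H (Some (cnj m))"
  have g: "(u, v) \<in> H \<longleftrightarrow> ?S (v - m *\<^sub>C u) = u" for u v by (rule mem_iff_resolvent[OF resolvent_lift(1)[OF m]])
  have g': "(u, v) \<in> H \<longleftrightarrow> ?S' (v - cnj m *\<^sub>C u) = u" for u v by (rule mem_iff_resolvent[OF resolvent_lift(1)[OF m']])
  have SS: "cinner (?S' x) y = cinner x (?S y)" for x y using resolvent_H_adj[OF m', of x y] by simp
  have "(x, y) \<in> rel_adj cinner H \<longleftrightarrow> (x, y) \<in> H" for x y
  proof -
    have "(x, y) \<in> rel_adj cinner H \<longleftrightarrow> (\<forall>h. cinner x (h + m *\<^sub>C ?S h) = cinner y (?S h))"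
    proof
      assume *: "(x, y) \<in> rel_adj cinner H"
      have "(?S h, h + m *\<^sub>C ?S h) \<in> H" for h unfolding g by simp
      then show "\<forall>h. cinner x (h + m *\<^sub>C ?S h) = cinner y (?S h)" using * unfolding rel_adj_def by blast
    next
      assume *: "\<forall>h. cinner x (h + m *\<^sub>C ?S h) = cinner y (?S h)"
      show "(x, y) \<in> rel_adj cinner H" unfolding rel_adj_def
      proof safe
        fix u v
        assume "(u, v) \<in> H"
        then show "cinner x v = cinner y u" using *[rule_format, of "v - m *\<^sub>C u"] unfolding g by simp
      qed
    qed
    also have "\<dots> \<longleftrightarrow> (\<forall>h. cinner (?S' (y - cnj m *\<^sub>C x)) h = cinner x h)"
      unfolding SS by (simp add: cinner_simps algebra_simps) metis
    also have "\<dots> \<longleftrightarrow> ?S' (y - cnj m *\<^sub>C x) = x"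
    proof
      assume *: "\<forall>h. cinner (?S' (y - cnj m *\<^sub>C x)) h = cinner x h"
      show "?S' (y - cnj m *\<^sub>C x) = x"
      proof (rule riesz_form_eqI[OF riesz_form_cinner])
        show "cinner h (?S' (y - cnj m *\<^sub>C x)) = cinner h x" for h
          using *[rule_format, of h] cinner_cnj[of "?S' (y - cnj m *\<^sub>C x)" h] cinner_cnj[of x h] by simp
      qed
    qed simp
    also have "\<dots> \<longleftrightarrow> (x, y) \<in> H" by (rule g'[symmetric])
    finally show ?thesis .
  qed
  then show ?thesis by auto
qed

lemma spectrum_H_real: "spectrum H \<subseteq> ext_real"
proof
  fix t
  assume t: "t \<in> spectrum H"
  show "t \<in> ext_real"
  proof (cases t)
    case (Some z)
    have "Im z = 0"
      using selfadjoint_nonreal_resolvent[OF H_selfadjoint H_subspace, of z] t Some by (auto simp: spectrum_def)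
    then show ?thesis using Some by (simp add: ext_real_def complex_is_Real_iff)
  qed (simp add: ext_real_def)
qed

sublocale supported_projection_valued E "spectrum H"
  by standard (use E spectrum_H_real spectrum_sphere_borel in \<open>auto simp: spectral_measure_of_def\<close>)

section \<open>Spectral integrals of rational functions\<close>

lemma J_moebius:
  assumes "Some z \<in> resolvent_set A"
  shows "T (J (moebius_point z) u) = resolvent A (Some z) (T u)"
proof -
  have "moebius_point z = (\<lambda>t. case t of None \<Rightarrow> 0 | Some t \<Rightarrow> 1 / (t - z))" by (simp add: moebius_point_def fun_eq_iff)
  then have "J (moebius_point z) = resolvent H (Some z)"
    using E resolvent_lift(1)[OF assms] by (simp add: spectral_measure_of_def)
  then show ?thesis by (simp add: resolvent_lift(2)[OF assms])
qed

lemma bounded_borel_spectrum_H: "f \<in> bounded_borel_on (spectrum A) \<Longrightarrow> f \<in> bounded_borel_on (spectrum H)"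
  using bounded_borel_on_subset spectrum_subset by blast

lemma rat_eval_borel: "s \<in> rat_algebra A \<Longrightarrow> rat_eval s \<in> bounded_borel_on (spectrum A)"
  using nonreal_point rat_eval_bounded_borel by blast

text \<open>The case of w = 1 / (t - m) is the defining formula of the spectral measure, and
  polynomials in w follow. For s = N / D the transformed D times s agrees with the transformed N on
  the spectrum, and the invertible operator of the denominator is cancelled.\<close>

lemma T_J_rat_eval:
  assumes s: "s \<in> rat_algebra A"
  shows "T (J (rat_eval s) u) = rat_calc A s (T u)"
proof -
  obtain m where m0: "Im m \<noteq> 0" and m: "Some m \<in> resolvent_set A" using nonreal_point by blast
  define B where "B = resolvent A (Some m)"
  have bB: "bounded_clinear B" unfolding B_def by (rule resolvent_setD(1)[OF m])
  have bb: "moebius_point m \<in> bounded_borel_on (spectrum H)"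
    by (rule moebius_point_bounded_borel[OF m0 spectrum_H_real])
  have pb: "(\<lambda>t. poly p (moebius_point m t)) \<in> bounded_borel_on (spectrum H)" for p
    by (induction p) (auto intro!: bounded_borel_on_const bounded_borel_on_add bounded_borel_on_mult bb)
  have Tp: "T (J (\<lambda>t. poly p (moebius_point m t)) v) = poly_op B p (T v)" for p v
  proof (induction p arbitrary: v)
    case 0
    show ?case using spectral_integral_scale[OF bounded_borel_on_const, of 0 1 v]
      by (simp add: bounded_clinear_zero_apply[OF T])
  next
    case (pCons a p)
    have ca: "(\<lambda>t. a) \<in> bounded_borel_on (spectrum H)" by (rule bounded_borel_on_const)
    have Ja: "J (\<lambda>t. a) v = a *\<^sub>C v"
      using spectral_integral_scale[OF bounded_borel_on_const, of a 1 v] spectral_integral_1 by simp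
    have "J (\<lambda>t. poly (pCons a p) (moebius_point m t)) v
        = a *\<^sub>C v + J (moebius_point m) (J (\<lambda>t. poly p (moebius_point m t)) v)"
      using spectral_integral_add[OF ca bounded_borel_on_mult[OF bb pb], of p v] spectral_integral_mult[OF bb pb, of p v] Ja
      by simp
    then show ?case
      by (simp add: bounded_clinear_add_apply[OF T] bounded_clinear_scale_apply[OF T] J_moebius[OF m] pCons.IH
          poly_op_pCons[OF bB] flip: B_def)
  qed
  obtain N D n where D: "D \<noteq> 0" and sND: "s = Fract N D" and n: "degree N \<le> n" "degree D \<le> n"
    and inv: "invertible_op (poly_op B (moebius_poly m n D))"
    and eq: "\<And>x. poly_op B (moebius_poly m n D) (rat_calc A s x) = poly_op B (moebius_poly m n N) x"
    using calc_rel_rat_calc[OF m s] unfolding B_def[symmetric] by (rule calc_relE) blast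
  have rs: "rat_eval s \<in> bounded_borel_on (spectrum H)" by (intro bounded_borel_spectrum_H rat_eval_borel s)
  have "poly (moebius_poly m n D) (moebius_point m t) * rat_eval s t = poly (moebius_poly m n N) (moebius_point m t)"
    if t: "t \<in> spectrum H" for t
  proof -
    have t': "t \<in> spectrum A" using t spectrum_subset by blast
    have "t \<noteq> Some m" using m t' by (auto simp: spectrum_def)
    then show ?thesis
      using rat_eval_moebius[OF sND D n] spectrum_poly_nonzero[OF m t'] inv unfolding B_def by simp
  qed
  then have "J (\<lambda>t. poly (moebius_poly m n D) (moebius_point m t) * rat_eval s t) = J (\<lambda>t. poly (moebius_poly m n N) (moebius_point m t))"
    by (rule spectral_integral_cong)
  then have "J (\<lambda>t. poly (moebius_poly m n D) (moebius_point m t)) (J (rat_eval s) u) = J (\<lambda>t. poly (moebius_poly m n N) (moebius_point m t)) u"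
    using spectral_integral_mult[OF pb rs] by metis
  then have "poly_op B (moebius_poly m n D) (T (J (rat_eval s) u)) = poly_op B (moebius_poly m n N) (T u)"
    unfolding Tp[symmetric] by simp
  then show ?thesis using eq[of "T u"] invertible_op_inj[OF inv] by metis
qed

lemma Tp_rat_calc:
  assumes s: "s \<in> rat_algebra A"
  shows "Tp (rat_calc A s x) = J (rat_eval s) (Tp x)"
proof (rule T_eqD)
  have "rat_calc A q (rat_calc A s x) = rat_calc A s (rat_calc A q x)"
    using rat_calc_mult[OF s q_algebra, of x] rat_calc_mult[OF q_algebra s, of x] by (simp add: mult.commute)
  then show "T (Tp (rat_calc A s x)) = T (J (rat_eval s) (Tp x))" by (simp add: TTp T_J_rat_eval[OF s])
qed

text \<open>After applying the injective T both sides become q(A) T u.\<close>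

lemma Tp_T: "Tp (T u) = J (rat_eval q) u"
  by (rule T_eqD) (simp add: TTp T_J_rat_eval[OF q_algebra])

text \<open>Taking adjoints in D(B) R = N(B) gives the corresponding equation with conjugated
  polynomials in the resolvent at cnj m; there it characterizes the operator of
  \<open>rat_sharp s\<close>.\<close>

lemma rat_calc_adj:
  assumes s: "s \<in> rat_algebra A"
  shows "ip (rat_calc A s x) y = ip x (rat_calc A (rat_sharp s) y)"
proof -
  obtain m where m: "Some m \<in> resolvent_set A" using nonreal_point by blast
  have m': "Some (cnj m) \<in> resolvent_set A" using resolvent_cnj[OF m] by simp
  define B B' where "B = resolvent A (Some m)" and "B' = resolvent A (Some (cnj m))"
  have bB: "bounded_clinear B" and bB': "bounded_clinear B'"
    unfolding B_def B'_def by (intro resolvent_setD(1) m m')+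
  have BB: "ip (B x) y = ip x (B' y)" for x y using resolvent_adj[OF m] by (simp add: B_def B'_def)
  have pBB: "ip (poly_op B p x) y = ip x (poly_op B' (map_poly cnj p) y)" for p x y
  proof (induction p arbitrary: x y)
    case 0
    show ?case by (simp add: hermitian_form_simps[OF herm])
  next
    case (pCons a p)
    then show ?case
      using poly_op_commute[OF bB' bB' bB' refl, of "map_poly cnj p" y]
      by (simp add: poly_op_pCons[OF bB] poly_op_pCons[OF bB'] map_poly_pCons hermitian_form_simps[OF herm] BB)
  qed
  have mc: "moebius_poly (cnj m) n (map_poly cnj N) = map_poly cnj (moebius_poly m n N)" if "degree N \<le> n" for n N
  proof (rule poly_eqI_nonzero)
    fix w :: complex
    assume "w \<noteq> 0"
    have p: "poly (map_poly cnj P) u = cnj (poly P (cnj u))" for P u by simp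
    show "poly (moebius_poly (cnj m) n (map_poly cnj N)) w = poly (map_poly cnj (moebius_poly m n N)) w"
      using \<open>w \<noteq> 0\<close> that by (simp add: p poly_moebius_poly degree_cnj_poly)
  qed
  define R where "R = rat_calc A s"
  have bR: "bounded_clinear R" unfolding R_def by (rule bounded_clinear_rat_calc[OF s])
  define R' where "R' = adj ip ip R"
  have bR': "bounded_clinear R'" and RR': "ip (R u) y = ip u (R' y)" for u y
    using riesz_form_adjoint[OF rf rf bR] unfolding R'_def by auto
  obtain N D n where D: "D \<noteq> 0" and sND: "s = Fract N D" and n: "degree N \<le> n" "degree D \<le> n"
    and inv: "invertible_op (poly_op B (moebius_poly m n D))"
    and eq: "\<And>x. poly_op B (moebius_poly m n D) (R x) = poly_op B (moebius_poly m n N) x"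
    using calc_rel_rat_calc[OF m s] unfolding B_def[symmetric] R_def[symmetric] by (rule calc_relE) blast
  \<comment> \<open>Adjoints reverse products, so D(B) has to be brought to the other side of R
    beforehand.\<close>
  have Rp: "R (poly_op B p x) = poly_op B p (R x)" for p x
    using calc_rel_poly_op[OF bB] calc_rel_rat_calc[OF m s] unfolding B_def R_def by blast
  have "calc_rel B' (cnj m) (rat_sharp s) R'"
  proof (rule calc_relI[of _ "map_poly cnj D" _ "map_poly cnj N" n])
    let ?P = "poly_op B (moebius_poly m n D)" and ?P' = "poly_op B' (moebius_poly (cnj m) n (map_poly cnj D))"
    have PP: "ip (?P x) y = ip x (?P' y)" for x y unfolding mc[OF n(2)] by (rule pBB)
    obtain Q where Q: "bounded_clinear Q" "?P \<circ> Q = id" "Q \<circ> ?P = id" using inv unfolding invertible_op_def by blast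
    define Q' where "Q' = adj ip ip Q"
    have bQ': "bounded_clinear Q'" and QQ': "ip (Q u) y = ip u (Q' y)" for u y
      using riesz_form_adjoint[OF rf rf Q(1)] unfolding Q'_def by auto
    have q1: "?P (Q x) = x" and q2: "Q (?P x) = x" for x using Q(2,3) by (metis comp_apply id_apply)+
    have "?P' (Q' x) = x" for x
      by (rule riesz_form_eqI[OF rf]) (simp add: q2 flip: PP QQ')
    moreover have "Q' (?P' x) = x" for x
      by (rule riesz_form_eqI[OF rf]) (simp add: q1 flip: PP QQ')
    ultimately show "invertible_op ?P'"
      unfolding invertible_op_def using bQ' bounded_clinear_poly_op[OF bB'] by (auto simp: fun_eq_iff)
    show "?P' (R' y) = poly_op B' (moebius_poly (cnj m) n (map_poly cnj N)) y" for y
    proof (rule riesz_form_eqI[OF rf])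
      fix x
      have "ip x (?P' (R' y)) = ip (R (?P x)) y" unfolding PP[symmetric] RR'[symmetric] ..
      also have "\<dots> = ip (poly_op B (moebius_poly m n N) x) y" unfolding Rp eq ..
      finally show "ip x (?P' (R' y)) = ip x (poly_op B' (moebius_poly (cnj m) n (map_poly cnj N)) y)"
        unfolding mc[OF n(1)] pBB .
    qed
  qed (use bR' D sND n in \<open>auto simp: rat_sharp_Fract degree_cnj_poly cnj_poly_eq_0_iff\<close>)
  then have "R' = rat_calc A (rat_sharp s)"
    using calc_rel_unique[OF bB'] calc_rel_rat_calc[OF m' rat_sharp_algebra[OF s]] unfolding B'_def by blast
  then show ?thesis using RR' unfolding R_def by simp
qed

end

text \<open>Real polynomials on the plane start from real linear functionals. These are expressed by
  w and cnj w because, for w = 1 / (t - m) with t real, both have resolvents as spectral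
  integrals.\<close>

lemma real_linear_complex:
  assumes "bounded_linear h"
  shows "complex_of_real (h w) = (of_real (h 1) - \<i> * of_real (h \<i>)) / 2 * w + (of_real (h 1) + \<i> * of_real (h \<i>)) / 2 * cnj w"
proof -
  have "h w = h (Re w *\<^sub>R 1 + Im w *\<^sub>R \<i>)" by (rule arg_cong[of _ _ h]) (simp add: complex_eq_iff)
  also have "\<dots> = Re w * h 1 + Im w * h \<i>"
    using bounded_linear.linear[OF assms] by (simp add: linear_add linear_scale)
  finally show ?thesis by (simp add: complex_eq_iff field_simps)
qed

section \<open>The operators s(A) + T J(g) T^+ and the bicommutant\<close>

context definitizable_setting
begin

lemma calc_op_apply: "calc_op ip A T E s g x = rat_calc A s x + T (J g (Tp x))"
  by (simp add: calc_op_def)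

lemma bounded_clinear_calc_op:
  assumes "s \<in> rat_algebra A" "g \<in> bounded_borel_on (spectrum A)"
  shows "bounded_clinear (calc_op ip A T E s g)"
proof -
  have "bounded_clinear (\<lambda>x. rat_calc A s x + (T \<circ> (J g \<circ> Tp)) x)"
    by (intro bounded_clinear_intros bounded_clinear_rat_calc T Tp bounded_clinear_spectral_integral
        bounded_borel_spectrum_H assms)
  then show ?thesis by (simp add: calc_op_apply[abs_def])
qed

text \<open>On the extended real line the conjugate of 1 / (t - m) is 1 / (t - cnj m), so the
  generators integrate to resolvents. \<open>G\<close> is the same polynomial in the resolvents of
  \<open>A\<close>; intertwining along T and commuting with \<open>C\<close> both survive sums and
  compositions.\<close>

lemma polynomial_lift:
  assumes p: "real_polynomial_function p" and C: "C \<in> rel_commutant A"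
    and m: "Im m \<noteq> 0" "Some m \<in> resolvent_set A"
  shows "(\<lambda>t. complex_of_real (p (moebius_point m t))) \<in> bounded_borel_on (spectrum H) \<and>
    (\<exists>G. (\<forall>u. T (J (\<lambda>t. of_real (p (moebius_point m t))) u) = G (T u)) \<and> (\<forall>x. C (G x) = G (C x)))"
  using p
proof (induction p rule: real_polynomial_function.induct)
  case (linear h)
  have bC: "bounded_clinear C" using C by (simp add: rel_commutant_def)
  define \<alpha> \<beta> where "\<alpha> = (of_real (h 1) - \<i> * of_real (h \<i>)) / 2" and "\<beta> = (of_real (h 1) + \<i> * of_real (h \<i>)) / 2"
  have h: "complex_of_real (h w) = \<alpha> * w + \<beta> * cnj w" for w
    unfolding \<alpha>_def \<beta>_def by (rule real_linear_complex[OF linear])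
  have m': "Some (cnj m) \<in> resolvent_set A" using resolvent_cnj[OF m(2)] by simp
  have b: "moebius_point m \<in> bounded_borel_on (spectrum H)"
    by (rule moebius_point_bounded_borel[OF m(1) spectrum_H_real])
  have b': "moebius_point (cnj m) \<in> bounded_borel_on (spectrum H)"
    using m(1) by (intro moebius_point_bounded_borel spectrum_H_real) simp
  have c: "cnj (moebius_point m t) = moebius_point (cnj m) t" if "t \<in> spectrum H" for t
  proof -
    have "t \<in> ext_real" using that spectrum_H_real by blast
    then show ?thesis by (cases rule: ext_real_cases) auto
  qed
  have "J (\<lambda>t. of_real (h (moebius_point m t))) = J (\<lambda>t. \<alpha> * moebius_point m t + \<beta> * moebius_point (cnj m) t)"
    by (rule spectral_integral_cong) (simp add: h c)
  then have "T (J (\<lambda>t. of_real (h (moebius_point m t))) u)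
      = \<alpha> *\<^sub>C resolvent A (Some m) (T u) + \<beta> *\<^sub>C resolvent A (Some (cnj m)) (T u)" for u
    using spectral_integral_add[OF bounded_borel_on_mult[OF bounded_borel_on_const b] bounded_borel_on_mult[OF bounded_borel_on_const b'], of \<alpha> \<beta> u]
    by (simp add: spectral_integral_scale b b' bounded_clinear_add_apply[OF T] bounded_clinear_scale_apply[OF T]
        J_moebius m m')
  moreover have "C (\<alpha> *\<^sub>C resolvent A (Some m) x + \<beta> *\<^sub>C resolvent A (Some (cnj m)) x)
      = \<alpha> *\<^sub>C resolvent A (Some m) (C x) + \<beta> *\<^sub>C resolvent A (Some (cnj m)) (C x)" for x
    by (simp add: bounded_clinear_add_apply[OF bC] bounded_clinear_scale_apply[OF bC] commutant_resolvent[OF C] m m')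
  moreover have "(\<lambda>t. complex_of_real (h (moebius_point m t))) \<in> bounded_borel_on (spectrum H)"
    unfolding h by (intro bounded_borel_on_add bounded_borel_on_mult bounded_borel_on_const bounded_borel_on_cnj b)
  ultimately show ?case
    by (intro conjI exI[of _ "\<lambda>x. \<alpha> *\<^sub>C resolvent A (Some m) x + \<beta> *\<^sub>C resolvent A (Some (cnj m)) x"]) auto
next
  case (const a)
  have bC: "bounded_clinear C" using C by (simp add: rel_commutant_def)
  have "J (\<lambda>t. complex_of_real a) u = of_real a *\<^sub>C u" for u
    using spectral_integral_scale[OF bounded_borel_on_const, of "of_real a" 1 u] spectral_integral_1 by simp
  then show ?case
    by (intro conjI bounded_borel_on_const exI[of _ "\<lambda>x. of_real a *\<^sub>C x"])
      (simp_all add: bounded_clinear_scale_apply[OF T] bounded_clinear_scale_apply[OF bC])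
next
  case (add f g)
  have bC: "bounded_clinear C" using C by (simp add: rel_commutant_def)
  obtain F G where f: "(\<lambda>t. complex_of_real (f (moebius_point m t))) \<in> bounded_borel_on (spectrum H)"
      "\<forall>u. T (J (\<lambda>t. of_real (f (moebius_point m t))) u) = F (T u)" "\<forall>x. C (F x) = F (C x)"
    and g: "(\<lambda>t. complex_of_real (g (moebius_point m t))) \<in> bounded_borel_on (spectrum H)"
      "\<forall>u. T (J (\<lambda>t. of_real (g (moebius_point m t))) u) = G (T u)" "\<forall>x. C (G x) = G (C x)"
    using add.IH by blast
  have "T (J (\<lambda>t. of_real (f (moebius_point m t) + g (moebius_point m t))) u) = F (T u) + G (T u)" for u
    using spectral_integral_add[OF f(1) g(1), of u] f(2) g(2) by (simp add: bounded_clinear_add_apply[OF T])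
  then show ?case using bounded_borel_on_add[OF f(1) g(1)] f(3) g(3)
    by (intro conjI exI[of _ "\<lambda>x. F x + G x"]) (simp_all add: bounded_clinear_add_apply[OF bC])
next
  case (mult f g)
  obtain F G where f: "(\<lambda>t. complex_of_real (f (moebius_point m t))) \<in> bounded_borel_on (spectrum H)"
      "\<forall>u. T (J (\<lambda>t. of_real (f (moebius_point m t))) u) = F (T u)" "\<forall>x. C (F x) = F (C x)"
    and g: "(\<lambda>t. complex_of_real (g (moebius_point m t))) \<in> bounded_borel_on (spectrum H)"
      "\<forall>u. T (J (\<lambda>t. of_real (g (moebius_point m t))) u) = G (T u)" "\<forall>x. C (G x) = G (C x)"
    using mult.IH by blast
  have "T (J (\<lambda>t. of_real (f (moebius_point m t) * g (moebius_point m t))) u) = F (G (T u))" for u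
    using spectral_integral_mult[OF f(1) g(1), of u] f(2) g(2) by simp
  then show ?case using bounded_borel_on_mult[OF f(1) g(1)] f(3) g(3)
    by (intro conjI exI[of _ "\<lambda>x. F (G x)"]) simp_all
qed

text \<open>Both sides are written as matrix coefficients of \<open>J g\<close> on the Hilbert space
  for two different pairs of vectors, one of them involving the Krein adjoint of \<open>C\<close>.
  It then suffices to know equality for real polynomials in the resolvents, where T J(p) Tp = G q(A)
  commutes with \<open>C\<close>.\<close>

lemma commutant_spectral_integral:
  assumes C: "C \<in> rel_commutant A" and g: "g \<in> bounded_borel_on (spectrum A)"
  shows "C (T (J g (Tp x))) = T (J g (Tp (C x)))"
proof (rule ip_eqI)
  fix k
  have bC: "bounded_clinear C" using C by (simp add: rel_commutant_def)
  define D where "D = adj ip ip C"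
  have D: "ip (C u) y = ip u (D y)" for u y using riesz_form_adjoint[OF rf rf bC] unfolding D_def by auto
  obtain m where m: "Im m \<noteq> 0" "Some m \<in> resolvent_set A" using nonreal_point by blast
  have "cinner (J g (Tp (C x))) (Tp k) = cinner (J g (Tp x)) (Tp (D k))"
  proof (rule cinner_spectral_integral_eqI[OF m(1) _ bounded_borel_spectrum_H[OF g]])
    fix p :: "complex \<Rightarrow> real"
    assume p: "real_polynomial_function p"
    let ?f = "\<lambda>t. complex_of_real (p (moebius_point m t))"
    obtain G where G: "\<And>u. T (J ?f u) = G (T u)" "\<And>x. C (G x) = G (C x)"
      using polynomial_lift[OF p C m] by blast
    have "T (J ?f (Tp (C x))) = C (T (J ?f (Tp x)))"
      by (simp add: G TTp commutant_rat_calc[OF C q_algebra])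
    then show "cinner (J ?f (Tp (C x))) (Tp k) = cinner (J ?f (Tp x)) (Tp (D k))"
      by (simp add: D flip: T_adj)
  qed
  then show "ip (C (T (J g (Tp x)))) k = ip (T (J g (Tp (C x)))) k" by (simp add: D T_adj)
qed

lemma calc_op_bicommutant:
  assumes s: "s \<in> rat_algebra A" and g: "g \<in> bounded_borel_on (spectrum A)"
  shows "calc_op ip A T E s g \<in> rel_bicommutant A"
proof -
  have "calc_op ip A T E s g (C x) = C (calc_op ip A T E s g x)" if C: "C \<in> rel_commutant A" for C x
  proof -
    have bC: "bounded_clinear C" using C by (simp add: rel_commutant_def)
    show ?thesis
      by (simp add: calc_op_apply bounded_clinear_add_apply[OF bC] commutant_rat_calc[OF C s] commutant_spectral_integral[OF C g])
  qed
  then show ?thesis using bounded_clinear_calc_op[OF s g] by (auto simp: rel_bicommutant_def fun_eq_iff)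
qed

lemma J_add: "f \<in> bounded_borel_on (spectrum A) \<Longrightarrow> g \<in> bounded_borel_on (spectrum A) \<Longrightarrow>
    J (\<lambda>t. f t + g t) u = J f u + J g u"
  by (intro spectral_integral_add bounded_borel_spectrum_H)

lemma J_scale: "f \<in> bounded_borel_on (spectrum A) \<Longrightarrow> J (\<lambda>t. c * f t) u = c *\<^sub>C J f u"
  by (intro spectral_integral_scale bounded_borel_spectrum_H)

lemma J_mult: "f \<in> bounded_borel_on (spectrum A) \<Longrightarrow> g \<in> bounded_borel_on (spectrum A) \<Longrightarrow>
    J (\<lambda>t. f t * g t) u = J f (J g u)"
  by (intro spectral_integral_mult bounded_borel_spectrum_H)

lemma calc_op_unique:
  assumes s: "s \<in> rat_algebra A" "s' \<in> rat_algebra A"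
    and g: "g \<in> bounded_borel_on (spectrum A)" "g' \<in> bounded_borel_on (spectrum A)"
    and eq: "compose_jet q A s g = compose_jet q A s' g'"
  shows "calc_op ip A T E s g = calc_op ip A T E s' g'"
proof
  fix x
  obtain k where k: "k \<in> rat_algebra A" "s = s' + k * q"
    and kg: "\<And>w. w \<in> spectrum A \<Longrightarrow> rat_eval k w = g' w - g w"
    using compose_jet_eqD[OF s q_algebra q_nonzero eq] by metis
  have kb: "rat_eval k \<in> bounded_borel_on (spectrum A)" by (rule rat_eval_borel[OF k(1)])
  have "rat_calc A s x = rat_calc A s' x + T (J (rat_eval k) (Tp x))"
    unfolding k(2) rat_calc_add[OF s(2) rat_algebra_mult[OF k(1) q_algebra]] rat_calc_mult[OF k(1) q_algebra]
      T_J_rat_eval[OF k(1)] TTp ..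
  moreover have "J (\<lambda>t. rat_eval k t + g t) = J g'"
    by (rule spectral_integral_cong) (use kg spectrum_subset in auto)
  then have "J g' (Tp x) = J (rat_eval k) (Tp x) + J g (Tp x)" using J_add[OF kb g(1)] by metis
  ultimately show "calc_op ip A T E s g x = calc_op ip A T E s' g' x"
    by (simp add: calc_op_apply bounded_clinear_add_apply[OF T])
qed

lemma fun_calc_compose_jet:
  assumes "s \<in> rat_algebra A" "g \<in> bounded_borel_on (spectrum A)"
  shows "fun_calc ip A q T E (compose_jet q A s g) = calc_op ip A T E s g"
  unfolding fun_calc_def
proof (rule the_equality)
  show "\<exists>s'\<in>rat_algebra A. \<exists>g'\<in>bounded_borel_on (spectrum A).
     compose_jet q A s g = compose_jet q A s' g' \<and> calc_op ip A T E s g = calc_op ip A T E s' g'"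
    using assms by blast
next
  fix X
  assume "\<exists>s'\<in>rat_algebra A. \<exists>g'\<in>bounded_borel_on (spectrum A).
     compose_jet q A s g = compose_jet q A s' g' \<and> X = calc_op ip A T E s' g'"
  then show "X = calc_op ip A T E s g" using calc_op_unique assms by metis
qed

lemma calc_op_add:
  assumes "s \<in> rat_algebra A" "s' \<in> rat_algebra A"
    and "g \<in> bounded_borel_on (spectrum A)" "g' \<in> bounded_borel_on (spectrum A)"
  shows "calc_op ip A T E (s + s') (\<lambda>t. g t + g' t) = (\<lambda>x. calc_op ip A T E s g x + calc_op ip A T E s' g' x)"
  by (rule ext) (simp add: calc_op_apply rat_calc_add J_add assms bounded_clinear_add_apply[OF T])

lemma calc_op_scale:
  assumes "s \<in> rat_algebra A" "g \<in> bounded_borel_on (spectrum A)"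
  shows "calc_op ip A T E (Fract [:a:] 1 * s) (\<lambda>t. a * g t) = (\<lambda>x. a *\<^sub>C calc_op ip A T E s g x)"
  by (rule ext) (simp add: calc_op_apply rat_calc_scale J_scale assms bounded_clinear_scale_apply[OF T] scaleC_add_right)

text \<open>The three terms beyond s(A) s'(A) are s(A) T J(g') Tp = T J(s g') Tp, then T J(g) Tp
  s'(A) = T J(g s') Tp, and T J(g) Tp T J(g') Tp = T J(g q g') Tp, the last one because Tp T =
  J(q).\<close>

lemma calc_op_mult:
  assumes s: "s \<in> rat_algebra A" "s' \<in> rat_algebra A"
    and g: "g \<in> bounded_borel_on (spectrum A)" "g' \<in> bounded_borel_on (spectrum A)"
  shows "calc_op ip A T E (s * s') (\<lambda>t. rat_eval s t * g' t + g t * rat_eval s' t + g t * g' t * rat_eval q t)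
    = calc_op ip A T E s g \<circ> calc_op ip A T E s' g'"
proof
  fix x
  let ?Jg = "J g" and ?Jg' = "J g'" and ?Js = "J (rat_eval s)" and ?Js' = "J (rat_eval s')" and ?Jq = "J (rat_eval q)"
  note b = rat_eval_borel[OF s(1)] rat_eval_borel[OF s(2)] rat_eval_borel[OF q_algebra]
  note m = bounded_borel_on_mult
  have gq: "J (\<lambda>t. g t * g' t * rat_eval q t) u = ?Jg (?Jq (?Jg' u))" for u
  proof -
    have "(\<lambda>t. g t * g' t * rat_eval q t) = (\<lambda>t. g t * (rat_eval q t * g' t))" by (simp add: mult_ac)
    then show ?thesis using J_mult[OF g(1) m[OF b(3) g(2)]] J_mult[OF b(3) g(2)] by simp
  qed
  have "J (\<lambda>t. rat_eval s t * g' t + g t * rat_eval s' t + g t * g' t * rat_eval q t) u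
      = ?Js (?Jg' u) + ?Jg (?Js' u) + ?Jg (?Jq (?Jg' u))" for u
    using J_add[OF bounded_borel_on_add[OF m[OF b(1) g(2)] m[OF g(1) b(2)]] m[OF m[OF g] b(3)], of u]
      J_add[OF m[OF b(1) g(2)] m[OF g(1) b(2)], of u] J_mult[OF b(1) g(2)] J_mult[OF g(1) b(2)] gq by simp
  then have "calc_op ip A T E (s * s') (\<lambda>t. rat_eval s t * g' t + g t * rat_eval s' t + g t * g' t * rat_eval q t) x
    = rat_calc A s (rat_calc A s' x) + T (?Js (?Jg' (Tp x))) + T (?Jg (?Js' (Tp x))) + T (?Jg (?Jq (?Jg' (Tp x))))"
    by (simp add: calc_op_apply rat_calc_mult[OF s] bounded_clinear_add_apply[OF T] add_ac)
  also have "\<dots> = rat_calc A s (rat_calc A s' x + T (?Jg' (Tp x))) + T (?Jg (Tp (rat_calc A s' x + T (?Jg' (Tp x)))))"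
    using bounded_clinear_spectral_integral[OF bounded_borel_spectrum_H[OF g(1)]]
    by (simp add: bounded_clinear_add_apply[OF bounded_clinear_rat_calc[OF s(1)]] bounded_clinear_add_apply[OF Tp]
        bounded_clinear_add_apply[OF T] bounded_clinear_add_apply T_J_rat_eval[OF s(1)] Tp_rat_calc[OF s(2)] Tp_T add_ac)
  finally show "calc_op ip A T E (s * s') (\<lambda>t. rat_eval s t * g' t + g t * rat_eval s' t + g t * g' t * rat_eval q t) x
    = (calc_op ip A T E s g \<circ> calc_op ip A T E s' g') x"
    by (simp add: calc_op_apply)
qed

text \<open>The reflection t \<mapsto> cnj t in \<open>jet_sharp\<close> may move points of the
  spectrum of \<open>A\<close>, but it fixes the spectrum of \<open>H\<close>, which is real. The
  integral therefore sees just the conjugation of the values.\<close>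

lemma calc_op_sharp:
  assumes s: "s \<in> rat_algebra A" and g: "g \<in> bounded_borel_on (spectrum A)"
  shows "calc_op ip A T E (rat_sharp s) (\<lambda>t. cnj (g (sphere_cnj t))) = adj ip ip (calc_op ip A T E s g)"
proof
  fix y
  have "sphere_cnj t = t" if "t \<in> spectrum H" for t
  proof -
    have "t \<in> ext_real" using that spectrum_H_real by blast
    then show ?thesis by (cases rule: ext_real_cases) auto
  qed
  then have J: "J (\<lambda>t. cnj (g (sphere_cnj t))) = J (\<lambda>t. cnj (g t))"
    by (intro spectral_integral_cong) simp
  have "ip (calc_op ip A T E s g x) y = ip x (calc_op ip A T E (rat_sharp s) (\<lambda>t. cnj (g (sphere_cnj t))) y)" for x
    using spectral_integral_cnj[OF bounded_borel_spectrum_H[OF g], of "Tp x" "Tp y"]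
    by (simp add: calc_op_apply J hermitian_form_add_left[OF herm] hermitian_form_add_right[OF herm]
        rat_calc_adj[OF s] T_adj Tp_adj)
  then show "calc_op ip A T E (rat_sharp s) (\<lambda>t. cnj (g (sphere_cnj t))) y = adj ip ip (calc_op ip A T E s g) y"
    by (intro adj_eqI[OF rf, symmetric])
qed

lemma calc_op_rational: "calc_op ip A T E s (\<lambda>t. 0) = rat_calc A s"
proof
  fix x
  \<comment> \<open>Writing the zero function as a multiple of the constant 1 lets the scaling rule
    deliver the zero integral.\<close>
  have "J (\<lambda>t. 0 * 1) (Tp x) = 0 *\<^sub>C J (\<lambda>t. 1) (Tp x)" by (intro J_scale bounded_borel_on_const)
  then show "calc_op ip A T E s (\<lambda>t. 0) x = rat_calc A s x"
    by (simp add: calc_op_apply bounded_clinear_zero_apply[OF T])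
qed

section \<open>The homomorphism on jet functions\<close>

lemma compose_jet_zero: "compose_jet q A s (\<lambda>t. 0) = jet_embed q A (rat_eval s)"
  by (simp add: compose_jet_def jet_add_def)

lemma F_algebraI:
  "s \<in> rat_algebra A \<Longrightarrow> g \<in> bounded_borel_on (spectrum A) \<Longrightarrow> compose_jet q A s g \<in> F_algebra q A"
  unfolding F_algebra_def by blast

lemma F_algebraE:
  assumes "\<phi> \<in> F_algebra q A"
  obtains s g where "s \<in> rat_algebra A" "g \<in> bounded_borel_on (spectrum A)" "\<phi> = compose_jet q A s g"
  using assms unfolding F_algebra_def by blast

lemma fun_calc_bicommutant: "\<phi> \<in> F_algebra q A \<Longrightarrow> fun_calc ip A q T E \<phi> \<in> rel_bicommutant A"
  by (elim F_algebraE) (simp add: fun_calc_compose_jet calc_op_bicommutant)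

lemma fun_calc_add:
  assumes "\<phi> \<in> F_algebra q A" "\<psi> \<in> F_algebra q A"
  shows "jet_add \<phi> \<psi> \<in> F_algebra q A \<and>
    fun_calc ip A q T E (jet_add \<phi> \<psi>) = (\<lambda>x. fun_calc ip A q T E \<phi> x + fun_calc ip A q T E \<psi> x)"
proof -
  obtain s g s' g' where 1: "s \<in> rat_algebra A" "g \<in> bounded_borel_on (spectrum A)" "\<phi> = compose_jet q A s g"
    and 2: "s' \<in> rat_algebra A" "g' \<in> bounded_borel_on (spectrum A)" "\<psi> = compose_jet q A s' g'"
    using assms by (elim F_algebraE)
  show ?thesis unfolding 1(3) 2(3) compose_jet_add[OF 1(1) 2(1)]
    using 1 2 by (simp add: F_algebraI fun_calc_compose_jet rat_algebra_add bounded_borel_on_add calc_op_add)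
qed

lemma fun_calc_scale:
  assumes "\<phi> \<in> F_algebra q A"
  shows "jet_scale a \<phi> \<in> F_algebra q A \<and>
    fun_calc ip A q T E (jet_scale a \<phi>) = (\<lambda>x. a *\<^sub>C fun_calc ip A q T E \<phi> x)"
proof -
  obtain s g where 1: "s \<in> rat_algebra A" "g \<in> bounded_borel_on (spectrum A)" "\<phi> = compose_jet q A s g"
    using assms by (elim F_algebraE)
  have "Fract [:a:] 1 * s \<in> rat_algebra A" "(\<lambda>t. a * g t) \<in> bounded_borel_on (spectrum A)"
    using 1 by (intro rat_algebra_mult rat_algebra_const bounded_borel_on_mult bounded_borel_on_const; simp)+
  then show ?thesis unfolding 1(3) compose_jet_scale[OF 1(1)]
    using 1 by (simp add: F_algebraI fun_calc_compose_jet calc_op_scale)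
qed

lemma fun_calc_mult:
  assumes "\<phi> \<in> F_algebra q A" "\<psi> \<in> F_algebra q A"
  shows "jet_mult q \<phi> \<psi> \<in> F_algebra q A \<and>
    fun_calc ip A q T E (jet_mult q \<phi> \<psi>) = fun_calc ip A q T E \<phi> \<circ> fun_calc ip A q T E \<psi>"
proof -
  obtain s g s' g' where 1: "s \<in> rat_algebra A" "g \<in> bounded_borel_on (spectrum A)" "\<phi> = compose_jet q A s g"
    and 2: "s' \<in> rat_algebra A" "g' \<in> bounded_borel_on (spectrum A)" "\<psi> = compose_jet q A s' g'"
    using assms by (elim F_algebraE)
  have b: "(\<lambda>t. rat_eval s t * g' t + g t * rat_eval s' t + g t * g' t * rat_eval q t) \<in> bounded_borel_on (spectrum A)"
    using 1 2 by (intro bounded_borel_on_add bounded_borel_on_mult rat_eval_borel q_algebra)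
  show ?thesis unfolding 1(3) 2(3) compose_jet_mult[OF 1(1) 2(1) q_algebra q_nonzero]
    using 1 2 b by (simp add: F_algebraI fun_calc_compose_jet rat_algebra_mult calc_op_mult)
qed

lemma fun_calc_sharp:
  assumes "\<phi> \<in> F_algebra q A"
  shows "jet_sharp \<phi> \<in> F_algebra q A \<and>
    fun_calc ip A q T E (jet_sharp \<phi>) = adj ip ip (fun_calc ip A q T E \<phi>)"
proof -
  obtain s g where 1: "s \<in> rat_algebra A" "g \<in> bounded_borel_on (spectrum A)" "\<phi> = compose_jet q A s g"
    using assms by (elim F_algebraE)
  have "(\<lambda>t. cnj (g (sphere_cnj t))) \<in> bounded_borel_on (spectrum A)"
    by (rule bounded_borel_on_sharp[OF 1(2) spectrum_cnj])
  moreover have e: "jet_sharp \<phi> = compose_jet q A (rat_sharp s) (\<lambda>t. cnj (g (sphere_cnj t)))"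
    unfolding 1(3) by (rule compose_jet_sharp[OF 1(1) q_algebra q_nonzero q_sharp spectrum_cnj])
  ultimately show ?thesis unfolding e unfolding 1(3)
    using 1 by (simp add: F_algebraI fun_calc_compose_jet rat_sharp_algebra calc_op_sharp)
qed

lemma fun_calc_rational:
  assumes "s \<in> rat_algebra A"
  shows "jet_embed q A (rat_eval s) \<in> F_algebra q A \<and>
    fun_calc ip A q T E (jet_embed q A (rat_eval s)) = rat_calc A s"
  unfolding compose_jet_zero[symmetric]
  using assms by (simp add: F_algebraI fun_calc_compose_jet bounded_borel_on_const calc_op_rational)

end

theorem theorem7p19:
  fixes ip :: "'k::complex_banach \<Rightarrow> 'k \<Rightarrow> complex"
    and A :: "('k \<times> 'k) set"
    and q :: "complex poly fract"
    and T :: "'v::complex_hilbert \<Rightarrow> 'k"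
    and E :: "sphere set \<Rightarrow> 'v \<Rightarrow> 'v"
  assumes "krein_space ip"
    and "csubspace A"
    and "rel_adj ip A = A"
    and "definitizable ip A"
    and "definitizing ip A q"
    and "rat_sharp q = q"
    and "q \<noteq> 0"
    and "bounded_clinear T"
    and "inj T"
    and "T \<circ> adj cinner ip T = rat_calc A q"
    and "spectral_measure_of (rel_preimage T A) E"
  shows
    "(\<forall>s\<in>rat_algebra A. \<forall>g\<in>bounded_borel_on (spectrum A).
        calc_op ip A T E s g \<in> rel_bicommutant A \<and>
        fun_calc ip A q T E (compose_jet q A s g) = calc_op ip A T E s g) \<and>
     (\<forall>s\<in>rat_algebra A. \<forall>s'\<in>rat_algebra A.
      \<forall>g\<in>bounded_borel_on (spectrum A). \<forall>g'\<in>bounded_borel_on (spectrum A).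
        compose_jet q A s g = compose_jet q A s' g' \<longrightarrow>
        calc_op ip A T E s g = calc_op ip A T E s' g') \<and>
     (\<forall>\<phi>\<in>F_algebra q A. fun_calc ip A q T E \<phi> \<in> rel_bicommutant A) \<and>
     (\<forall>\<phi>\<in>F_algebra q A. \<forall>\<psi>\<in>F_algebra q A.
        jet_add \<phi> \<psi> \<in> F_algebra q A \<and>
        fun_calc ip A q T E (jet_add \<phi> \<psi>) =
          (\<lambda>x. fun_calc ip A q T E \<phi> x + fun_calc ip A q T E \<psi> x)) \<and>
     (\<forall>a. \<forall>\<phi>\<in>F_algebra q A.
        jet_scale a \<phi> \<in> F_algebra q A \<and>
        fun_calc ip A q T E (jet_scale a \<phi>) = (\<lambda>x. a *\<^sub>C fun_calc ip A q T E \<phi> x)) \<and>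
     (\<forall>\<phi>\<in>F_algebra q A. \<forall>\<psi>\<in>F_algebra q A.
        jet_mult q \<phi> \<psi> \<in> F_algebra q A \<and>
        fun_calc ip A q T E (jet_mult q \<phi> \<psi>) = fun_calc ip A q T E \<phi> \<circ> fun_calc ip A q T E \<psi>) \<and>
     (\<forall>\<phi>\<in>F_algebra q A.
        jet_sharp \<phi> \<in> F_algebra q A \<and>
        fun_calc ip A q T E (jet_sharp \<phi>) = adj ip ip (fun_calc ip A q T E \<phi>)) \<and>
     (\<forall>s\<in>rat_algebra A.
        jet_embed q A (rat_eval s) \<in> F_algebra q A \<and>
        fun_calc ip A q T E (jet_embed q A (rat_eval s)) = rat_calc A s)"
proof -
  interpret definitizable_setting ip A q T E
    by (rule definitizable_setting.intro) (fact assms)+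
  show ?thesis
    by (intro conjI ballI allI impI;
        rule calc_op_bicommutant fun_calc_compose_jet calc_op_unique fun_calc_bicommutant
          fun_calc_add[THEN conjunct1] fun_calc_add[THEN conjunct2]
          fun_calc_scale[THEN conjunct1] fun_calc_scale[THEN conjunct2]
          fun_calc_mult[THEN conjunct1] fun_calc_mult[THEN conjunct2]
          fun_calc_sharp[THEN conjunct1] fun_calc_sharp[THEN conjunct2]
          fun_calc_rational[THEN conjunct1] fun_calc_rational[THEN conjunct2]; assumption)
qed

end
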